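(* Let $s_1,\dots,s_n$ be distinct points in $G$ and let $w_1,\dots,w_n\in\mathbb{D}^-$. There exists an analytic function $\varphi:G\to\mathbb{D}^-$ such that $\varphi(s_j)=w_j$ for $j=1,\dots,n$ if and only if there exist a Hilbert space $\mathcal{M}$, a contraction $T$ on $\mathcal{M}$ and vectors $v_1,\dots,v_n\in\mathcal{M}$ such that $$1-\overline{w_i}w_j=\left\langle\left(1-(s_i)_T^*(s_j)_T\right)v_j,v_i\right\rangle_{\mathcal{M}}$$ for $i,j=1,\dots,n$.
   Context: $\mathbb{D}$ is the open unit disc in $\mathbb{C}$ and $\mathbb{D}^-$ is its closure. The symmetrized bidisc is the open set $G=\{(z+w,zw): |z|<1,\ |w|<1\}\subset\mathbb{C}^2$. Superscripts denote components: $s=(s^1,s^2)$ for $s\in G$ (so $|s^1|<2$). Hilbert spaces are complex and operators are bounded and linear; a contraction is an operator of norm at most $1$. For $s\in G$ and a contraction $T$ on a Hilbert space $\mathcal{M}$, $s_T=(2s^2T-s^1)(2-s^1T)^{-1}$, an operator on $\mathcal{M}$; $(s_i)_T^*$ is the adjoint of $(s_i)_T$. *)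

theory Defs
  imports "HOL-Analysis.Analysis" "HOL-Algebra.Algebraic_Closure_Type"
begin

section \<open>Complex Hilbert spaces with an explicit carrier\<close>

text \<open>
  A Hilbert space has to be quantified existentially, so it is a record with a carrier set and not
  a type class. The vector space structure is that of a module over the field of complex numbers;
  the ring multiplication and unit that the record inherits are unused. The inner product is
  linear in its first argument. No condition is put on the operations outside the carrier.
\<close>

record 'a hilbert = "(complex, 'a) module" +
  ip :: "'a \<Rightarrow> 'a \<Rightarrow> complex"

definition hnorm :: "('a, 'b) hilbert_scheme \<Rightarrow> 'a \<Rightarrow> real"
  where "hnorm M x = sqrt (Re (ip M x x))"

text \<open>
  The locale \<^locale>\<open>Metric_space\<close> wants symmetry and nonnegativity of the distance on the
  whole type, hence the value 0 outside the carrier.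
\<close>

definition hdist :: "('a, 'b) hilbert_scheme \<Rightarrow> 'a \<Rightarrow> 'a \<Rightarrow> real"
  where "hdist M x y =
    (if x \<in> carrier M \<and> y \<in> carrier M then hnorm M (x \<ominus>\<^bsub>M\<^esub> y) else 0)"

locale hilbert_space = Module.module "ring_of_type_algebra :: complex ring" M
  for M :: "('a, 'b) hilbert_scheme" (structure) +
  assumes ip_add_left: "\<lbrakk>x \<in> carrier M; y \<in> carrier M; z \<in> carrier M\<rbrakk>
      \<Longrightarrow> ip M (x \<oplus> y) z = ip M x z + ip M y z"
    and ip_smult_left: "\<lbrakk>x \<in> carrier M; y \<in> carrier M\<rbrakk>
      \<Longrightarrow> ip M (c \<odot>\<^bsub>M\<^esub> x) y = c * ip M x y"
    and ip_commute: "\<lbrakk>x \<in> carrier M; y \<in> carrier M\<rbrakk> \<Longrightarrow> ip M x y = cnj (ip M y x)"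
    and ip_pos: "\<lbrakk>x \<in> carrier M; x \<noteq> \<zero>\<^bsub>M\<^esub>\<rbrakk> \<Longrightarrow> 0 < Re (ip M x x)"
    and complete: "Metric_space.mcomplete (carrier M) (hdist M)"

section \<open>Operators\<close>

definition linear_op :: "('a, 'b) hilbert_scheme \<Rightarrow> ('a \<Rightarrow> 'a) \<Rightarrow> bool"
  where "linear_op M A \<longleftrightarrow> A \<in> carrier M \<rightarrow> carrier M \<and>
    (\<forall>x\<in>carrier M. \<forall>y\<in>carrier M. A (x \<oplus>\<^bsub>M\<^esub> y) = A x \<oplus>\<^bsub>M\<^esub> A y) \<and>
    (\<forall>c. \<forall>x\<in>carrier M. A (c \<odot>\<^bsub>M\<^esub> x) = c \<odot>\<^bsub>M\<^esub> A x)"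

definition bounded_op :: "('a, 'b) hilbert_scheme \<Rightarrow> ('a \<Rightarrow> 'a) \<Rightarrow> bool"
  where "bounded_op M A \<longleftrightarrow>
    linear_op M A \<and> (\<exists>K. \<forall>x\<in>carrier M. hnorm M (A x) \<le> K * hnorm M x)"

definition op_norm :: "('a, 'b) hilbert_scheme \<Rightarrow> ('a \<Rightarrow> 'a) \<Rightarrow> real"
  where "op_norm M A = (SUP x\<in>{x \<in> carrier M. hnorm M x \<le> 1}. hnorm M (A x))"

definition contraction_op :: "('a, 'b) hilbert_scheme \<Rightarrow> ('a \<Rightarrow> 'a) \<Rightarrow> bool"
  where "contraction_op M A \<longleftrightarrow> bounded_op M A \<and> op_norm M A \<le> 1"

definition adjoint_op :: "('a, 'b) hilbert_scheme \<Rightarrow> ('a \<Rightarrow> 'a) \<Rightarrow> 'a \<Rightarrow> 'a"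
  where "adjoint_op M A y =
    (THE z. z \<in> carrier M \<and> (\<forall>x\<in>carrier M. ip M (A x) y = ip M x z))"

section \<open>The symmetrized bidisc\<close>

definition symm_bidisc :: "(complex \<times> complex) set"
  where "symm_bidisc = {(z + w, z * w) | z w. norm z < 1 \<and> norm w < 1}"

text \<open>
  The operator \<open>s\<^sub>T = (2 s\<^sup>2 T - s\<^sup>1) (2 - s\<^sup>1 T)\<^sup>-\<^sup>1\<close>, where the superscripts of \<open>s\<close> denote
  components. For \<open>s\<close> in the symmetrized bidisc and a contraction \<open>T\<close> the map inverted here is a
  bijection of the carrier.
\<close>

definition symm_op ::
    "('a, 'b) hilbert_scheme \<Rightarrow> complex \<times> complex \<Rightarrow> ('a \<Rightarrow> 'a) \<Rightarrow> 'a \<Rightarrow> 'a"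
  where "symm_op M s T x =
    (let y = inv_into (carrier M) (\<lambda>u. 2 \<odot>\<^bsub>M\<^esub> u \<ominus>\<^bsub>M\<^esub> fst s \<odot>\<^bsub>M\<^esub> T u) x
     in (2 * snd s) \<odot>\<^bsub>M\<^esub> T y \<ominus>\<^bsub>M\<^esub> fst s \<odot>\<^bsub>M\<^esub> y)"

text \<open>
  Analyticity of a function of two complex variables on an open set: at every point the function
  has a Frechet derivative that is complex linear.
\<close>

definition analytic2_on ::
    "(complex \<times> complex \<Rightarrow> complex) \<Rightarrow> (complex \<times> complex) set \<Rightarrow> bool"
  where "analytic2_on f S \<longleftrightarrow>
    (\<forall>p\<in>S. \<exists>a b. (f has_derivative (\<lambda>h. a * fst h + b * snd h)) (at p))"

text \<open>
  HOL cannot quantify over types, so the existence of a Hilbert space is asserted for one carrier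
  type. The type \<^typ>\<open>nat \<Rightarrow> complex\<close> has room for a copy of every separable Hilbert space, and in a
  model the space may be cut down to the closed span of the vectors \<open>T\<^sup>k v\<^sub>j\<close>, which is separable
  and invariant under \<open>T\<close>.
\<close>

definition interpolation_model ::
    "nat \<Rightarrow> (nat \<Rightarrow> complex \<times> complex) \<Rightarrow> (nat \<Rightarrow> complex) \<Rightarrow>
     ('a, 'b) hilbert_scheme \<Rightarrow> ('a \<Rightarrow> 'a) \<Rightarrow> (nat \<Rightarrow> 'a) \<Rightarrow> bool"
  where "interpolation_model n s w M T v \<longleftrightarrow>
    hilbert_space M \<and> contraction_op M T \<and> (\<forall>j\<in>{1..n}. v j \<in> carrier M) \<and>
    (\<forall>i\<in>{1..n}. \<forall>j\<in>{1..n}.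
      1 - cnj (w i) * w j =
      ip M (v j \<ominus>\<^bsub>M\<^esub> adjoint_op M (symm_op M (s i) T) (symm_op M (s j) T (v j))) (v i))"

end

theory Submission
  imports Defs "HOL-Complex_Analysis.Complex_Analysis" "HOL-Real_Asymp.Real_Asymp"
begin

text \<open>
  If a model is given, the Gram identity says that the vectors \<open>(1, (s\<^sub>j)\<^sub>T v\<^sub>j)\<close> and \<open>(w\<^sub>j, v\<^sub>j)\<close> of
  \<open>\<complex> \<oplus> M\<close> have the same Gram matrix. Hence a unitary with blocks \<open>a, b, c, d\<close> maps the former to the
  latter (it is a product of finitely many complex reflections), and \<open>\<phi> s = a + b s\<^sub>T (1 - d s\<^sub>T)\<^sup>-\<^sup>1 c\<close>
  interpolates; \<open>\<phi>\<close> is defined and bounded by 1 because \<open>s\<^sub>T\<close> is a strict contraction.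

  Conversely, \<open>f (z, w) = \<phi> (z + w, z w)\<close> is a symmetric function on the bidisc. Ando's inequality
  says that \<open>\<Sum>\<^sub>i\<^sub>j (1 - cnj (f i) * f j) * l i j \<ge> 0\<close> for every kernel \<open>l\<close> on finitely many points for
  which both coordinate multiplications are contractions. It is proved by dilating the two
  multiplications to commuting unitaries on cyclic sequences and averaging over roots of unity. By
  duality \<open>1 - cnj (f i) * f j\<close> has an Agler decomposition with positive semidefinite kernels \<open>\<Gamma>\<close>, \<open>\<Delta>\<close>:
  a pair that minimises the distance has residual 0. Symmetrising the decomposition gives vectors
  \<open>u (z, w)\<close>, and comparing the decompositions at \<open>((z, w), (z', w'))\<close> and \<open>((z, w), (w', z'))\<close> shows that
  \<open>z u (z, w) - w u (w, z) \<mapsto> u (z, w) - u (w, z)\<close> preserves inner products; a unitary extension of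
  this map is \<open>T\<close>.
\<close>

section \<open>Complex inner product spaces\<close>

text \<open>The carrier type \<open>nat \<Rightarrow> complex\<close> suffices because only finitely
  many points matter: each node contributes two points of the bidisc, and the converse ends in
  \<open>fn_space I\<close> for a finite \<open>I\<close>. An infinite dilation would leave this
  finite-dimensional setting. It is therefore cut off to cyclic sequences of length
  \<open>N\<close>: there the dilated multiplications still commute exactly, but they act correctly
  on the distinguished vectors only away from the end. Letting \<open>N\<close> grow removes the
  error. The link between the bidisc and \<open>s_T\<close> is \<open>symm_identity\<close>. For
  \<open>t = T u\<close> with \<open>T\<close> isometric it turns the defect of \<open>s_T\<close>
  into a sum with the factors \<open>1 - z * cnj z'\<close> and \<open>1 - w * cnj w'\<close>, the
  shape that duality produces; for a contraction \<open>T\<close> it gives the strict bound on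
  \<open>s_T\<close>. A given model may be infinite-dimensional, so the direction from model to
  function rests on completeness, through Riesz and a fixed point iteration. Extending a
  Gram-preserving map takes only reflections, so it is proved in \<open>inner_space\<close> and
  applies to \<open>complex_hsum M\<close> at once.\<close>

locale inner_space = Module.module "ring_of_type_algebra :: complex ring" M
  for M :: "('a, 'b) hilbert_scheme" (structure) +
  assumes ip_add_left: "\<lbrakk>x \<in> carrier M; y \<in> carrier M; z \<in> carrier M\<rbrakk>
      \<Longrightarrow> ip M (x \<oplus> y) z = ip M x z + ip M y z"
    and ip_smult_left: "\<lbrakk>x \<in> carrier M; y \<in> carrier M\<rbrakk>
      \<Longrightarrow> ip M (c \<odot>\<^bsub>M\<^esub> x) y = c * ip M x y"
    and ip_commute: "\<lbrakk>x \<in> carrier M; y \<in> carrier M\<rbrakk> \<Longrightarrow> ip M x y = cnj (ip M y x)"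
    and ip_pos: "\<lbrakk>x \<in> carrier M; x \<noteq> \<zero>\<^bsub>M\<^esub>\<rbrakk> \<Longrightarrow> 0 < Re (ip M x x)"

sublocale hilbert_space \<subseteq> inner_space
  by unfold_locales (auto intro: ip_add_left ip_smult_left ip_commute ip_pos)

lemma complex_ring_simps [simp]:
  "carrier (ring_of_type_algebra :: complex ring) = UNIV"
  "\<one>\<^bsub>ring_of_type_algebra :: complex ring\<^esub> = 1"
  "\<zero>\<^bsub>ring_of_type_algebra :: complex ring\<^esub> = 0"
  "a \<oplus>\<^bsub>ring_of_type_algebra :: complex ring\<^esub> b = a + b"
  "a \<otimes>\<^bsub>ring_of_type_algebra :: complex ring\<^esub> b = a * b"
  by (simp_all add: ring_of_type_algebra_def)

lemma linear_opD:
  assumes "linear_op M A"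
  shows linear_op_closed: "x \<in> carrier M \<Longrightarrow> A x \<in> carrier M"
    and linear_op_add: "\<lbrakk>x \<in> carrier M; y \<in> carrier M\<rbrakk> \<Longrightarrow> A (x \<oplus>\<^bsub>M\<^esub> y) = A x \<oplus>\<^bsub>M\<^esub> A y"
    and linear_op_smult: "x \<in> carrier M \<Longrightarrow> A (c \<odot>\<^bsub>M\<^esub> x) = c \<odot>\<^bsub>M\<^esub> A x"
  using assms by (auto simp: linear_op_def)

context inner_space
begin

lemma smult_mem [simp, intro]: "x \<in> carrier M \<Longrightarrow> c \<odot> x \<in> carrier M"
  using smult_closed[of c x] by simp

lemma ip_zero_left [simp]: "z \<in> carrier M \<Longrightarrow> ip M \<zero> z = 0"
  using ip_add_left[of \<zero> \<zero> z] by simp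

lemma ip_uminus_left: "\<lbrakk>x \<in> carrier M; z \<in> carrier M\<rbrakk> \<Longrightarrow> ip M (\<ominus> x) z = - ip M x z"
  using ip_add_left[of x "\<ominus> x" z] by (simp add: M.r_neg eq_neg_iff_add_eq_0 add.commute)

lemma ip_diff_left: "\<lbrakk>x \<in> carrier M; y \<in> carrier M; z \<in> carrier M\<rbrakk>
    \<Longrightarrow> ip M (x \<ominus> y) z = ip M x z - ip M y z"
  by (simp add: a_minus_def ip_add_left ip_uminus_left)

lemma ip_add_right: "\<lbrakk>x \<in> carrier M; y \<in> carrier M; z \<in> carrier M\<rbrakk>
    \<Longrightarrow> ip M z (x \<oplus> y) = ip M z x + ip M z y"
  by (metis M.a_closed complex_cnj_add ip_add_left ip_commute)

lemma ip_smult_right: "\<lbrakk>x \<in> carrier M; z \<in> carrier M\<rbrakk>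
    \<Longrightarrow> ip M z (c \<odot> x) = cnj c * ip M z x"
  by (metis smult_mem complex_cnj_mult ip_smult_left ip_commute)

lemma ip_diff_right: "\<lbrakk>x \<in> carrier M; y \<in> carrier M; z \<in> carrier M\<rbrakk>
    \<Longrightarrow> ip M z (x \<ominus> y) = ip M z x - ip M z y"
  by (metis M.minus_closed complex_cnj_diff ip_diff_left ip_commute)

lemma ip_zero_right [simp]: "z \<in> carrier M \<Longrightarrow> ip M z \<zero> = 0"
  by (metis M.zero_closed complex_cnj_zero ip_commute ip_zero_left)

lemma ip_uminus_right: "\<lbrakk>x \<in> carrier M; z \<in> carrier M\<rbrakk> \<Longrightarrow> ip M z (\<ominus> x) = - ip M z x"
  by (metis M.a_inv_closed complex_cnj_minus ip_uminus_left ip_commute)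

lemmas ip_simps = ip_add_left ip_smult_left ip_diff_left ip_add_right ip_smult_right ip_diff_right

lemma ip_self_Im [simp]: "x \<in> carrier M \<Longrightarrow> Im (ip M x x) = 0"
  using ip_commute[of x x] by (metis cnj.sel(2) equal_neg_zero)

lemma hnorm_ge_0 [simp]: "x \<in> carrier M \<Longrightarrow> 0 \<le> hnorm M x"
  using ip_pos[of x] by (cases "x = \<zero>") (auto simp: hnorm_def)

lemma ip_self_ge_0: "x \<in> carrier M \<Longrightarrow> 0 \<le> Re (ip M x x)"
  using ip_pos[of x] by (cases "x = \<zero>") auto

lemma ip_self: "x \<in> carrier M \<Longrightarrow> ip M x x = of_real ((hnorm M x)\<^sup>2)"
  by (simp add: complex_eq_iff hnorm_def ip_self_ge_0)

lemma hnorm_sq: "x \<in> carrier M \<Longrightarrow> (hnorm M x)\<^sup>2 = Re (ip M x x)"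
  by (simp add: hnorm_def ip_self_ge_0)

lemma hnorm_eq_0_iff: "x \<in> carrier M \<Longrightarrow> hnorm M x = 0 \<longleftrightarrow> x = \<zero>"
  using ip_pos[of x] by (cases "x = \<zero>") (auto simp: hnorm_def)

lemma hnorm_zero [simp]: "hnorm M \<zero> = 0"
  by (simp add: hnorm_eq_0_iff)

lemma diff_eq_zero_iff:
  assumes "x \<in> carrier M" "y \<in> carrier M"
  shows "x \<ominus> y = \<zero> \<longleftrightarrow> x = y"
proof
  assume "x \<ominus> y = \<zero>"
  then have "\<ominus> (\<ominus> y) = x" using assms by (intro M.minus_equality) (auto simp: a_minus_def)
  then show "x = y" using assms by simp
qed (use assms in \<open>simp add: a_minus_def M.r_neg\<close>)

lemma eq_if_ip_diff:
  assumes "x \<in> carrier M" "y \<in> carrier M" "Re (ip M (x \<ominus> y) (x \<ominus> y)) \<le> 0"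
  shows "x = y"
  using ip_pos[of "x \<ominus> y"] assms diff_eq_zero_iff[of x y] by (metis M.minus_closed linorder_not_less)

text \<open>Pairing with an arbitrary \<open>z\<close> turns an equation between vectors into one
  between complex numbers, which \<open>ip_simps\<close> and \<open>algebra_simps\<close> can
  decide. Throughout, this replaces module arithmetic in the carrier.\<close>

lemma ip_eqI:
  assumes "x \<in> carrier M" "y \<in> carrier M" "\<And>z. z \<in> carrier M \<Longrightarrow> ip M x z = ip M y z"
  shows "x = y"
proof (rule eq_if_ip_diff)
  show "Re (ip M (x \<ominus> y) (x \<ominus> y)) \<le> 0"
    using assms(3)[of "x \<ominus> y"] ip_diff_left[of x y "x \<ominus> y"] assms(1,2) by simp
qed (rule assms(1,2))+

lemma hnorm_smult: "x \<in> carrier M \<Longrightarrow> hnorm M (c \<odot> x) = cmod c * hnorm M x"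
proof (rule power2_eq_imp_eq)
  assume x: "x \<in> carrier M"
  have "ip M (c \<odot> x) (c \<odot> x) = of_real ((cmod c)\<^sup>2) * ip M x x"
    using x by (simp add: ip_simps complex_norm_square mult.commute del: of_real_power)
  then show "(hnorm M (c \<odot> x))\<^sup>2 = (cmod c * hnorm M x)\<^sup>2"
    using x by (simp add: hnorm_sq power_mult_distrib)
qed auto

lemma hnorm_diff_commute: "\<lbrakk>x \<in> carrier M; y \<in> carrier M\<rbrakk> \<Longrightarrow> hnorm M (x \<ominus> y) = hnorm M (y \<ominus> x)"
  by (rule power2_eq_imp_eq) (auto simp: hnorm_sq ip_simps)

lemma cauchy_schwarz:
  assumes x: "x \<in> carrier M" and y: "y \<in> carrier M"
  shows "cmod (ip M x y) \<le> hnorm M x * hnorm M y"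
proof (cases "y = \<zero>")
  case False
  define c where "c = ip M x y"
  define s where "s = (hnorm M y)\<^sup>2"
  have s: "s > 0"
    using False hnorm_eq_0_iff[OF y] by (simp add: s_def)
  \<comment> \<open>The vector is \<open>s\<close> times the component of \<open>x\<close>
    orthogonal to \<open>y\<close>; the factor \<open>s\<close> clears the denominator.\<close>
  have "0 \<le> (hnorm M (of_real s \<odot> x \<ominus> c \<odot> y))\<^sup>2" by simp
  also have "\<dots> = Re (of_real s * of_real s * ip M x x - of_real s * cnj c * ip M x y
       - c * of_real s * ip M y x + c * cnj c * ip M y y)"
    using x y by (simp add: hnorm_sq ip_simps algebra_simps)
  also have "ip M y x = cnj c" unfolding c_def by (rule ip_commute[OF y x])
  also have "ip M x y = c" by (simp add: c_def)
  also have "ip M y y = of_real s" using y by (simp add: ip_self s_def)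
  also have "ip M x x = of_real ((hnorm M x)\<^sup>2)" using x by (simp add: ip_self)
  also have "Re (of_real s * of_real s * of_real ((hnorm M x)\<^sup>2) - of_real s * cnj c * c
       - c * of_real s * cnj c + c * cnj c * of_real s) = s * (s * (hnorm M x)\<^sup>2 - (cmod c)\<^sup>2)"
    by (simp add: cmod_power2 algebra_simps power2_eq_square[of s] power2_eq_square[of "Re c"] power2_eq_square[of "Im c"] power2_eq_square[of "hnorm M x"])
  finally have "(cmod c)\<^sup>2 \<le> (hnorm M x)\<^sup>2 * s"
    using s by (simp add: zero_le_mult_iff mult.commute)
  then have "(cmod c)\<^sup>2 \<le> (hnorm M x * hnorm M y)\<^sup>2" by (simp add: s_def power_mult_distrib)
  then show ?thesis using x y by (auto simp: c_def intro: power2_le_imp_le)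
qed (use x in auto)

lemma hnorm_triangle:
  assumes x: "x \<in> carrier M" and y: "y \<in> carrier M"
  shows "hnorm M (x \<oplus> y) \<le> hnorm M x + hnorm M y"
proof (rule power2_le_imp_le)
  have "(hnorm M (x \<oplus> y))\<^sup>2 = (hnorm M x)\<^sup>2 + (hnorm M y)\<^sup>2 + (Re (ip M x y) + Re (ip M y x))"
    using x y by (simp add: hnorm_sq ip_simps)
  also have "Re (ip M y x) = Re (ip M x y)" using ip_commute[OF x y] by simp
  also have "Re (ip M x y) \<le> hnorm M x * hnorm M y"
    using cauchy_schwarz[OF x y] complex_Re_le_cmod order_trans by blast
  finally show "(hnorm M (x \<oplus> y))\<^sup>2 \<le> (hnorm M x + hnorm M y)\<^sup>2"
    by (simp add: power2_sum)
qed (use x y in auto)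

lemma hnorm_uminus: "x \<in> carrier M \<Longrightarrow> hnorm M (\<ominus> x) = hnorm M x"
  by (simp add: hnorm_def ip_uminus_left ip_uminus_right)

lemma hnorm_triangle_diff:
  assumes x: "x \<in> carrier M" and y: "y \<in> carrier M"
  shows "hnorm M (x \<ominus> y) \<le> hnorm M x + hnorm M y"
  using hnorm_triangle[of x "\<ominus> y"] x y by (simp add: a_minus_def hnorm_uminus)

lemma hnorm_triangle_diff':
  assumes x: "x \<in> carrier M" and y: "y \<in> carrier M"
  shows "hnorm M x - hnorm M y \<le> hnorm M (x \<ominus> y)"
proof -
  have "x = (x \<ominus> y) \<oplus> y" using x y by (intro ip_eqI) (auto simp: ip_simps)
  then show ?thesis using hnorm_triangle[of "x \<ominus> y" y] x y by auto
qed

lemma linear_op_diff: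
  assumes A: "linear_op M A" and x: "x \<in> carrier M" and y: "y \<in> carrier M"
  shows "A (x \<ominus> y) = A x \<ominus> A y"
proof -
  have "x \<ominus> y = x \<oplus> (-1) \<odot> y" using x y by (intro ip_eqI) (auto simp: ip_simps)
  then have "A (x \<ominus> y) = A x \<oplus> (-1) \<odot> A y"
    using x y linear_opD[OF A] by simp
  also have "\<dots> = A x \<ominus> A y" using x y linear_op_closed[OF A]
    by (intro ip_eqI) (auto simp: ip_simps)
  finally show ?thesis .
qed

lemma linear_op_zero: "linear_op M A \<Longrightarrow> A \<zero> = \<zero>"
  by (metis M.zero_closed complex_ring_simps(3) linear_op_closed linear_op_smult smult_l_null)

subsection \<open>Extending a Gram-preserving map to a unitary\<close>

text \<open>The adjoint \<open>V\<close> is carried along with \<open>U\<close>, since in an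
  incomplete space Riesz is not there to produce it.\<close>

definition unitary_pair where
  "unitary_pair U V \<longleftrightarrow> linear_op M U \<and> linear_op M V \<and>
    (\<forall>x\<in>carrier M. \<forall>y\<in>carrier M. ip M (U x) y = ip M x (V y)) \<and>
    (\<forall>x\<in>carrier M. U (V x) = x \<and> V (U x) = x)"

lemma unitary_pairD:
  assumes "unitary_pair U V"
  shows "linear_op M U" "linear_op M V"
    "x \<in> carrier M \<Longrightarrow> U x \<in> carrier M" "x \<in> carrier M \<Longrightarrow> V x \<in> carrier M"
    "\<And>x. x \<in> carrier M \<Longrightarrow> U (V x) = x" "\<And>x. x \<in> carrier M \<Longrightarrow> V (U x) = x"
    "\<And>x y. \<lbrakk>x \<in> carrier M; y \<in> carrier M\<rbrakk> \<Longrightarrow> ip M (U x) y = ip M x (V y)"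
    "\<lbrakk>x \<in> carrier M; y \<in> carrier M\<rbrakk> \<Longrightarrow> ip M (U x) (U y) = ip M x y"
    "\<lbrakk>x \<in> carrier M; y \<in> carrier M\<rbrakk> \<Longrightarrow> ip M (V x) (V y) = ip M x y"
proof -
  show UV: "linear_op M U" "linear_op M V" using assms by (auto simp: unitary_pair_def)
  note cl [simp] = linear_op_closed[OF UV(1)] linear_op_closed[OF UV(2)]
  show "x \<in> carrier M \<Longrightarrow> U x \<in> carrier M" "x \<in> carrier M \<Longrightarrow> V x \<in> carrier M" by simp_all
  show inv: "U (V x) = x" "V (U x) = x" if "x \<in> carrier M" for x
    using assms that by (auto simp: unitary_pair_def)
  show adj: "ip M (U x) y = ip M x (V y)" if "x \<in> carrier M" "y \<in> carrier M" for x y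
    using assms that by (auto simp: unitary_pair_def)
  assume xy: "x \<in> carrier M" "y \<in> carrier M"
  show "ip M (U x) (U y) = ip M x y" using xy adj[of x "U y"] inv by simp
  show "ip M (V x) (V y) = ip M x y" using xy adj[of "V x" y] inv by simp
qed

lemma unitary_pair_comp:
  assumes "unitary_pair U V" "unitary_pair U' V'"
  shows "unitary_pair (\<lambda>x. U' (U x)) (\<lambda>x. V (V' x))"
  using unitary_pairD[OF assms(1)] unitary_pairD[OF assms(2)]
  by (auto simp: unitary_pair_def linear_op_def)

text \<open>\<open>U\<close> is the complex reflection along \<open>x - y\<close>; its factor \<open>- cnj q / q\<close> is not real in general.\<close>

lemma unitary_reflection:
  assumes x: "x \<in> carrier M" and y: "y \<in> carrier M" and xy: "ip M x x = ip M y y"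
  obtains U V where "unitary_pair U V" "U x = y"
    "\<And>z. z \<in> carrier M \<Longrightarrow> ip M z x = ip M z y \<Longrightarrow> U z = z"
proof (cases "x = y")
  case True
  then show ?thesis using that[of "\<lambda>x. x" "\<lambda>x. x"] by (auto simp: unitary_pair_def linear_op_def)
next
  case False
  define d where "d = x \<ominus> y"
  have d [simp]: "d \<in> carrier M" using x y by (simp add: d_def)
  define q where "q = ip M x d"
  have yx: "ip M y x = cnj (ip M x y)" by (rule ip_commute[OF y x])
  \<comment> \<open>This is where equal norms enter: the square of \<open>d\<close> is twice the
    real part of \<open>q\<close>, so \<open>q\<close> cannot vanish when \<open>x\<close> and
    \<open>y\<close> differ.\<close>
  have dd: "ip M d d = q + cnj q"
    unfolding q_def d_def using x y xy by (simp add: ip_simps yx complex_eq_iff)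
  have "Re (ip M d d) > 0" using False eq_if_ip_diff[OF x y] by (force simp: d_def)
  then have q: "q \<noteq> 0" using dd by auto
  \<comment> \<open>The denominator \<open>q\<close> is forced by \<open>U x = x - d = y\<close>. On
    \<open>d\<close> the map has an eigenvalue of modulus one, and the orthogonal complement of
    \<open>d\<close> is fixed. Conjugating the denominator gives the adjoint.\<close>
  define U where "U z = z \<ominus> (ip M z d / q) \<odot> d" for z
  define V where "V z = z \<ominus> (ip M z d / cnj q) \<odot> d" for z
  \<comment> \<open>The coefficient of \<open>d\<close> in \<open>U (V u)\<close> and in
    \<open>V (U u)\<close>; separate \<open>r\<close> and \<open>q'\<close> let one computation
    serve both orders.\<close>
  have aux: "t / r + (t - t / r * (q' + r)) / q' = 0" if "r \<noteq> 0" "q' \<noteq> 0" for t r q' :: complex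
  proof -
    have "t - t / r * (q' + r) = - (t / r) * q'" using that by (simp add: distrib_left)
    then show ?thesis using that by simp
  qed
  have "U x = y" using x y q by (intro ip_eqI) (auto simp: U_def ip_simps q_def[symmetric], simp add: d_def ip_simps)
  moreover have "U z = z" if "z \<in> carrier M" "ip M z x = ip M z y" for z
    using that x y by (intro ip_eqI) (auto simp: U_def ip_simps d_def)
  moreover have "unitary_pair U V"
    unfolding unitary_pair_def linear_op_def
  proof (intro conjI ballI allI)
    fix u v assume [simp]: "u \<in> carrier M" "v \<in> carrier M"
    have dv: "ip M d v = cnj (ip M v d)" by (rule ip_commute) auto
    show "ip M (U u) v = ip M u (V v)"
      using q by (simp add: U_def V_def ip_simps dv)
    show "U (u \<oplus> v) = U u \<oplus> U v"
      by (rule ip_eqI) (auto simp: U_def ip_simps algebra_simps add_divide_distrib)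
    show "V (u \<oplus> v) = V u \<oplus> V v"
      by (rule ip_eqI) (auto simp: V_def ip_simps algebra_simps add_divide_distrib)
    fix c
    show "U (c \<odot> u) = c \<odot> U u"
      by (rule ip_eqI) (auto simp: U_def ip_simps algebra_simps)
    show "V (c \<odot> u) = c \<odot> V u"
      by (rule ip_eqI) (auto simp: V_def ip_simps algebra_simps)
    define t where "t = ip M u d"
    show "U (V u) = u"
    proof (rule ip_eqI)
      fix z assume [simp]: "z \<in> carrier M"
      have "ip M (U (V u)) z = ip M u z
          - (t / cnj q + (t - t / cnj q * (q + cnj q)) / q) * ip M d z"
        by (simp add: U_def V_def ip_simps dd t_def algebra_simps)
      then show "ip M (U (V u)) z = ip M u z" using aux[of "cnj q" q t] q by simp
    qed (auto simp: U_def V_def)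
    show "V (U u) = u"
    proof (rule ip_eqI)
      fix z assume [simp]: "z \<in> carrier M"
      have "ip M (V (U u)) z = ip M u z
          - (t / q + (t - t / q * (cnj q + q)) / cnj q) * ip M d z"
        by (simp add: U_def V_def ip_simps dd t_def algebra_simps)
      also have "t / q + (t - t / q * (cnj q + q)) / cnj q = 0"
        using aux[of q "cnj q" t] q by simp
      finally show "ip M (V (U u)) z = ip M u z" by simp
    qed (auto simp: U_def V_def)
  qed (auto simp: U_def V_def)
  ultimately show ?thesis using that by blast
qed

text \<open>Induction over the vectors: once \<open>U\<close> matches those of \<open>I\<close>, one
  more reflection takes \<open>U (x p)\<close> to \<open>y p\<close>. It does not disturb the
  earlier ones, since by equality of the Gram entries every \<open>y i\<close> has the same inner
  product with \<open>U (x p)\<close> as with \<open>y p\<close>.\<close>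

theorem unitary_extension:
  assumes "finite I" "\<And>i. i \<in> I \<Longrightarrow> x i \<in> carrier M" "\<And>i. i \<in> I \<Longrightarrow> y i \<in> carrier M"
    and "\<And>i j. i \<in> I \<Longrightarrow> j \<in> I \<Longrightarrow> ip M (x i) (x j) = ip M (y i) (y j)"
  shows "\<exists>U V. unitary_pair U V \<and> (\<forall>i\<in>I. U (x i) = y i)"
  using assms
proof (induction rule: finite_induct)
  case empty
  show ?case by (rule exI[of _ "\<lambda>x. x"], rule exI[of _ "\<lambda>x. x"])
      (auto simp: unitary_pair_def linear_op_def)
next
  case (insert p I)
  from insert obtain U V where UV: "unitary_pair U V" and U: "\<And>i. i \<in> I \<Longrightarrow> U (x i) = y i"
    by fastforce
  note [simp] = unitary_pairD(3,8)[OF UV]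
  have 1: "U (x p) \<in> carrier M" "y p \<in> carrier M" "ip M (U (x p)) (U (x p)) = ip M (y p) (y p)"
    using insert.prems by auto
  obtain U' V' where UV': "unitary_pair U' V'" and U': "U' (U (x p)) = y p"
    "\<And>z. z \<in> carrier M \<Longrightarrow> ip M z (U (x p)) = ip M z (y p) \<Longrightarrow> U' z = z"
    using unitary_reflection[OF 1] by metis
  have "U' (U (x i)) = y i" if "i \<in> I" for i
  proof -
    have "ip M (y i) (U (x p)) = ip M (U (x i)) (U (x p))" by (simp add: U that)
    also have "\<dots> = ip M (y i) (y p)" using insert.prems that by simp
    finally show ?thesis using U'(2)[of "y i"] U[OF that] insert.prems that by simp
  qed
  then show ?case using unitary_pair_comp[OF UV UV'] U'(1) by blast
qed

end

section \<open>Contractions on Hilbert spaces\<close>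

context inner_space
begin

lemma hnorm_triangle3:
  assumes "x \<in> carrier M" "y \<in> carrier M" "z \<in> carrier M"
  shows "hnorm M (x \<ominus> z) \<le> hnorm M (x \<ominus> y) + hnorm M (y \<ominus> z)"
proof -
  have "x \<ominus> z = (x \<ominus> y) \<oplus> (y \<ominus> z)" using assms by (intro ip_eqI) (auto simp: ip_simps)
  then show ?thesis using hnorm_triangle[of "x \<ominus> y" "y \<ominus> z"] assms by simp
qed

lemma metric_space_hdist: "Metric_space (carrier M) (hdist M)"
proof
  show "0 \<le> hdist M x y" for x y by (simp add: hdist_def)
  show "hdist M x y = hdist M y x" for x y by (simp add: hdist_def hnorm_diff_commute)
  show "hdist M x y = 0 \<longleftrightarrow> x = y" if "x \<in> carrier M" "y \<in> carrier M" for x y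
    using that by (simp add: hdist_def hnorm_eq_0_iff diff_eq_zero_iff)
  show "hdist M x z \<le> hdist M x y + hdist M y z"
    if "x \<in> carrier M" "y \<in> carrier M" "z \<in> carrier M" for x y z
    using that hnorm_triangle3 by (simp add: hdist_def)
qed

lemma hnorm_diff_abs:
  assumes "x \<in> carrier M" "y \<in> carrier M"
  shows "\<bar>hnorm M x - hnorm M y\<bar> \<le> hnorm M (x \<ominus> y)"
  using hnorm_triangle_diff'[of x y] hnorm_triangle_diff'[of y x] hnorm_diff_commute[of x y] assms
  by auto

lemma parallelogram:
  assumes "x \<in> carrier M" "y \<in> carrier M"
  shows "(hnorm M (x \<oplus> y))\<^sup>2 + (hnorm M (x \<ominus> y))\<^sup>2 = 2 * (hnorm M x)\<^sup>2 + 2 * (hnorm M y)\<^sup>2"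
  using assms by (simp add: hnorm_sq ip_simps)

lemma contraction_opD:
  assumes T: "contraction_op M T"
  shows "linear_op M T" and "x \<in> carrier M \<Longrightarrow> hnorm M (T x) \<le> hnorm M x"
proof -
  show L: "linear_op M T" using T by (simp add: contraction_op_def bounded_op_def)
  assume x: "x \<in> carrier M"
  obtain K where K: "\<And>x. x \<in> carrier M \<Longrightarrow> hnorm M (T x) \<le> K * hnorm M x"
    using T by (auto simp: contraction_op_def bounded_op_def)
  \<comment> \<open>The supremum in \<open>op_norm\<close> is an upper bound only over a bounded
    set. The constant \<open>K\<close> has no prescribed sign, hence its absolute value.\<close>
  have bdd: "bdd_above ((\<lambda>x. hnorm M (T x)) ` {x \<in> carrier M. hnorm M x \<le> 1})"
  proof (rule bdd_aboveI2)
    fix y assume "y \<in> {x \<in> carrier M. hnorm M x \<le> 1}"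
    then have y: "y \<in> carrier M" "hnorm M y \<le> 1" by auto
    have "K * hnorm M y \<le> \<bar>K\<bar> * hnorm M y" using y by (intro mult_right_mono) auto
    also have "\<dots> \<le> \<bar>K\<bar> * 1" using y by (intro mult_left_mono) auto
    finally show "hnorm M (T y) \<le> \<bar>K\<bar>" using K[OF y(1)] by simp
  qed
  show "hnorm M (T x) \<le> hnorm M x"
  proof (cases "x = \<zero>")
    case True
    then show ?thesis using L by (simp add: linear_op_zero)
  next
    case False
    then have n: "hnorm M x > 0" using hnorm_eq_0_iff[OF x] hnorm_ge_0[OF x] by linarith
    define y where "y = of_real (inverse (hnorm M x)) \<odot> x"
    have y: "y \<in> carrier M" "hnorm M y = 1" using x n by (auto simp: y_def hnorm_smult norm_inverse)
    then have "hnorm M (T y) \<le> op_norm M T"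
      unfolding op_norm_def by (intro cSUP_upper bdd) auto
    also have "\<dots> \<le> 1" using T by (simp add: contraction_op_def)
    finally have "inverse (hnorm M x) * hnorm M (T x) \<le> 1"
      using x n linear_opD[OF L] by (simp add: y_def hnorm_smult norm_inverse)
    then show ?thesis using n by (simp add: field_simps)
  qed
qed

lemma contraction_opI:
  assumes L: "linear_op M T" and T: "\<And>x. x \<in> carrier M \<Longrightarrow> hnorm M (T x) \<le> hnorm M x"
  shows "contraction_op M T"
proof -
  have "bounded_op M T" unfolding bounded_op_def using L T by (intro conjI exI[of _ 1]) auto
  moreover have "op_norm M T \<le> 1"
    unfolding op_norm_def
  proof (rule cSUP_least)
    have "\<zero> \<in> {x \<in> carrier M. hnorm M x \<le> 1}" by simp
    then show "{x \<in> carrier M. hnorm M x \<le> 1} \<noteq> {}" by blast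
    show "hnorm M (T x) \<le> 1" if "x \<in> {x \<in> carrier M. hnorm M x \<le> 1}" for x
      using that T[of x] by auto
  qed
  ultimately show ?thesis by (simp add: contraction_op_def)
qed

text \<open>With \<open>t = T u\<close> this is the reason why \<open>s\<^sub>T\<close> is a strict contraction for \<open>s = (z + w, z w)\<close>.\<close>

lemma symm_identity:
  assumes u: "u \<in> carrier M" and t: "t \<in> carrier M" and u': "u' \<in> carrier M" and t': "t' \<in> carrier M"
  shows "ip M (2 \<odot> u \<ominus> (z + w) \<odot> t) (2 \<odot> u' \<ominus> (z' + w') \<odot> t')
      - ip M ((2 * (z * w)) \<odot> t \<ominus> (z + w) \<odot> u) ((2 * (z' * w')) \<odot> t' \<ominus> (z' + w') \<odot> u')
    = 2 * (1 - z * cnj z') * ip M (u \<ominus> w \<odot> t) (u' \<ominus> w' \<odot> t')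
      + 2 * (1 - w * cnj w') * ip M (u \<ominus> z \<odot> t) (u' \<ominus> z' \<odot> t')
      + (z - w) * cnj (z' - w') * (ip M u u' - ip M t t')"
  using assms by (simp add: ip_simps algebra_simps)

text \<open>Take both arguments equal in \<open>symm_identity\<close>: the last term is nonnegative
  since \<open>t\<close> is no longer than \<open>u\<close>. The vectors \<open>a\<close> and
  \<open>b\<close> there add up to \<open>A\<close>, so the parallelogram law bounds the square of
  \<open>A\<close> by twice the squares of \<open>a\<close> and \<open>b\<close>. With
  \<open>r\<close> the larger modulus this leaves at least \<open>1 - r\<^sup>2\<close> times the
  square of \<open>A\<close> as the defect.\<close>

lemma symm_strict:
  assumes u: "u \<in> carrier M" and t: "t \<in> carrier M" and tu: "hnorm M t \<le> hnorm M u"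
    and z: "cmod z < 1" and w: "cmod w < 1"
  shows "hnorm M ((2 * (z * w)) \<odot> t \<ominus> (z + w) \<odot> u)
    \<le> max (cmod z) (cmod w) * hnorm M (2 \<odot> u \<ominus> (z + w) \<odot> t)"
proof (rule power2_le_imp_le)
  define r where "r = max (cmod z) (cmod w)"
  define a where "a = u \<ominus> w \<odot> t"
  define b where "b = u \<ominus> z \<odot> t"
  define A where "A = 2 \<odot> u \<ominus> (z + w) \<odot> t"
  define B where "B = (2 * (z * w)) \<odot> t \<ominus> (z + w) \<odot> u"
  have [simp]: "a \<in> carrier M" "b \<in> carrier M" "A \<in> carrier M" "B \<in> carrier M"
    using u t by (auto simp: a_def b_def A_def B_def)
  have "of_real ((hnorm M A)\<^sup>2 - (hnorm M B)\<^sup>2) = ip M A A - ip M B B" by (simp add: ip_self)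
  also have "\<dots> = 2 * (1 - z * cnj z) * ip M a a + 2 * (1 - w * cnj w) * ip M b b
      + (z - w) * cnj (z - w) * (ip M u u - ip M t t)"
    unfolding A_def B_def a_def b_def using symm_identity[OF u t u t] .
  also have "\<dots> = of_real (2 * (1 - (cmod z)\<^sup>2) * (hnorm M a)\<^sup>2 + 2 * (1 - (cmod w)\<^sup>2) * (hnorm M b)\<^sup>2
      + (cmod (z - w))\<^sup>2 * ((hnorm M u)\<^sup>2 - (hnorm M t)\<^sup>2))"
    using u t by (simp add: ip_self complex_norm_square[unfolded of_real_power])
  finally have eq: "(hnorm M A)\<^sup>2 - (hnorm M B)\<^sup>2 =
      2 * (1 - (cmod z)\<^sup>2) * (hnorm M a)\<^sup>2 + 2 * (1 - (cmod w)\<^sup>2) * (hnorm M b)\<^sup>2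
      + (cmod (z - w))\<^sup>2 * ((hnorm M u)\<^sup>2 - (hnorm M t)\<^sup>2)"
    using of_real_eq_iff by blast
  have r1: "(cmod z)\<^sup>2 \<le> r\<^sup>2" "(cmod w)\<^sup>2 \<le> r\<^sup>2" by (auto simp: r_def intro: power_mono)
  have "r\<^sup>2 \<le> 1" using z w by (auto simp: r_def power_le_one max_def)
  have "A = a \<oplus> b" unfolding A_def a_def b_def using u t by (intro ip_eqI) (auto simp: ip_simps algebra_simps)
  then have "(hnorm M A)\<^sup>2 \<le> 2 * (hnorm M a)\<^sup>2 + 2 * (hnorm M b)\<^sup>2"
    using parallelogram[of a b] by (simp add: algebra_simps) (metis add_le_same_cancel1 add.commute le_add_same_cancel1 zero_le_power2)
  then have "(1 - r\<^sup>2) * (hnorm M A)\<^sup>2 \<le> (1 - r\<^sup>2) * (2 * (hnorm M a)\<^sup>2 + 2 * (hnorm M b)\<^sup>2)"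
    using \<open>r\<^sup>2 \<le> 1\<close> by (intro mult_left_mono) auto
  also have "\<dots> = 2 * (1 - r\<^sup>2) * (hnorm M a)\<^sup>2 + 2 * (1 - r\<^sup>2) * (hnorm M b)\<^sup>2"
    by (simp add: algebra_simps)
  also have "\<dots> \<le> 2 * (1 - (cmod z)\<^sup>2) * (hnorm M a)\<^sup>2 + 2 * (1 - (cmod w)\<^sup>2) * (hnorm M b)\<^sup>2"
    using r1 by (intro add_mono mult_right_mono) auto
  also have "\<dots> \<le> (hnorm M A)\<^sup>2 - (hnorm M B)\<^sup>2"
    unfolding eq using power_mono[OF tu, of 2] t by simp
  finally show "(hnorm M B)\<^sup>2 \<le> (r * hnorm M A)\<^sup>2"
    by (simp add: power_mult_distrib algebra_simps)
  show "0 \<le> r * hnorm M A" by (auto simp: r_def max_def)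
qed

end

section \<open>Consequences of completeness: Riesz representation, adjoints, fixed point
  iteration\<close>

context hilbert_space
begin

lemma cauchy_limit:
  assumes xs: "\<And>n. xs n \<in> carrier M"
    and C: "\<And>e. e > 0 \<Longrightarrow> \<exists>N. \<forall>m\<ge>N. \<forall>n\<ge>N. hnorm M (xs m \<ominus> xs n) < e"
  obtains z where "z \<in> carrier M" "(\<lambda>n. hnorm M (xs n \<ominus> z)) \<longlonglongrightarrow> 0"
proof -
  interpret Metric_space "carrier M" "hdist M" by (rule metric_space_hdist)
  have "MCauchy xs" unfolding MCauchy_def using xs C by (auto simp: hdist_def)
  then obtain z where z: "limitin mtopology xs z sequentially"
    using complete unfolding mcomplete_def by blast
  then have "z \<in> carrier M" "(\<lambda>n. hdist M (xs n) z) \<longlonglongrightarrow> 0"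
    by (auto simp: limitin_metric_dist_null)
  then show ?thesis using that xs by (simp add: hdist_def)
qed

text \<open>If \<open>z\<close> represents \<open>F\<close>, then \<open>J x\<close> is the squared
  distance from \<open>x\<close> to \<open>z\<close> up to a constant. So \<open>z\<close> is sought
  as a minimiser of \<open>J\<close>: minimising sequences are Cauchy, and the first variation at
  the limit yields the representation. No closed subspaces or projections are involved.\<close>

theorem riesz:
  fixes F :: "'a \<Rightarrow> complex"
  assumes add: "\<And>x y. \<lbrakk>x \<in> carrier M; y \<in> carrier M\<rbrakk> \<Longrightarrow> F (x \<oplus> y) = F x + F y"
    and smult: "\<And>c x. x \<in> carrier M \<Longrightarrow> F (c \<odot> x) = c * F x"
    and bound: "\<And>x. x \<in> carrier M \<Longrightarrow> cmod (F x) \<le> K * hnorm M x"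
  obtains z where "z \<in> carrier M" "\<And>x. x \<in> carrier M \<Longrightarrow> F x = ip M x z"
proof -
  have diff: "F (x \<ominus> y) = F x - F y" if "x \<in> carrier M" "y \<in> carrier M" for x y
  proof -
    have "x = (x \<ominus> y) \<oplus> y" using that by (intro ip_eqI) (auto simp: ip_simps)
    then have "F x = F (x \<ominus> y) + F y" using add[of "x \<ominus> y" y] that by simp
    then show ?thesis by simp
  qed
  define J where "J x = (hnorm M x)\<^sup>2 - 2 * Re (F x)" for x
  have J_lower: "J x \<ge> - K\<^sup>2" if "x \<in> carrier M" for x
  proof -
    have "Re (F x) \<le> K * hnorm M x" using bound[OF that] complex_Re_le_cmod[of "F x"] by linarith
    moreover have "0 \<le> (hnorm M x - K)\<^sup>2" by simp
    ultimately show ?thesis by (simp add: J_def power2_diff mult.commute[of K])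
  qed
  define m where "m = Inf (J ` carrier M)"
  have ne: "J ` carrier M \<noteq> {}" using M.zero_closed by blast
  have bdd: "bdd_below (J ` carrier M)" using J_lower by (auto intro!: bdd_belowI2)
  have m_le: "m \<le> J x" if "x \<in> carrier M" for x
    unfolding m_def using that bdd by (intro cInf_lower) auto
  have "\<exists>x\<in>carrier M. J x < m + 1 / real (Suc n)" for n
    using cInf_lessD[OF ne, of "m + 1 / real (Suc n)"] by (auto simp: m_def)
  then obtain xs where xs: "\<And>n. xs n \<in> carrier M" "\<And>n. J (xs n) < m + 1 / real (Suc n)" by metis
  \<comment> \<open>Compare \<open>m\<close> with the value of \<open>J\<close> at the midpoint and
    apply the parallelogram law.\<close>
  have est: "(hnorm M (x \<ominus> y))\<^sup>2 \<le> 2 * (J x - m) + 2 * (J y - m)" if [simp]: "x \<in> carrier M" "y \<in> carrier M" for x y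
  proof -
    define h where "h = (1/2) \<odot> (x \<oplus> y)"
    have "m \<le> J h" by (rule m_le) (simp add: h_def)
    also have "J h = (hnorm M (x \<oplus> y))\<^sup>2 / 4 - Re (F x + F y)"
      by (simp add: J_def h_def hnorm_smult smult add power_divide norm_divide)
    finally show ?thesis using parallelogram[of x y] by (simp add: J_def)
  qed
  have cauchy: "\<exists>N. \<forall>k\<ge>N. \<forall>l\<ge>N. hnorm M (xs k \<ominus> xs l) < e" if "e > 0" for e :: real
  proof -
    obtain N where "inverse (real (Suc N)) < e\<^sup>2 / 4"
      using reals_Archimedean[of "e\<^sup>2 / 4"] \<open>e > 0\<close> by auto
    then have N: "4 / real (Suc N) < e\<^sup>2" using divide_inverse[of 4 "real (Suc N)"] by linarith
    have "hnorm M (xs k \<ominus> xs l) < e" if "k \<ge> N" "l \<ge> N" for k l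
    proof (rule power2_less_imp_less)
      have "1 / real (Suc k) \<le> 1 / real (Suc N)" "1 / real (Suc l) \<le> 1 / real (Suc N)"
        using that by (auto simp: field_simps)
      then show "(hnorm M (xs k \<ominus> xs l))\<^sup>2 < e\<^sup>2"
        using est[OF xs(1)[of k] xs(1)[of l]] xs(2)[of k] xs(2)[of l] N by simp
    qed (use \<open>e > 0\<close> in simp)
    then show ?thesis by blast
  qed
  obtain z where z: "z \<in> carrier M" "(\<lambda>n. hnorm M (xs n \<ominus> z)) \<longlonglongrightarrow> 0"
    using cauchy_limit[OF xs(1) cauchy] by blast
  have "(\<lambda>n. hnorm M (xs n)) \<longlonglongrightarrow> hnorm M z"
    by (rule LIM_zero_cancel, rule Lim_null_comparison[OF _ z(2)])
       (use hnorm_diff_abs xs z in auto)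
  moreover have "(\<lambda>n. F (xs n)) \<longlonglongrightarrow> F z"
  proof (rule LIM_zero_cancel, rule Lim_null_comparison)
    show "\<forall>\<^sub>F n in sequentially. norm (F (xs n) - F z) \<le> K * hnorm M (xs n \<ominus> z)"
      using bound[of "xs _ \<ominus> z"] xs z diff by auto
    show "(\<lambda>n. K * hnorm M (xs n \<ominus> z)) \<longlonglongrightarrow> 0" using tendsto_mult_right_zero[OF z(2)] by simp
  qed
  ultimately have "(\<lambda>n. J (xs n)) \<longlonglongrightarrow> J z" unfolding J_def by (intro tendsto_intros)
  moreover have "(\<lambda>n. m + 1 / real (Suc n)) \<longlonglongrightarrow> m + 0"
    by (intro tendsto_intros LIMSEQ_Suc lim_1_over_n)
  ultimately have Jz: "J z \<le> m"
    using xs(2) by (intro LIMSEQ_le[of "\<lambda>n. J (xs n)" _ "\<lambda>n. m + 1 / real (Suc n)"]) (auto intro: less_imp_le)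
  have "F x = ip M x z" if x: "x \<in> carrier M" for x
  proof (rule ccontr)
    define g where "g = F x - ip M x z"
    assume "F x \<noteq> ip M x z"
    then have g: "cmod g > 0" by (simp add: g_def)
    \<comment> \<open>Moving from \<open>z\<close> by \<open>t\<close> times \<open>x\<close>
      changes \<open>J\<close> by
      \<open>e * (cmod g)\<^sup>2 * (e * (hnorm M x)\<^sup>2 - 2)\<close>; this \<open>e\<close>
      makes the bracket negative, also for \<open>x\<close> zero.\<close>
    define e where "e = 1 / ((hnorm M x)\<^sup>2 + 1)"
    have e: "e > 0" by (auto simp: e_def intro!: divide_pos_pos add_nonneg_pos)
    define t where "t = of_real e * cnj g"
    have zx: "ip M z x = cnj (ip M x z)" using ip_commute[OF z(1) x] .
    have "J z \<le> J (z \<oplus> t \<odot> x)" using Jz m_le[of "z \<oplus> t \<odot> x"] z x by simp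
    also have "\<dots> = J z + Re (t * cnj t * ip M x x) - 2 * Re (t * g)"
      using x z by (simp add: J_def hnorm_sq ip_simps add smult zx g_def algebra_simps)
    also have "t * g = of_real (e * (cmod g)\<^sup>2)"
      by (simp add: t_def complex_norm_square[unfolded of_real_power] mult_ac)
    also have "t * cnj t * ip M x x = of_real (e\<^sup>2 * (cmod g)\<^sup>2 * (hnorm M x)\<^sup>2)"
      using x by (simp add: t_def complex_norm_square[unfolded of_real_power] ip_self power2_eq_square[of "complex_of_real e"] mult_ac)
    finally have "2 * (e * (cmod g)\<^sup>2) \<le> e * (cmod g)\<^sup>2 * (e * (hnorm M x)\<^sup>2)"
      by (simp add: power2_eq_square[of e] mult_ac)
    moreover have "e * (cmod g)\<^sup>2 > 0" using e g by simp
    ultimately have "2 \<le> e * (hnorm M x)\<^sup>2" by (metis mult.commute mult_le_cancel_left_pos)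
    moreover have "e * (hnorm M x)\<^sup>2 \<le> 1"
      unfolding e_def by (simp add: pos_divide_le_eq add_nonneg_pos)
    ultimately show False by simp
  qed
  then show ?thesis using that z(1) by blast
qed

text \<open>Riesz supplies a witness and nondegeneracy its uniqueness, so the definite description
  in the definition denotes.\<close>

lemma adjoint_op:
  assumes A: "bounded_op M A" and y: "y \<in> carrier M"
  shows "adjoint_op M A y \<in> carrier M \<and> (\<forall>x\<in>carrier M. ip M (A x) y = ip M x (adjoint_op M A y))"
proof -
  have L: "linear_op M A" using A by (simp add: bounded_op_def)
  obtain K where K: "\<And>x. x \<in> carrier M \<Longrightarrow> hnorm M (A x) \<le> K * hnorm M x"
    using A by (auto simp: bounded_op_def)
  have bound: "cmod (ip M (A x) y) \<le> (K * hnorm M y) * hnorm M x" if "x \<in> carrier M" for x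
  proof -
    have "cmod (ip M (A x) y) \<le> hnorm M (A x) * hnorm M y"
      using that y linear_op_closed[OF L] by (intro cauchy_schwarz) auto
    also have "\<dots> \<le> (K * hnorm M x) * hnorm M y" using K that y by (intro mult_right_mono) auto
    finally show ?thesis by (simp add: mult_ac)
  qed
  have add: "ip M (A (a \<oplus> b)) y = ip M (A a) y + ip M (A b) y"
    if "a \<in> carrier M" "b \<in> carrier M" for a b
    using that y by (simp add: linear_opD[OF L] ip_add_left)
  have smult: "ip M (A (c \<odot> a)) y = c * ip M (A a) y" if "a \<in> carrier M" for a c
    using that y by (simp add: linear_opD[OF L] ip_smult_left)
  obtain z where z: "z \<in> carrier M" "\<And>x. x \<in> carrier M \<Longrightarrow> ip M (A x) y = ip M x z"
    using riesz[of "\<lambda>x. ip M (A x) y", OF add smult bound] by blast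
  have uniq: "z' = z" if "z' \<in> carrier M \<and> (\<forall>x\<in>carrier M. ip M (A x) y = ip M x z')" for z'
  proof (rule ip_eqI)
    fix x assume "x \<in> carrier M"
    then show "ip M z' x = ip M z x"
      using that z(1) z(2)[of x] ip_commute[of x z'] ip_commute[of x z] by (metis complex_cnj_cancel_iff)
  qed (use that z in auto)
  have "adjoint_op M A y = z"
    unfolding adjoint_op_def by (rule the_equality) (use z in blast, rule uniq)
  then show ?thesis using z by simp
qed

lemma ip_adjoint_op:
  assumes A: "bounded_op M A" and x: "x \<in> carrier M" and y: "y \<in> carrier M"
  shows "ip M (adjoint_op M A y) x = ip M y (A x)"
proof -
  have "A x \<in> carrier M" using A x by (auto simp: bounded_op_def linear_op_def)
  then show ?thesis
    using adjoint_op[OF A y] x y ip_commute[of y "A x"] ip_commute[of "adjoint_op M A y" x] by auto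
qed

text \<open>Iterate the affine contraction \<open>c + B x\<close> from zero. The orbit stays within
  \<open>K\<close>, the solution of \<open>K = hnorm M c + r * K\<close>, and later terms differ
  from the \<open>n\<close>-th by at most \<open>r ^ n * K\<close>.\<close>

theorem neumann_solvable:
  assumes B: "linear_op M B" and r: "0 \<le> r" "r < 1"
    and bound: "\<And>x. x \<in> carrier M \<Longrightarrow> hnorm M (B x) \<le> r * hnorm M x"
    and c: "c \<in> carrier M"
  obtains x where "x \<in> carrier M" "x = c \<oplus> B x"
proof -
  note [simp] = linear_op_closed[OF B] c
  define xs where "xs n = ((\<lambda>x. c \<oplus> B x) ^^ n) \<zero>" for n
  have X0: "xs 0 = \<zero>" and XS: "xs (Suc n) = c \<oplus> B (xs n)" for n by (simp_all add: xs_def)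
  have xs [simp]: "xs n \<in> carrier M" for n by (induction n) (auto simp: X0 XS)
  define K where "K = hnorm M c / (1 - r)"
  have K: "K = hnorm M c + r * K" "0 \<le> K" using r by (auto simp: K_def field_simps)
  have XK: "hnorm M (xs n) \<le> K" for n
  proof (induction n)
    case (Suc n)
    have "hnorm M (xs (Suc n)) \<le> hnorm M c + hnorm M (B (xs n))"
      unfolding XS by (intro hnorm_triangle) auto
    also have "\<dots> \<le> hnorm M c + r * hnorm M (xs n)" using bound[of "xs n"] by simp
    also have "\<dots> \<le> hnorm M c + r * K" using Suc r by (simp add: mult_left_mono)
    finally show ?case using K by simp
  qed (use K in \<open>simp add: X0\<close>)
  have diff: "xs (Suc n) \<ominus> xs (Suc m) = B (xs n \<ominus> xs m)" for n m
    using linear_op_diff[OF B, of "xs n" "xs m"] by (intro ip_eqI) (auto simp: XS ip_simps)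
  have step: "hnorm M (xs (n + k) \<ominus> xs n) \<le> r ^ n * K" for n k
  proof (induction n)
    case 0
    have "xs k \<ominus> \<zero> = xs k" by (intro ip_eqI) (auto simp: ip_simps)
    then show ?case using XK[of k] by (simp add: X0)
  next
    case (Suc n)
    have "hnorm M (xs (Suc n + k) \<ominus> xs (Suc n)) \<le> r * hnorm M (xs (n + k) \<ominus> xs n)"
      using bound[of "xs (n + k) \<ominus> xs n"] by (simp add: diff)
    also have "\<dots> \<le> r * (r ^ n * K)" using Suc r by (intro mult_left_mono) auto
    finally show ?case by simp
  qed
  have lim: "(\<lambda>n. r ^ n * K) \<longlonglongrightarrow> 0"
    using r by (intro tendsto_mult_left_zero LIMSEQ_realpow_zero) auto
  have cauchy: "\<exists>N. \<forall>m\<ge>N. \<forall>n\<ge>N. hnorm M (xs m \<ominus> xs n) < e" if e: "e > 0" for e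
  proof -
    obtain N where N: "\<And>n. n \<ge> N \<Longrightarrow> r ^ n * K < e"
      using order_tendstoD(2)[OF lim e] by (auto simp: eventually_sequentially)
    have "hnorm M (xs m \<ominus> xs n) < e" if "m \<ge> N" "n \<ge> N" for m n
    proof (cases "m \<ge> n")
      case True
      then show ?thesis using step[of n "m - n"] N[OF that(2)] by simp
    next
      case False
      then show ?thesis using step[of m "n - m"] N[OF that(1)] hnorm_diff_commute[of "xs m" "xs n"] by simp
    qed
    then show ?thesis by blast
  qed
  obtain x where x: "x \<in> carrier M" "(\<lambda>n. hnorm M (xs n \<ominus> x)) \<longlonglongrightarrow> 0"
    using cauchy_limit[OF xs cauchy] by blast
  have "hnorm M (x \<ominus> (c \<oplus> B x)) \<le> hnorm M (xs (Suc n) \<ominus> x) + r * hnorm M (xs n \<ominus> x)" for n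
  proof -
    have "hnorm M (x \<ominus> (c \<oplus> B x)) \<le> hnorm M (x \<ominus> xs (Suc n)) + hnorm M (xs (Suc n) \<ominus> (c \<oplus> B x))"
      using x by (intro hnorm_triangle3) auto
    also have "xs (Suc n) \<ominus> (c \<oplus> B x) = B (xs n \<ominus> x)"
      using linear_op_diff[OF B, of "xs n" x] x by (intro ip_eqI) (auto simp: XS ip_simps)
    also have "hnorm M (B (xs n \<ominus> x)) \<le> r * hnorm M (xs n \<ominus> x)" using x by (intro bound) auto
    also have "hnorm M (x \<ominus> xs (Suc n)) = hnorm M (xs (Suc n) \<ominus> x)" using x by (intro hnorm_diff_commute) auto
    finally show ?thesis by simp
  qed
  moreover have "(\<lambda>n. hnorm M (xs (Suc n) \<ominus> x) + r * hnorm M (xs n \<ominus> x)) \<longlonglongrightarrow> 0 + r * 0"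
    by (intro tendsto_intros LIMSEQ_Suc x(2))
  ultimately have "hnorm M (x \<ominus> (c \<oplus> B x)) \<le> 0"
    by (intro LIMSEQ_le_const[of "\<lambda>n. hnorm M (xs (Suc n) \<ominus> x) + r * hnorm M (xs n \<ominus> x)"]) auto
  then have "hnorm M (x \<ominus> (c \<oplus> B x)) = 0" using x by (simp add: antisym)
  then have "x = c \<oplus> B x" using x by (simp add: hnorm_eq_0_iff diff_eq_zero_iff)
  then show ?thesis using that x by blast
qed

lemma resolvent_solvable:
  assumes T: "contraction_op M T" and c: "cmod c < 1" and x: "x \<in> carrier M"
  obtains u where "u \<in> carrier M" "x = u \<ominus> c \<odot> T u"
proof -
  note L = contraction_opD(1)[OF T] and [simp] = linear_opD[OF contraction_opD(1)[OF T]]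
  have "linear_op M (\<lambda>u. c \<odot> T u)"
    unfolding linear_op_def by (auto intro!: ip_eqI simp: ip_simps algebra_simps)
  moreover have "hnorm M (c \<odot> T u) \<le> cmod c * hnorm M u" if "u \<in> carrier M" for u
    using that contraction_opD(2)[OF T that] by (simp add: hnorm_smult mult_left_mono)
  ultimately obtain u where u: "u \<in> carrier M" "u = x \<oplus> c \<odot> T u"
    using neumann_solvable[of "\<lambda>u. c \<odot> T u" "cmod c" x] c x by auto
  have "x = u \<ominus> c \<odot> T u"
  proof (rule ip_eqI)
    fix z assume "z \<in> carrier M"
    then show "ip M x z = ip M (u \<ominus> c \<odot> T u) z"
      using arg_cong[OF u(2), of "\<lambda>v. ip M v z"] u(1) x by (simp add: ip_simps)
  qed (use u x in auto)
  then show ?thesis using that u by blast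
qed

lemma resolvent_inj:
  assumes T: "contraction_op M T" and c: "cmod c < 1"
    and u: "u \<in> carrier M" and v: "v \<in> carrier M"
    and eq: "u \<ominus> c \<odot> T u = v \<ominus> c \<odot> T v"
  shows "u = v"
proof -
  note L = contraction_opD(1)[OF T] and [simp] = linear_opD[OF contraction_opD(1)[OF T]]
  have "u \<ominus> v = c \<odot> T (u \<ominus> v)"
  proof (rule ip_eqI)
    fix z assume "z \<in> carrier M"
    then show "ip M (u \<ominus> v) z = ip M (c \<odot> T (u \<ominus> v)) z"
      using arg_cong[OF eq, of "\<lambda>v. ip M v z"] u v
      by (simp add: linear_op_diff[OF L] ip_simps algebra_simps)
  qed (use u v in auto)
  then have "hnorm M (u \<ominus> v) = cmod c * hnorm M (T (u \<ominus> v))"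
    using u v by (metis M.minus_closed hnorm_smult linear_op_closed[OF L])
  also have "\<dots> \<le> cmod c * hnorm M (u \<ominus> v)"
    using u v contraction_opD(2)[OF T] by (intro mult_left_mono) auto
  finally have "(1 - cmod c) * hnorm M (u \<ominus> v) \<le> 0" by (simp add: algebra_simps)
  then have "hnorm M (u \<ominus> v) = 0"
    using c u v by (simp add: mult_le_0_iff antisym)
  then show ?thesis using u v by (simp add: hnorm_eq_0_iff diff_eq_zero_iff)
qed

section \<open>The operator s_T for a point of the symmetrized bidisc\<close>

context
  fixes T s
  assumes T: "contraction_op M T" and s: "s \<in> symm_bidisc"
begin

lemma cmod_fst_symm_bidisc: "cmod (fst s) < 2"
proof -
  obtain z w where "s = (z + w, z * w)" "cmod z < 1" "cmod w < 1"
    using s by (auto simp: symm_bidisc_def)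
  then show ?thesis using norm_triangle_ineq[of z w] by simp
qed

text \<open>Every vector is parametrised by some \<open>u\<close>, and in this parameter
  \<open>symm_op_apply\<close> is an explicit formula. All properties of \<open>symm_op\<close> are
  derived from the two, so \<open>inv_into\<close> never has to be handled again. The resolvent
  converges because half of \<open>fst s\<close> lies in the open disc.\<close>

lemma symm_op_domain:
  assumes x: "x \<in> carrier M"
  obtains u where "u \<in> carrier M" "x = 2 \<odot> u \<ominus> fst s \<odot> T u"
proof -
  note [simp] = linear_opD[OF contraction_opD(1)[OF T]]
  have "cmod (fst s / 2) < 1" using cmod_fst_symm_bidisc by (simp add: norm_divide)
  then obtain v where v: "v \<in> carrier M" "x = v \<ominus> (fst s / 2) \<odot> T v"
    using resolvent_solvable[OF T _ x] by blast
  have "x = 2 \<odot> ((1/2) \<odot> v) \<ominus> fst s \<odot> T ((1/2) \<odot> v)"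
    using v x by (intro ip_eqI) (auto simp: ip_simps algebra_simps)
  then show ?thesis using that[of "(1/2) \<odot> v"] v by simp
qed

lemma symm_op_apply:
  assumes u: "u \<in> carrier M"
  shows "symm_op M s T (2 \<odot> u \<ominus> fst s \<odot> T u)
    = (2 * snd s) \<odot> T u \<ominus> fst s \<odot> u"
proof -
  note [simp] = linear_opD[OF contraction_opD(1)[OF T]]
  have "inj_on (\<lambda>u. 2 \<odot> u \<ominus> fst s \<odot> T u) (carrier M)"
  proof (rule inj_onI)
    fix a b assume ab: "a \<in> carrier M" "b \<in> carrier M"
      and eq: "2 \<odot> a \<ominus> fst s \<odot> T a = 2 \<odot> b \<ominus> fst s \<odot> T b"
    have c: "cmod (fst s / 2) < 1" using cmod_fst_symm_bidisc by (simp add: norm_divide)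
    show "a = b"
    proof (rule resolvent_inj[OF T c ab])
      have "c \<ominus> (fst s / 2) \<odot> T c = (1/2) \<odot> (2 \<odot> c \<ominus> fst s \<odot> T c)" if "c \<in> carrier M" for c
        using that by (intro ip_eqI) (auto simp: ip_simps algebra_simps)
      then show "a \<ominus> (fst s / 2) \<odot> T a = b \<ominus> (fst s / 2) \<odot> T b"
        using ab eq by simp
    qed
  qed
  from inv_into_f_f[OF this u] show ?thesis by (simp add: symm_op_def Let_def)
qed

lemma symm_op_linear: "linear_op M (symm_op M s T)"
proof -
  note [simp] = linear_opD[OF contraction_opD(1)[OF T]]
  let ?D = "\<lambda>u. 2 \<odot> u \<ominus> fst s \<odot> T u"
  have cl: "symm_op M s T x \<in> carrier M" if "x \<in> carrier M" for x
    using symm_op_domain[OF that] symm_op_apply by (metis M.minus_closed linear_op_closed smult_mem contraction_opD(1)[OF T])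
  moreover have "symm_op M s T (x \<oplus> y) = symm_op M s T x \<oplus> symm_op M s T y"
    if x: "x \<in> carrier M" and y: "y \<in> carrier M" for x y
  proof -
    obtain u where u: "u \<in> carrier M" "x = ?D u" using symm_op_domain[OF x] by blast
    obtain v where v: "v \<in> carrier M" "y = ?D v" using symm_op_domain[OF y] by blast
    have "x \<oplus> y = ?D (u \<oplus> v)"
      using u v by (intro ip_eqI) (auto simp: ip_simps algebra_simps)
    then have "symm_op M s T (x \<oplus> y) = (2 * snd s) \<odot> T (u \<oplus> v) \<ominus> fst s \<odot> (u \<oplus> v)"
      using symm_op_apply[of "u \<oplus> v"] u(1) v(1) by (simp only: M.a_closed)
    also have "\<dots> = symm_op M s T x \<oplus> symm_op M s T y"
      unfolding u(2) v(2) symm_op_apply[OF u(1)] symm_op_apply[OF v(1)]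
      using u(1) v(1) by (intro ip_eqI) (auto simp: ip_simps algebra_simps)
    finally show ?thesis .
  qed
  moreover have "symm_op M s T (c \<odot> x) = c \<odot> symm_op M s T x"
    if x: "x \<in> carrier M" for c x
  proof -
    obtain u where u: "u \<in> carrier M" "x = ?D u" using symm_op_domain[OF x] by blast
    have "c \<odot> x = ?D (c \<odot> u)"
      using u by (intro ip_eqI) (auto simp: ip_simps algebra_simps)
    then have "symm_op M s T (c \<odot> x) = (2 * snd s) \<odot> T (c \<odot> u) \<ominus> fst s \<odot> (c \<odot> u)"
      using symm_op_apply[of "c \<odot> u"] u(1) by (simp only: smult_mem)
    also have "\<dots> = c \<odot> symm_op M s T x"
      unfolding u(2) symm_op_apply[OF u(1)]
      using u(1) by (intro ip_eqI) (auto simp: ip_simps algebra_simps)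
    finally show ?thesis .
  qed
  ultimately show ?thesis by (auto simp: linear_op_def)
qed

lemma symm_op_strict_contraction:
  obtains r where "0 \<le> r" "r < 1" "\<And>x. x \<in> carrier M \<Longrightarrow> hnorm M (symm_op M s T x) \<le> r * hnorm M x"
proof -
  obtain z w where zw: "s = (z + w, z * w)" "cmod z < 1" "cmod w < 1"
    using s by (auto simp: symm_bidisc_def)
  have "hnorm M (symm_op M s T x) \<le> max (cmod z) (cmod w) * hnorm M x" if x: "x \<in> carrier M" for x
  proof -
    obtain u where u: "u \<in> carrier M" "x = 2 \<odot> u \<ominus> fst s \<odot> T u" using symm_op_domain[OF x] by blast
    then show ?thesis
      using symm_strict[OF u(1) _ contraction_opD(2)[OF T u(1)] zw(2,3)]
        linear_op_closed[OF contraction_opD(1)[OF T] u(1)] zw(1) symm_op_apply[OF u(1)]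
      by simp
  qed
  then show ?thesis using that[of "max (cmod z) (cmod w)"] zw by (auto simp: max_def)
qed

lemma symm_op_bounded: "bounded_op M (symm_op M s T)"
  using symm_op_linear symm_op_strict_contraction unfolding bounded_op_def by metis

end

end

section \<open>Transfer functions on the symmetrized bidisc\<close>

lemma cmod_fst_le: "cmod (fst h) \<le> norm h" and cmod_snd_le: "cmod (snd h) \<le> norm h"
  using norm_fst_le[of "fst h" "snd h"] norm_snd_le[of "snd h" "fst h"] by simp_all

text \<open>A point lies in the set when both roots of \<open>t\<^sup>2 - fst s * t + snd s\<close>
  lie in the disc. At a root \<open>t\<close> of modulus at least one, the unperturbed polynomial
  has modulus at least \<open>((1 - r) * cmod t)\<^sup>2\<close>, while a perturbation
  \<open>h\<close> changes it by at most \<open>2 * norm h * cmod t\<close>. This explains the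
  radius \<open>(1 - r)\<^sup>2 / 2\<close>.\<close>

lemma open_symm_bidisc: "open symm_bidisc"
  unfolding open_dist
proof (intro ballI)
  fix p assume "p \<in> symm_bidisc"
  then obtain z w where zw: "p = (z + w, z * w)" "cmod z < 1" "cmod w < 1"
    by (auto simp: symm_bidisc_def)
  define r where "r = max (cmod z) (cmod w)"
  have r: "cmod z \<le> r" "cmod w \<le> r" "0 \<le> r" "r < 1" using zw by (auto simp: r_def max_def)
  have "s \<in> symm_bidisc" if s: "dist s p < (1 - r)\<^sup>2 / 2" for s
  proof -
    define h where "h = s - p"
    have h: "cmod (fst h) \<le> norm h" "cmod (snd h) \<le> norm h" "norm h < (1 - r)\<^sup>2 / 2"
      using s by (simp_all add: h_def dist_norm cmod_fst_le cmod_snd_le del: fst_diff snd_diff)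
    have root: "cmod t < 1" if t: "t\<^sup>2 - fst s * t + snd s = 0" for t
    proof (rule ccontr)
      assume "\<not> cmod t < 1"
      then have t1: "1 \<le> cmod t" by simp
      have "(t - z) * (t - w) = fst h * t - snd h"
        using t zw(1) by (simp add: h_def algebra_simps power2_eq_square)
      then have "cmod (t - z) * cmod (t - w) \<le> cmod (fst h) * cmod t + cmod (snd h)"
        by (metis norm_mult norm_triangle_ineq4)
      also have "\<dots> \<le> norm h * cmod t + norm h * cmod t"
      proof (rule add_mono)
        have "norm h * 1 \<le> norm h * cmod t" using t1 by (intro mult_left_mono) auto
        then show "cmod (snd h) \<le> norm h * cmod t" using h by linarith
      qed (use h in \<open>simp add: mult_right_mono\<close>)
      finally have le: "cmod (t - z) * cmod (t - w) \<le> 2 * norm h * cmod t" by (simp add: mult_ac)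
      have b: "(1 - r) * cmod t \<le> cmod (t - c)" if "cmod c \<le> r" for c
      proof -
        have "r * 1 \<le> r * cmod t" using t1 r by (intro mult_left_mono) auto
        then show ?thesis using norm_triangle_ineq2[of t c] that by (simp add: algebra_simps)
      qed
      have "((1 - r) * cmod t) * ((1 - r) * cmod t) \<le> cmod (t - z) * cmod (t - w)"
        using b r by (intro mult_mono) auto
      then have "(1 - r)\<^sup>2 * cmod t * cmod t \<le> 2 * norm h * cmod t"
        using le by (simp add: power2_eq_square mult_ac)
      then have "(1 - r)\<^sup>2 * cmod t \<le> 2 * norm h" using t1 by (auto simp: mult_le_cancel_right)
      moreover have "(1 - r)\<^sup>2 * 1 \<le> (1 - r)\<^sup>2 * cmod t" using t1 by (intro mult_left_mono) auto
      ultimately show False using h(3) by linarith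
    qed
    define d where "d = csqrt ((fst s)\<^sup>2 - 4 * snd s)"
    have d: "d\<^sup>2 = (fst s)\<^sup>2 - 4 * snd s" by (simp add: d_def)
    define a where "a = (fst s + d) / 2"
    define b where "b = (fst s - d) / 2"
    have sum: "fst s = a + b" unfolding a_def b_def by (simp flip: add_divide_distrib)
    have "4 * (a * b) = (fst s)\<^sup>2 - d\<^sup>2" by (simp add: a_def b_def power2_eq_square algebra_simps)
    then have prod: "snd s = a * b" by (simp add: d)
    have "cmod a < 1" by (rule root) (simp add: sum prod power2_eq_square algebra_simps)
    moreover have "cmod b < 1" by (rule root) (simp add: sum prod power2_eq_square algebra_simps)
    moreover have "s = (a + b, a * b)" by (simp add: prod_eq_iff flip: sum prod)
    ultimately show ?thesis unfolding symm_bidisc_def by blast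
  qed
  moreover have "(1 - r)\<^sup>2 / 2 > 0" using r by simp
  ultimately show "\<exists>e>0. \<forall>y. dist y p < e \<longrightarrow> y \<in> symm_bidisc" by blast
qed

lemma symm_bidisc_bounds:
  assumes "s \<in> symm_bidisc"
  shows "cmod (fst s) \<le> 2" "cmod (snd s) \<le> 1"
proof -
  obtain z w where zw: "s = (z + w, z * w)" "cmod z < 1" "cmod w < 1"
    using assms by (auto simp: symm_bidisc_def)
  then show "cmod (fst s) \<le> 2" using norm_triangle_ineq[of z w] by simp
  show "cmod (snd s) \<le> 1" using zw mult_mono[of "cmod z" 1 "cmod w" 1] by (simp add: norm_mult)
qed

section \<open>Unitary colligations on the sum of the scalars and M\<close>

definition complex_hsum :: "('a, 'b) hilbert_scheme \<Rightarrow> (complex \<times> 'a) hilbert"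
  where "complex_hsum M = \<lparr>carrier = UNIV \<times> carrier M, monoid.mult = (\<lambda>x y. x),
    one = (0, \<zero>\<^bsub>M\<^esub>), ring.zero = (0, \<zero>\<^bsub>M\<^esub>),
    add = (\<lambda>x y. (fst x + fst y, snd x \<oplus>\<^bsub>M\<^esub> snd y)),
    smult = (\<lambda>c x. (c * fst x, c \<odot>\<^bsub>M\<^esub> snd x)),
    ip = (\<lambda>x y. fst x * cnj (fst y) + ip M (snd x) (snd y))\<rparr>"

context inner_space
begin

lemma complex_hsum_simps [simp]:
  "x \<in> carrier (complex_hsum M) \<longleftrightarrow> snd x \<in> carrier M"
  "\<zero>\<^bsub>complex_hsum M\<^esub> = (0, \<zero>)"
  "x \<oplus>\<^bsub>complex_hsum M\<^esub> y = (fst x + fst y, snd x \<oplus> snd y)"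
  "c \<odot>\<^bsub>complex_hsum M\<^esub> x = (c * fst x, c \<odot> snd x)"
  "ip (complex_hsum M) x y = fst x * cnj (fst y) + ip M (snd x) (snd y)"
  by (auto simp: complex_hsum_def mem_Times_iff)

lemma inner_space_complex_hsum: "inner_space (complex_hsum M)" (is "inner_space ?H")
proof (intro inner_space.intro inner_space_axioms.intro moduleI abelian_groupI)
  show "cring (ring_of_type_algebra :: complex ring)" by (rule cring_from_type_algebra)
  fix x y z assume x: "x \<in> carrier ?H" and y: "y \<in> carrier ?H"
    and z: "z \<in> carrier ?H"
  show "x \<oplus>\<^bsub>?H\<^esub> y \<oplus>\<^bsub>?H\<^esub> z = x \<oplus>\<^bsub>?H\<^esub> (y \<oplus>\<^bsub>?H\<^esub> z)"
    using x y z by (simp add: M.a_assoc)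
  show "ip ?H (x \<oplus>\<^bsub>?H\<^esub> y) z = ip ?H x z + ip ?H y z"
    using x y z by (simp add: ip_simps algebra_simps)
next
  fix x y assume x: "x \<in> carrier ?H" and y: "y \<in> carrier ?H"
  show "x \<oplus>\<^bsub>?H\<^esub> y = y \<oplus>\<^bsub>?H\<^esub> x"
    using x y by (simp add: M.a_comm)
  show "ip ?H x y = cnj (ip ?H y x)"
    using ip_commute[of "snd x" "snd y"] x y by simp
  show "a \<odot>\<^bsub>?H\<^esub> (x \<oplus>\<^bsub>?H\<^esub> y) = a \<odot>\<^bsub>?H\<^esub> x \<oplus>\<^bsub>?H\<^esub> a \<odot>\<^bsub>?H\<^esub> y" for a
    using x y smult_r_distr[of a "snd x" "snd y"] by (simp add: algebra_simps)
  show "ip ?H (c \<odot>\<^bsub>?H\<^esub> x) y = c * ip ?H x y" for c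
    using x y by (simp add: ip_simps algebra_simps)
next
  fix x assume x: "x \<in> carrier ?H"
  show "\<exists>y\<in>carrier ?H. y \<oplus>\<^bsub>?H\<^esub> x = \<zero>\<^bsub>?H\<^esub>"
    using x by (intro bexI[of _ "(- fst x, \<ominus> snd x)"]) (auto simp: M.l_neg)
  show "(a \<oplus>\<^bsub>ring_of_type_algebra\<^esub> b) \<odot>\<^bsub>?H\<^esub> x = a \<odot>\<^bsub>?H\<^esub> x \<oplus>\<^bsub>?H\<^esub> b \<odot>\<^bsub>?H\<^esub> x" for a b
    using x smult_l_distr[of a b "snd x"] by (simp add: algebra_simps)
  show "(a \<otimes>\<^bsub>ring_of_type_algebra\<^esub> b) \<odot>\<^bsub>?H\<^esub> x = a \<odot>\<^bsub>?H\<^esub> (b \<odot>\<^bsub>?H\<^esub> x)" for a b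
    using x smult_assoc1[of a b "snd x"] by (simp add: algebra_simps)
  show "\<one>\<^bsub>ring_of_type_algebra\<^esub> \<odot>\<^bsub>?H\<^esub> x = x"
    using x smult_one[of "snd x"] by simp
  assume "x \<noteq> \<zero>\<^bsub>?H\<^esub>"
  then have "fst x \<noteq> 0 \<or> snd x \<noteq> \<zero>" by (metis complex_hsum_simps(2) prod.collapse)
  moreover have "Re (fst x * cnj (fst x)) = (cmod (fst x))\<^sup>2"
    by (simp add: complex_norm_square[symmetric] del: of_real_power)
  ultimately show "0 < Re (ip ?H x x)"
    using x ip_pos[of "snd x"] ip_self_ge_0[of "snd x"]
    by (auto simp del: complex_mult_cnj intro: add_pos_nonneg add_nonneg_pos)
qed auto

text \<open>The lurking isometry argument.\<close>

lemma unitary_colligation: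
  assumes I: "finite I" and x: "\<And>i. i \<in> I \<Longrightarrow> x i \<in> carrier M" and v: "\<And>i. i \<in> I \<Longrightarrow> v i \<in> carrier M"
    and gram: "\<And>i j. \<lbrakk>i \<in> I; j \<in> I\<rbrakk> \<Longrightarrow> 1 + ip M (x i) (x j) = w i * cnj (w j) + ip M (v i) (v j)"
  obtains a b c d where "c \<in> carrier M" "linear_op M d"
    "\<And>x y. \<lbrakk>x \<in> carrier M; y \<in> carrier M\<rbrakk> \<Longrightarrow> b (x \<oplus> y) = b x + b y"
    "\<And>k x. x \<in> carrier M \<Longrightarrow> b (k \<odot> x) = k * b x"
    "\<And>k x. x \<in> carrier M \<Longrightarrow>
      (cmod (k * a + b x))\<^sup>2 + (hnorm M (k \<odot> c \<oplus> d x))\<^sup>2 = (cmod k)\<^sup>2 + (hnorm M x)\<^sup>2"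
    "\<And>i. i \<in> I \<Longrightarrow> a + b (x i) = w i" "\<And>i. i \<in> I \<Longrightarrow> c \<oplus> d (x i) = v i"
proof -
  interpret S: inner_space "complex_hsum M" by (rule inner_space_complex_hsum)
  have "\<exists>U V. S.unitary_pair U V \<and> (\<forall>i\<in>I. U (1, x i) = (w i, v i))"
    by (rule S.unitary_extension[OF I]) (use x v gram in auto)
  then obtain U V where UV: "S.unitary_pair U V" and U: "\<And>i. i \<in> I \<Longrightarrow> U (1, x i) = (w i, v i)"
    by blast
  note L = S.unitary_pairD(1)[OF UV]
  \<comment> \<open>The four blocks of \<open>U\<close>: \<open>a\<close> and \<open>c\<close> come
    from the scalar summand, \<open>b\<close> and \<open>d\<close> from \<open>M\<close>.\<close>
  define a where "a = fst (U (1, \<zero>))"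
  define c where "c = snd (U (1, \<zero>))"
  define b where "b x = fst (U (0, x))" for x
  define d where "d x = snd (U (0, x))" for x
  have cl: "snd (U (k, y)) \<in> carrier M" if "y \<in> carrier M" for k y
    using S.unitary_pairD(3)[OF UV, of "(k, y)"] that by simp
  have Ukx: "U (k, y) = (k * a + b y, k \<odot> c \<oplus> d y)" if "y \<in> carrier M" for k y
  proof -
    have "(k, y) = k \<odot>\<^bsub>complex_hsum M\<^esub> (1, \<zero>) \<oplus>\<^bsub>complex_hsum M\<^esub> (0, y)"
      using that by (auto intro!: ip_eqI simp: ip_simps)
    also have "U \<dots> = k \<odot>\<^bsub>complex_hsum M\<^esub> U (1, \<zero>) \<oplus>\<^bsub>complex_hsum M\<^esub> U (0, y)"
      using that by (subst linear_op_add[OF L], simp, simp, subst linear_op_smult[OF L], simp, simp)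
    finally show ?thesis by (simp add: a_def b_def c_def d_def)
  qed
  show thesis
  proof (rule that[of c d b a])
    show "c \<in> carrier M" by (simp add: c_def cl)
    have add: "U (0, y \<oplus> z) = U (0, y) \<oplus>\<^bsub>complex_hsum M\<^esub> U (0, z)"
      if "y \<in> carrier M" "z \<in> carrier M" for y z
      using linear_op_add[OF L, of "(0, y)" "(0, z)"] that by simp
    have smult: "U (0, k \<odot> y) = k \<odot>\<^bsub>complex_hsum M\<^esub> U (0, y)" if "y \<in> carrier M" for k y
      using linear_op_smult[OF L, of "(0, y)" k] that by simp
    show "linear_op M d" using add smult cl by (auto simp: linear_op_def d_def)
    show "b (y \<oplus> z) = b y + b z" if "y \<in> carrier M" "z \<in> carrier M" for y z
      using add that by (simp add: b_def)
    show "b (k \<odot> y) = k * b y" if "y \<in> carrier M" for k y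
      using smult that by (simp add: b_def)
    show "a + b (x i) = w i" "c \<oplus> d (x i) = v i" if "i \<in> I" for i
      using U[OF that] Ukx[of "x i" 1] x[OF that] smult_one[of c] cl[of \<zero> 1] by (simp_all add: c_def)
    show "(cmod (k * a + b y))\<^sup>2 + (hnorm M (k \<odot> c \<oplus> d y))\<^sup>2 = (cmod k)\<^sup>2 + (hnorm M y)\<^sup>2"
      if y: "y \<in> carrier M" for k y
    proof -
      have cd: "c \<in> carrier M" "d y \<in> carrier M" using y cl by (auto simp: c_def d_def)
      have "ip (complex_hsum M) (U (k, y)) (U (k, y)) = ip (complex_hsum M) (k, y) (k, y)"
        using y by (intro S.unitary_pairD(8)[OF UV]) auto
      then have "(k * a + b y) * cnj (k * a + b y) + ip M (k \<odot> c \<oplus> d y) (k \<odot> c \<oplus> d y)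
        = k * cnj k + ip M y y"
        unfolding Ukx[OF y] by simp
      then have "complex_of_real ((cmod (k * a + b y))\<^sup>2 + (hnorm M (k \<odot> c \<oplus> d y))\<^sup>2)
        = of_real ((cmod k)\<^sup>2 + (hnorm M y)\<^sup>2)"
        using y cd by (simp only: of_real_add complex_norm_square ip_self M.a_closed smult_mem)
      then show ?thesis using of_real_eq_iff by blast
    qed
  qed
qed

end

text \<open>In terms of \<open>x = (2 - s\<^sup>1 T) y\<close> the transfer function \<open>a + b s\<^sub>T (1 - d s\<^sub>T)\<^sup>-\<^sup>1 c\<close> involves only
  the inverse of the operator \<open>q s\<close> below, which is affine in \<open>s\<close>.\<close>

locale transfer_function = hilbert_space M for M :: "('a, 'b) hilbert_scheme" (structure) +
  fixes T d :: "'a \<Rightarrow> 'a" and a :: complex and b :: "'a \<Rightarrow> complex" and c :: 'a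
  assumes T: "contraction_op M T" and d: "linear_op M d" and c: "c \<in> carrier M"
    and b_add: "\<lbrakk>x \<in> carrier M; y \<in> carrier M\<rbrakk> \<Longrightarrow> b (x \<oplus> y) = b x + b y"
    and b_smult: "x \<in> carrier M \<Longrightarrow> b (k \<odot> x) = k * b x"
    and colligation: "x \<in> carrier M \<Longrightarrow>
      (cmod (k * a + b x))\<^sup>2 + (hnorm M (k \<odot> c \<oplus> d x))\<^sup>2 = (cmod k)\<^sup>2 + (hnorm M x)\<^sup>2"
begin

text \<open>With \<open>x = den s y\<close> one has \<open>num s y\<close> equal to
  \<open>s_T\<close> applied to \<open>x\<close>. Hence \<open>q s y = c\<close> says that
  \<open>x\<close> solves \<open>x = c + d (s_T x)\<close>, and \<open>sol s\<close> encodes the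
  vector \<open>(1 - d s_T)\<^sup>-\<^sup>1 c\<close> without an operator inverse.\<close>

definition num where "num s y = (2 * snd s) \<odot> T y \<ominus> fst s \<odot> y" for s y
definition den where "den s y = 2 \<odot> y \<ominus> fst s \<odot> T y" for s y
definition q where "q s y = den s y \<ominus> d (num s y)" for s y
definition sol where "sol s = (SOME y. y \<in> carrier M \<and> q s y = c)" for s
definition \<phi> where "\<phi> s = a + b (num s (sol s))" for s

lemmas T_lin = contraction_opD(1)[OF T] and T_le = contraction_opD(2)[OF T]
lemmas [simp] = linear_opD[OF T_lin] linear_opD[OF d] c b_add b_smult linear_op_diff[OF T_lin] linear_op_diff[OF d]

lemma b_diff [simp]: "\<lbrakk>x \<in> carrier M; y \<in> carrier M\<rbrakk> \<Longrightarrow> b (x \<ominus> y) = b x - b y"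
proof -
  assume xy: "x \<in> carrier M" "y \<in> carrier M"
  have "x \<ominus> y = x \<oplus> (-1) \<odot> y" using xy by (intro ip_eqI) (auto simp: ip_simps)
  then show ?thesis using xy by simp
qed

lemma num_den_closed [simp]: "y \<in> carrier M \<Longrightarrow> num s y \<in> carrier M"
    "y \<in> carrier M \<Longrightarrow> den s y \<in> carrier M" "y \<in> carrier M \<Longrightarrow> q s y \<in> carrier M"
  by (auto simp: num_def den_def q_def)

lemma num_le:
  "y \<in> carrier M \<Longrightarrow> hnorm M (num s y) \<le> 2 * cmod (snd s) * hnorm M (T y) + cmod (fst s) * hnorm M y"
  unfolding num_def using hnorm_triangle_diff[of "(2 * snd s) \<odot> T y" "fst s \<odot> y"]
  by (simp add: hnorm_smult norm_mult)

lemma bd_le: assumes x: "x \<in> carrier M" shows "cmod (b x) \<le> hnorm M x" "hnorm M (d x) \<le> hnorm M x"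
proof -
  have "0 \<odot> c \<oplus> d x = d x" using x by (intro ip_eqI) (auto simp: ip_simps)
  then have "(cmod (b x))\<^sup>2 + (hnorm M (d x))\<^sup>2 = (hnorm M x)\<^sup>2" using colligation[OF x, of 0] by simp
  then have "(cmod (b x))\<^sup>2 \<le> (hnorm M x)\<^sup>2" "(hnorm M (d x))\<^sup>2 \<le> (hnorm M x)\<^sup>2"
    by (metis le_add_same_cancel1 le_add_same_cancel2 zero_le_power2)+
  then show "cmod (b x) \<le> hnorm M x" "hnorm M (d x) \<le> hnorm M x"
    using x by (auto intro: power2_le_imp_le)
qed

lemma symm_op_den: "\<lbrakk>s \<in> symm_bidisc; y \<in> carrier M\<rbrakk> \<Longrightarrow> symm_op M s T (den s y) = num s y"
  unfolding den_def num_def by (rule symm_op_apply[OF T])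

text \<open>The bound multiplies two gaps: \<open>den\<close> is bounded below by
  \<open>2 - cmod (fst s)\<close> because \<open>T\<close> is a contraction, and \<open>d\<close>
  after \<open>s_T\<close> has norm at most \<open>r < 1\<close>. It yields uniqueness of
  \<open>sol\<close> and absorbs the remainder in the proof of differentiability.\<close>

lemma q_lower_bound:
  assumes s: "s \<in> symm_bidisc"
  obtains \<delta> where "\<delta> > 0" "\<And>y. y \<in> carrier M \<Longrightarrow> \<delta> * hnorm M y \<le> hnorm M (q s y)"
proof -
  obtain r where r: "0 \<le> r" "r < 1" "\<And>x. x \<in> carrier M \<Longrightarrow> hnorm M (symm_op M s T x) \<le> r * hnorm M x"
    using symm_op_strict_contraction[OF T s] by blast
  have f: "cmod (fst s) < 2" by (rule cmod_fst_symm_bidisc[OF T s])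
  have "(1 - r) * (2 - cmod (fst s)) * hnorm M y \<le> hnorm M (q s y)" if y: "y \<in> carrier M" for y
  proof -
    have "cmod (fst s) * hnorm M (T y) \<le> cmod (fst s) * hnorm M y"
      using T_le[OF y] by (intro mult_left_mono) auto
    then have "(2 - cmod (fst s)) * hnorm M y \<le> hnorm M (den s y)"
      using hnorm_triangle_diff'[of "2 \<odot> y" "fst s \<odot> T y"] y
      by (simp add: den_def hnorm_smult algebra_simps)
    then have "(1 - r) * ((2 - cmod (fst s)) * hnorm M y) \<le> (1 - r) * hnorm M (den s y)"
      using r by (intro mult_left_mono) auto
    also have "\<dots> \<le> hnorm M (den s y) - hnorm M (d (num s y))"
      using bd_le(2)[of "num s y"] r(3)[of "den s y"] symm_op_den[OF s y] y by (simp add: algebra_simps)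
    also have "\<dots> \<le> hnorm M (q s y)" unfolding q_def using y by (intro hnorm_triangle_diff') auto
    finally show ?thesis by (simp add: mult.assoc)
  qed
  then show ?thesis using that[of "(1 - r) * (2 - cmod (fst s))"] r f by simp
qed

lemma q_solvable:
  assumes s: "s \<in> symm_bidisc" and g: "g \<in> carrier M"
  obtains y where "y \<in> carrier M" "q s y = g"
proof -
  obtain r where r: "0 \<le> r" "r < 1" "\<And>x. x \<in> carrier M \<Longrightarrow> hnorm M (symm_op M s T x) \<le> r * hnorm M x"
    using symm_op_strict_contraction[OF T s] by blast
  note S [simp] = linear_opD[OF symm_op_linear[OF T s]]
  have 1: "linear_op M (\<lambda>x. d (symm_op M s T x))" by (auto simp: linear_op_def)
  have 2: "hnorm M (d (symm_op M s T x)) \<le> r * hnorm M x" if "x \<in> carrier M" for x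
    using bd_le(2)[of "symm_op M s T x"] r(3)[OF that] that by simp
  obtain x where x: "x \<in> carrier M" "x = g \<oplus> d (symm_op M s T x)"
    using neumann_solvable[OF 1 r(1,2) 2 g] by blast
  obtain y where y: "y \<in> carrier M" "x = den s y" using symm_op_domain[OF T s x(1)] by (metis den_def)
  have "den s y = g \<oplus> d (num s y)" using x(2) unfolding y(2) symm_op_den[OF s y(1)] .
  then have "q s y = g" unfolding q_def using y(1) g by (intro ip_eqI) (auto simp: ip_simps)
  then show ?thesis using that y by blast
qed

lemma sol: "s \<in> symm_bidisc \<Longrightarrow> sol s \<in> carrier M \<and> q s (sol s) = c"
  unfolding sol_def by (rule someI_ex) (metis c q_solvable)

lemma q_inj:
  assumes s: "s \<in> symm_bidisc" and y: "y \<in> carrier M" "y' \<in> carrier M" and eq: "q s y = q s y'"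
  shows "y = y'"
proof -
  obtain \<delta> where \<delta>: "\<delta> > 0" "\<And>y. y \<in> carrier M \<Longrightarrow> \<delta> * hnorm M y \<le> hnorm M (q s y)"
    using q_lower_bound[OF s] by blast
  have "q s (y \<ominus> y') = q s y \<ominus> q s y'"
    using y by (intro ip_eqI) (auto simp: q_def num_def den_def ip_simps algebra_simps)
  also have "\<dots> = \<zero>" using eq y by (simp add: diff_eq_zero_iff)
  finally have "\<delta> * hnorm M (y \<ominus> y') \<le> 0" using \<delta>(2)[of "y \<ominus> y'"] y by simp
  then have "hnorm M (y \<ominus> y') = 0" using \<delta>(1) y by (simp add: mult_le_0_iff antisym)
  then show ?thesis using y by (simp add: hnorm_eq_0_iff diff_eq_zero_iff)
qed

lemma den_sol: "s \<in> symm_bidisc \<Longrightarrow> den s (sol s) = c \<oplus> d (num s (sol s))"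
proof (rule ip_eqI)
  fix z assume s: "s \<in> symm_bidisc" and z: "z \<in> carrier M"
  show "ip M (den s (sol s)) z = ip M (c \<oplus> d (num s (sol s))) z"
    using arg_cong[OF conjunct2[OF sol[OF s]], of "\<lambda>x. ip M x z"] conjunct1[OF sol[OF s]] z
    by (simp add: q_def ip_simps diff_eq_eq)
qed (use sol in auto)

text \<open>The colligation maps the scalar 1 and \<open>num s (sol s)\<close> to
  \<open>\<phi> s\<close> and \<open>den s (sol s)\<close> while preserving the total square norm,
  and \<open>num\<close> is no longer than \<open>den\<close>, being its image under
  \<open>s_T\<close>.\<close>

lemma \<phi>_bound:
  assumes s: "s \<in> symm_bidisc"
  shows "cmod (\<phi> s) \<le> 1"
proof -
  have y: "sol s \<in> carrier M" using sol[OF s] by simp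
  obtain r where r: "0 \<le> r" "r < 1" "\<And>x. x \<in> carrier M \<Longrightarrow> hnorm M (symm_op M s T x) \<le> r * hnorm M x"
    using symm_op_strict_contraction[OF T s] by blast
  have "hnorm M (num s (sol s)) \<le> r * hnorm M (den s (sol s))"
    using r(3)[of "den s (sol s)"] symm_op_den[OF s y] y by simp
  also have "\<dots> \<le> 1 * hnorm M (den s (sol s))" using r y by (intro mult_right_mono) auto
  finally have "(hnorm M (num s (sol s)))\<^sup>2 \<le> (hnorm M (den s (sol s)))\<^sup>2" using y by (intro power_mono) auto
  moreover have "(cmod (\<phi> s))\<^sup>2 + (hnorm M (den s (sol s)))\<^sup>2 = 1 + (hnorm M (num s (sol s)))\<^sup>2"
    using colligation[of "num s (sol s)" 1] y smult_one[of c] by (simp add: \<phi>_def den_sol[OF s])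
  ultimately have "(cmod (\<phi> s))\<^sup>2 \<le> 1\<^sup>2" by simp
  then show ?thesis by (rule power2_le_imp_le) simp
qed

text \<open>The hypothesis identifies \<open>v\<close> as the unique solution of the equation
  encoded by \<open>sol s\<close>.\<close>

lemma \<phi>_interpolates:
  assumes s: "s \<in> symm_bidisc" and v: "v \<in> carrier M" and eq: "c \<oplus> d (symm_op M s T v) = v"
  shows "\<phi> s = a + b (symm_op M s T v)"
proof -
  obtain y where y: "y \<in> carrier M" "v = den s y" using symm_op_domain[OF T s v] by (metis den_def)
  have "c \<oplus> d (num s y) = den s y" using eq unfolding y(2) symm_op_den[OF s y(1)] .
  then have "q s y = (c \<oplus> d (num s y)) \<ominus> d (num s y)" by (simp add: q_def)
  also have "\<dots> = c" using y(1) by (intro ip_eqI) (auto simp: ip_simps)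
  finally have "q s y = c" .
  then have "sol s = y" using q_inj[OF s] sol[OF s] y(1) by metis
  then show ?thesis by (simp add: \<phi>_def y(2) symm_op_den[OF s y(1)])
qed

text \<open>Since \<open>q\<close> is affine in \<open>s\<close>, its increment in direction
  \<open>h\<close> is \<open>- P h\<close>. Differentiating \<open>q s (sol s) = c\<close> formally
  gives \<open>q p (g h) = P h y0\<close>, which defines the candidate derivative \<open>g\<close>
  of \<open>sol\<close>. The remainder \<open>r\<close> then satisfies
  \<open>q p r = P h (g h) + P h r\<close>, and the lower bound on \<open>q p\<close> makes it
  quadratically small.\<close>

lemma \<phi>_differentiable:
  assumes p: "p \<in> symm_bidisc"
  shows "\<exists>\<alpha> \<beta>. (\<phi> has_derivative (\<lambda>h. \<alpha> * fst h + \<beta> * snd h)) (at p)"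
proof -
  obtain \<delta> where \<delta>: "\<delta> > 0" "\<And>y. y \<in> carrier M \<Longrightarrow> \<delta> * hnorm M y \<le> hnorm M (q p y)"
    using q_lower_bound[OF p] by blast
  define P where "P h y = fst h \<odot> (T y \<ominus> d y) \<oplus> (2 * snd h) \<odot> d (T y)" for h y
  have P_cl [simp]: "P h y \<in> carrier M" if "y \<in> carrier M" for h y using that by (simp add: P_def)
  have qP: "q (p + h) y = q p y \<ominus> P h y" if "y \<in> carrier M" for h y
    using that by (intro ip_eqI) (auto simp: q_def num_def den_def P_def ip_simps algebra_simps)
  have P_le: "hnorm M (P h y) \<le> 4 * norm h * hnorm M y" if y: "y \<in> carrier M" for h y
  proof -
    have 1: "hnorm M (T y \<ominus> d y) \<le> 2 * hnorm M y"
      using hnorm_triangle_diff[of "T y" "d y"] T_le[OF y] bd_le(2)[OF y] y by simp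
    have 2: "hnorm M (d (T y)) \<le> hnorm M y" using bd_le(2)[of "T y"] T_le[OF y] y by simp
    have "hnorm M (P h y) \<le> cmod (fst h) * hnorm M (T y \<ominus> d y) + 2 * cmod (snd h) * hnorm M (d (T y))"
      unfolding P_def using hnorm_triangle[of "fst h \<odot> (T y \<ominus> d y)" "(2 * snd h) \<odot> d (T y)"] y
      by (simp add: hnorm_smult norm_mult)
    also have "\<dots> \<le> norm h * (2 * hnorm M y) + (2 * norm h) * hnorm M y"
      using 1 2 cmod_fst_le[of h] cmod_snd_le[of h] y by (intro add_mono mult_mono) auto
    finally show ?thesis by simp
  qed
  define y0 where "y0 = sol p"
  have y0 [simp]: "y0 \<in> carrier M" "q p y0 = c" using sol[OF p] by (auto simp: y0_def)
  \<comment> \<open>The partial derivatives of \<open>sol\<close> at \<open>p\<close>. Building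
    \<open>g h\<close> from them makes it linear in \<open>h\<close> by construction.\<close>
  obtain g1 where g1: "g1 \<in> carrier M" "q p g1 = P (1, 0) y0" using q_solvable[OF p, of "P (1, 0) y0"] by auto
  obtain g2 where g2: "g2 \<in> carrier M" "q p g2 = P (0, 1) y0" using q_solvable[OF p, of "P (0, 1) y0"] by auto
  note [simp] = g1(1) g2(1)
  define g where "g h = fst h \<odot> g1 \<oplus> snd h \<odot> g2" for h
  have g_cl [simp]: "g h \<in> carrier M" for h by (simp add: g_def)
  define K where "K = hnorm M g1 + hnorm M g2"
  have K: "0 \<le> K" by (simp add: K_def)
  have g_le: "hnorm M (g h) \<le> K * norm h" for h
  proof -
    have "hnorm M (g h) \<le> cmod (fst h) * hnorm M g1 + cmod (snd h) * hnorm M g2"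
      unfolding g_def using hnorm_triangle[of "fst h \<odot> g1" "snd h \<odot> g2"] by (simp add: hnorm_smult)
    also have "\<dots> \<le> norm h * hnorm M g1 + norm h * hnorm M g2"
      using cmod_fst_le[of h] cmod_snd_le[of h] by (intro add_mono mult_right_mono) auto
    finally show ?thesis by (simp add: K_def algebra_simps)
  qed
  have qg: "q p (g h) = P h y0" for h
  proof -
    have "q p (g h) = fst h \<odot> q p g1 \<oplus> snd h \<odot> q p g2"
      by (intro ip_eqI) (auto simp: g_def q_def num_def den_def ip_simps algebra_simps)
    also have "\<dots> = P h y0" unfolding g1(2) g2(2)
      by (intro ip_eqI) (auto simp: P_def ip_simps algebra_simps)
    finally show ?thesis .
  qed
  \<comment> \<open>Product rule for \<open>a + b (num s (sol s))\<close>: one summand comes from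
    moving \<open>sol\<close>, the other from moving \<open>s\<close> inside
    \<open>num\<close>.\<close>
  define \<alpha> where "\<alpha> = b (num p g1) - b y0"
  define \<beta> where "\<beta> = b (num p g2) + 2 * b (T y0)"
  \<comment> \<open>The first summand bounds the cross term \<open>e1\<close> of two increments. The
    second bounds the remainder \<open>r\<close>, where 4 is a norm bound for \<open>num\<close> on
    the symmetrized bidisc.\<close>
  define C where "C = 3 * K + 4 * (8 * K / \<delta>)"
  have C: "0 \<le> C" using K \<delta> by (simp add: C_def)
  have main: "cmod (\<phi> (p + h) - \<phi> p - (\<alpha> * fst h + \<beta> * snd h)) \<le> C * (norm h)\<^sup>2"
    if h: "p + h \<in> symm_bidisc" "norm h \<le> \<delta> / 8" for h
  proof -
    define y where "y = sol (p + h)"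
    have y [simp]: "y \<in> carrier M" "q (p + h) y = c" using sol[OF h(1)] by (auto simp: y_def)
    define r where "r = y \<ominus> (y0 \<oplus> g h)"
    have r [simp]: "r \<in> carrier M" by (simp add: r_def)
    have q_lin: "q s r = q s y \<ominus> (q s y0 \<oplus> q s (g h))" for s
      by (intro ip_eqI) (auto simp: r_def q_def num_def den_def ip_simps algebra_simps)
    have "q (p + h) r = P h (g h)"
      unfolding q_lin y(2) qP[OF y0(1)] qP[OF g_cl] y0(2) qg
      by (intro ip_eqI) (auto simp: ip_simps)
    then have "P h (g h) = q p r \<ominus> P h r" by (simp add: qP)
    then have qr: "q p r = P h (g h) \<oplus> P h r"
      by (simp only:) (intro ip_eqI, auto simp: ip_simps)
    have "\<delta> * hnorm M r \<le> hnorm M (P h (g h)) + hnorm M (P h r)"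
      using \<delta>(2)[OF r] hnorm_triangle[of "P h (g h)" "P h r"] by (simp add: qr)
    also have "hnorm M (P h r) \<le> 4 * norm h * hnorm M r" by (rule P_le) simp
    \<comment> \<open>With \<open>norm h\<close> at most \<open>\<delta> / 8\<close> this term is
      half of the left-hand side and is absorbed there.\<close>
    also have "\<dots> \<le> 4 * (\<delta> / 8) * hnorm M r" using h(2) by (intro mult_right_mono) auto
    also have "hnorm M (P h (g h)) \<le> 4 * norm h * (K * norm h)"
      using P_le[OF g_cl] g_le[of h] by (meson mult_left_mono order_trans norm_ge_zero mult_nonneg_nonneg zero_le_numeral)
    finally have "\<delta> * hnorm M r \<le> 8 * K * (norm h)\<^sup>2" by (simp add: power2_eq_square algebra_simps)
    then have r_le: "hnorm M r \<le> 8 * K / \<delta> * (norm h)\<^sup>2" using \<delta>(1) by (simp add: field_simps)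
    have y_eq: "y = r \<oplus> (y0 \<oplus> g h)" by (intro ip_eqI) (auto simp: r_def ip_simps)
    define e1 where "e1 = (2 * snd h) \<odot> T (g h) \<ominus> fst h \<odot> g h"
    have e1_cl [simp]: "e1 \<in> carrier M" by (simp add: e1_def)
    have "\<phi> (p + h) - \<phi> p - (\<alpha> * fst h + \<beta> * snd h) = b (num (p + h) y) - b (num p y0) - (\<alpha> * fst h + \<beta> * snd h)"
      by (simp add: \<phi>_def y_def y0_def)
    also have "\<dots> = b e1 + b (num (p + h) r)"
      unfolding y_eq by (simp add: e1_def num_def g_def \<alpha>_def \<beta>_def algebra_simps)
    finally have "cmod (\<phi> (p + h) - \<phi> p - (\<alpha> * fst h + \<beta> * snd h)) \<le> cmod (b e1) + cmod (b (num (p + h) r))"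
      using norm_triangle_ineq by metis
    also have "cmod (b e1) \<le> hnorm M e1" by (rule bd_le) simp
    also have "hnorm M e1 \<le> 3 * norm h * (K * norm h)"
    proof -
      have "hnorm M e1 \<le> 2 * cmod (snd h) * hnorm M (T (g h)) + cmod (fst h) * hnorm M (g h)"
        unfolding e1_def using hnorm_triangle_diff[of "(2 * snd h) \<odot> T (g h)" "fst h \<odot> g h"]
        by (simp add: hnorm_smult norm_mult)
      also have "\<dots> \<le> 2 * norm h * hnorm M (g h) + norm h * hnorm M (g h)"
        using cmod_fst_le[of h] cmod_snd_le[of h] T_le[of "g h"] by (intro add_mono mult_mono) auto
      also have "\<dots> = 3 * norm h * hnorm M (g h)" by simp
      also have "\<dots> \<le> 3 * norm h * (K * norm h)" using g_le[of h] by (intro mult_left_mono) auto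
      finally show ?thesis .
    qed
    also have "cmod (b (num (p + h) r)) \<le> hnorm M (num (p + h) r)" by (rule bd_le) simp
    also have "\<dots> \<le> 4 * hnorm M r"
    proof -
      have "hnorm M (num (p + h) r) \<le> 2 * cmod (snd (p + h)) * hnorm M (T r) + cmod (fst (p + h)) * hnorm M r"
        by (rule num_le) simp
      also have "\<dots> \<le> (2 * 1) * hnorm M r + 2 * hnorm M r"
        using symm_bidisc_bounds[OF h(1)] T_le[of r] by (intro add_mono mult_mono) auto
      finally show ?thesis by simp
    qed
    also have "4 * hnorm M r \<le> 4 * (8 * K / \<delta> * (norm h)\<^sup>2)" using r_le by simp
    finally show ?thesis by (simp add: C_def power2_eq_square algebra_simps)
  qed
  have "(\<phi> has_derivative (\<lambda>h. \<alpha> * fst h + \<beta> * snd h)) (at p)"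
    unfolding has_derivative_at
  proof (intro conjI)
    show "bounded_linear (\<lambda>h. \<alpha> * fst h + \<beta> * snd h)"
      by (intro bounded_linear_add bounded_linear_const_mult bounded_linear_fst bounded_linear_snd)
    obtain e where e: "e > 0" "\<And>x. dist x p < e \<Longrightarrow> x \<in> symm_bidisc"
      using open_symm_bidisc p unfolding open_dist by metis
    have "\<forall>\<^sub>F h in at 0. norm (norm (\<phi> (p + h) - \<phi> p - (\<alpha> * fst h + \<beta> * snd h)) / norm h) \<le> C * norm h"
      unfolding eventually_at
    proof (intro exI[of _ "min e (\<delta> / 8)"] conjI ballI impI)
      show "0 < min e (\<delta> / 8)" using e \<delta> by simp
      fix h :: "complex \<times> complex" assume h: "h \<noteq> 0 \<and> dist h 0 < min e (\<delta> / 8)"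
      then have "p + h \<in> symm_bidisc" "norm h \<le> \<delta> / 8"
        using e(2)[of "p + h"] by (auto simp: dist_norm)
      from main[OF this] h show "norm (norm (\<phi> (p + h) - \<phi> p - (\<alpha> * fst h + \<beta> * snd h)) / norm h) \<le> C * norm h"
        by (simp add: pos_divide_le_eq power2_eq_square mult.assoc)
    qed
    moreover have "(\<lambda>h::complex \<times> complex. C * norm h) \<midarrow>0\<rightarrow> 0"
      by (auto intro!: tendsto_eq_intros)
    ultimately show "(\<lambda>h. norm (\<phi> (p + h) - \<phi> p - (\<alpha> * fst h + \<beta> * snd h)) / norm h) \<midarrow>0\<rightarrow> 0"
      by (rule Lim_null_comparison)
  qed
  then show ?thesis by blast
qed

end

theorem interpolation_of_model:
  assumes model: "interpolation_model n s w M T v" and s: "\<And>j. j \<in> {1..n} \<Longrightarrow> s j \<in> symm_bidisc"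
  shows "\<exists>\<phi>. analytic2_on \<phi> symm_bidisc \<and> \<phi> ` symm_bidisc \<subseteq> cball 0 1 \<and> (\<forall>j\<in>{1..n}. \<phi> (s j) = w j)"
proof -
  interpret hilbert_space M using model by (simp add: interpolation_model_def)
  have T: "contraction_op M T" and v: "\<And>j. j \<in> {1..n} \<Longrightarrow> v j \<in> carrier M"
    using model by (auto simp: interpolation_model_def)
  define x where "x j = symm_op M (s j) T (v j)" for j
  have x: "x j \<in> carrier M" if "j \<in> {1..n}" for j
    unfolding x_def using linear_op_closed[OF symm_op_linear[OF T s[OF that]] v[OF that]] .
  have gram: "1 + ip M (x i) (x j) = w i * cnj (w j) + ip M (v i) (v j)"
    if i: "i \<in> {1..n}" and j: "j \<in> {1..n}" for i j
  proof -
    note B = symm_op_bounded[OF T s[OF j]]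
    \<comment> \<open>The identity is taken with the roles of \<open>i\<close> and \<open>j\<close>
      exchanged, to match the Gram entries of \<open>unitary_colligation\<close>.\<close>
    have "1 - cnj (w j) * w i = ip M (v i \<ominus>\<^bsub>M\<^esub> adjoint_op M (symm_op M (s j) T) (x i)) (v j)"
      using model i j by (auto simp: interpolation_model_def x_def)
    also have "\<dots> = ip M (v i) (v j) - ip M (x i) (x j)"
      using ip_adjoint_op[OF B v[OF j] x[OF i]] adjoint_op[OF B x[OF i]] v[OF i] v[OF j] by (simp add: ip_diff_left x_def)
    finally show ?thesis by (simp add: algebra_simps)
  qed
  show ?thesis
  proof (rule unitary_colligation[OF finite_atLeastAtMost x v gram])
    fix a b c d assume abcd: "c \<in> carrier M" "linear_op M d"
    "\<And>x y. \<lbrakk>x \<in> carrier M; y \<in> carrier M\<rbrakk> \<Longrightarrow> b (x \<oplus>\<^bsub>M\<^esub> y) = b x + b y"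
    "\<And>k x. x \<in> carrier M \<Longrightarrow> b (k \<odot>\<^bsub>M\<^esub> x) = k * b x"
    "\<And>k x. x \<in> carrier M \<Longrightarrow>
      (cmod (k * a + b x))\<^sup>2 + (hnorm M (k \<odot>\<^bsub>M\<^esub> c \<oplus>\<^bsub>M\<^esub> d x))\<^sup>2 = (cmod k)\<^sup>2 + (hnorm M x)\<^sup>2"
    "\<And>i. i \<in> {1..n} \<Longrightarrow> a + b (x i) = w i" "\<And>i. i \<in> {1..n} \<Longrightarrow> c \<oplus>\<^bsub>M\<^esub> d (x i) = v i"
  interpret transfer_function M T d a b c
    by unfold_locales (rule T abcd; assumption?)+
  show ?thesis
  proof (intro exI[of _ \<phi>] conjI ballI)
    show "analytic2_on \<phi> symm_bidisc" unfolding analytic2_on_def using \<phi>_differentiable by blast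
    show "\<phi> ` symm_bidisc \<subseteq> cball 0 1" using \<phi>_bound by (auto simp: dist_norm)
    show "\<phi> (s j) = w j" if "j \<in> {1..n}" for j
      using \<phi>_interpolates[OF s[OF that] v[OF that]] abcd(6,7)[OF that] by (simp add: x_def)
  qed
  qed
qed

section \<open>Finite-dimensional function spaces\<close>

text \<open>The coordinate space over \<open>J\<close>, with vectors extended by zero so that
  equality of vectors is equality of functions. For a finite \<open>J\<close> of natural numbers it
  has the carrier type required of the model.\<close>

definition fn_space :: "'k set \<Rightarrow> ('k \<Rightarrow> complex) hilbert"
  where "fn_space J = \<lparr>carrier = {x. \<forall>k. k \<notin> J \<longrightarrow> x k = 0}, monoid.mult = (\<lambda>x y. x),
    one = (\<lambda>k. 0), ring.zero = (\<lambda>k. 0), add = (\<lambda>x y k. x k + y k),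
    smult = (\<lambda>c x k. c * x k), ip = (\<lambda>x y. \<Sum>k\<in>J. x k * cnj (y k))\<rparr>"

lemma fn_space_simps [simp]:
  "x \<in> carrier (fn_space J) \<longleftrightarrow> (\<forall>k. k \<notin> J \<longrightarrow> x k = 0)"
  "\<zero>\<^bsub>fn_space J\<^esub> = (\<lambda>k. 0)"
  "x \<oplus>\<^bsub>fn_space J\<^esub> y = (\<lambda>k. x k + y k)"
  "c \<odot>\<^bsub>fn_space J\<^esub> x = (\<lambda>k. c * x k)"
  by (simp_all add: fn_space_def)

lemma ip_fn_space: "ip (fn_space J) x y = (\<Sum>k\<in>J. x k * cnj (y k))"
  by (simp add: fn_space_def)

lemma hnorm_fn_space: "hnorm (fn_space J) x = sqrt (\<Sum>k\<in>J. (cmod (x k))\<^sup>2)"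
proof -
  have "Re (x k * cnj (x k)) = (cmod (x k))\<^sup>2" for k
    by (simp add: complex_norm_square[symmetric] del: of_real_power)
  then show ?thesis by (simp add: hnorm_def ip_fn_space del: complex_mult_cnj)
qed

lemma hnorm_fn_space_sq: "(hnorm (fn_space J) x)\<^sup>2 = (\<Sum>k\<in>J. (cmod (x k))\<^sup>2)"
  by (simp add: hnorm_fn_space sum_nonneg)

lemma inner_space_fn_space:
  assumes J: "finite J"
  shows "inner_space (fn_space J)"
proof (intro inner_space.intro inner_space_axioms.intro moduleI abelian_groupI)
  show "cring (ring_of_type_algebra :: complex ring)" by (rule cring_from_type_algebra)
  show "\<exists>y\<in>carrier (fn_space J). y \<oplus>\<^bsub>fn_space J\<^esub> x = \<zero>\<^bsub>fn_space J\<^esub>"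
    if "x \<in> carrier (fn_space J)" for x
    using that by (intro bexI[of _ "\<lambda>k. - x k"]) auto
  show "ip (fn_space J) x y = cnj (ip (fn_space J) y x)" for x y
    by (simp add: ip_fn_space mult.commute)
  fix x assume x: "x \<in> carrier (fn_space J)" and "x \<noteq> \<zero>\<^bsub>fn_space J\<^esub>"
  then obtain k where "x k \<noteq> 0" by (auto simp: fun_eq_iff)
  with x have k: "k \<in> J" "x k \<noteq> 0" by auto
  have "0 < (\<Sum>k\<in>J. (cmod (x k))\<^sup>2)"
    by (rule sum_pos2[OF J k(1)]) (use k in auto)
  moreover have "Re (ip (fn_space J) x x) = (\<Sum>k\<in>J. (cmod (x k))\<^sup>2)"
    unfolding ip_fn_space by (simp add: complex_norm_square[symmetric] del: complex_mult_cnj of_real_power)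
  ultimately show "0 < Re (ip (fn_space J) x x)" by simp
qed (auto simp: ip_fn_space algebra_simps sum.distrib sum_distrib_left)

lemma minus_fn_space:
  assumes J: "finite J" and x: "x \<in> carrier (fn_space J)" and y: "y \<in> carrier (fn_space J)"
  shows "x \<ominus>\<^bsub>fn_space J\<^esub> y = (\<lambda>k. x k - y k)"
proof -
  interpret inner_space "fn_space J" by (rule inner_space_fn_space[OF J])
  have "\<ominus>\<^bsub>fn_space J\<^esub> y = (\<lambda>k. - y k)"
    by (rule M.minus_equality) (use y in auto)
  then show ?thesis by (simp add: a_minus_def)
qed

theorem hilbert_space_fn_space:
  assumes J: "finite J"
  shows "hilbert_space (fn_space J)"
proof -
  interpret inner_space "fn_space J" by (rule inner_space_fn_space[OF J])
  interpret Metric_space "carrier (fn_space J)" "hdist (fn_space J)" by (rule metric_space_hdist)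
  have dist: "hdist (fn_space J) x y = sqrt (\<Sum>k\<in>J. (cmod (x k - y k))\<^sup>2)"
    if "x \<in> carrier (fn_space J)" "y \<in> carrier (fn_space J)" for x y
    using that by (simp add: hdist_def hnorm_fn_space minus_fn_space[OF J])
  have mcomplete
    unfolding mcomplete_def
  proof (intro allI impI)
    fix \<sigma> assume C: "MCauchy \<sigma>"
    then have \<sigma>: "\<sigma> n \<in> carrier (fn_space J)" for n unfolding MCauchy_def by blast
    have "Cauchy (\<lambda>n. \<sigma> n k)" if k: "k \<in> J" for k
    proof (rule metric_CauchyI)
      fix e :: real assume "e > 0"
      then obtain N where N: "\<And>m n. N \<le> m \<Longrightarrow> N \<le> n \<Longrightarrow> hdist (fn_space J) (\<sigma> m) (\<sigma> n) < e"
        using C unfolding MCauchy_def by blast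
      have "dist (\<sigma> m k) (\<sigma> n k) \<le> hdist (fn_space J) (\<sigma> m) (\<sigma> n)" for m n
      proof -
        have "(cmod (\<sigma> m k - \<sigma> n k))\<^sup>2 \<le> (\<Sum>k\<in>J. (cmod (\<sigma> m k - \<sigma> n k))\<^sup>2)"
          using member_le_sum[of k J "\<lambda>k. (cmod (\<sigma> m k - \<sigma> n k))\<^sup>2"] k J by auto
        then show ?thesis unfolding dist[OF \<sigma> \<sigma>] dist_norm by (rule real_le_rsqrt)
      qed
      then show "\<exists>N. \<forall>m\<ge>N. \<forall>n\<ge>N. dist (\<sigma> m k) (\<sigma> n k) < e"
        using N by (meson order_le_less_trans)
    qed
    then have "\<exists>l. (\<lambda>n. \<sigma> n k) \<longlonglongrightarrow> l" if "k \<in> J" for k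
      using that Cauchy_convergent_iff convergent_def by blast
    then obtain l where l: "\<And>k. k \<in> J \<Longrightarrow> (\<lambda>n. \<sigma> n k) \<longlonglongrightarrow> l k" by metis
    define x where "x k = (if k \<in> J then l k else 0)" for k
    have x: "x \<in> carrier (fn_space J)" by (simp add: x_def)
    have "(\<lambda>n. sqrt (\<Sum>k\<in>J. (cmod (\<sigma> n k - x k))\<^sup>2)) \<longlonglongrightarrow> sqrt (\<Sum>k\<in>J. (cmod (l k - x k))\<^sup>2)"
      by (intro tendsto_intros l)
    also have "sqrt (\<Sum>k\<in>J. (cmod (l k - x k))\<^sup>2) = 0" by (simp add: x_def)
    finally have "limitin mtopology \<sigma> x sequentially"
      unfolding limitin_metric_dist_null using \<sigma> x dist by simp
    then show "\<exists>x. limitin mtopology \<sigma> x sequentially" by blast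
  qed
  then show ?thesis
    by unfold_locales (auto intro: ip_add_left ip_smult_left ip_commute ip_pos simp del: fn_space_simps)
qed

lemma linear_op_fn_space_sum:
  assumes A: "linear_op (fn_space J) A" and J: "finite J" and I: "finite I"
    and x: "\<And>i. i \<in> I \<Longrightarrow> x i \<in> carrier (fn_space J)"
  shows "A (\<lambda>k. \<Sum>i\<in>I. c i * x i k) = (\<lambda>k. \<Sum>i\<in>I. c i * A (x i) k)"
  using I x
proof (induction rule: finite_induct)
  case empty
  interpret inner_space "fn_space J" by (rule inner_space_fn_space[OF J])
  show ?case using linear_op_zero[OF A] by simp
next
  case (insert p I)
  have "A (\<lambda>k. \<Sum>i\<in>insert p I. c i * x i k)
    = A ((c p \<odot>\<^bsub>fn_space J\<^esub> x p) \<oplus>\<^bsub>fn_space J\<^esub> (\<lambda>k. \<Sum>i\<in>I. c i * x i k))"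
    using insert.hyps by simp
  also have "\<dots> = (c p \<odot>\<^bsub>fn_space J\<^esub> A (x p)) \<oplus>\<^bsub>fn_space J\<^esub> A (\<lambda>k. \<Sum>i\<in>I. c i * x i k)"
  proof (subst linear_op_add[OF A])
    show "c p \<odot>\<^bsub>fn_space J\<^esub> x p \<in> carrier (fn_space J)" using insert.prems[of p] by simp
    show "(\<lambda>k. \<Sum>i\<in>I. c i * x i k) \<in> carrier (fn_space J)" using insert.prems by (auto intro!: sum.neutral)
    show "A (c p \<odot>\<^bsub>fn_space J\<^esub> x p) \<oplus>\<^bsub>fn_space J\<^esub> A (\<lambda>k. \<Sum>i\<in>I. c i * x i k)
      = (c p \<odot>\<^bsub>fn_space J\<^esub> A (x p)) \<oplus>\<^bsub>fn_space J\<^esub> A (\<lambda>k. \<Sum>i\<in>I. c i * x i k)"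
      using linear_op_smult[OF A insert.prems[of p]] by simp
  qed
  also have "\<dots> = (\<lambda>k. \<Sum>i\<in>insert p I. c i * A (x i) k)"
    using insert.hyps insert.IH insert.prems by simp
  finally show ?case .
qed

section \<open>Positive semidefinite kernels\<close>

text \<open>Only the real part of the form is tested, which does not force symmetry; the Hermitian
  condition is therefore a clause of its own.\<close>

definition psd :: "'i set \<Rightarrow> ('i \<Rightarrow> 'i \<Rightarrow> complex) \<Rightarrow> bool"
  where "psd I K \<longleftrightarrow> (\<forall>i\<in>I. \<forall>j\<in>I. K j i = cnj (K i j)) \<and>
    (\<forall>c. 0 \<le> Re (\<Sum>i\<in>I. \<Sum>j\<in>I. cnj (c i) * c j * K i j))"

lemma psd_hermitian: "psd I K \<Longrightarrow> i \<in> I \<Longrightarrow> j \<in> I \<Longrightarrow> K j i = cnj (K i j)"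
  unfolding psd_def by blast

lemma psd_nonneg: "psd I K \<Longrightarrow> 0 \<le> Re (\<Sum>i\<in>I. \<Sum>j\<in>I. cnj (c i) * c j * K i j)"
  unfolding psd_def by blast

text \<open>The test vector is written as a sum of two one-point terms, so that the case
  \<open>i = j\<close> is covered as well.\<close>

lemma psd_two_points:
  assumes K: "psd I K" and I: "finite I" and i: "i \<in> I" and j: "j \<in> I"
  shows "0 \<le> (cmod s)\<^sup>2 * Re (K i i) + (cmod t)\<^sup>2 * Re (K j j) + 2 * Re (cnj s * t * K i j)"
proof -
  define c where "c k = (if k = i then s else 0) + (if k = j then t else 0)" for k
  have "(\<Sum>k\<in>I. \<Sum>l\<in>I. cnj (c k) * c l * K k l) =
      cnj s * s * K i i + cnj s * t * K i j + cnj t * s * K j i + cnj t * t * K j j"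
  proof -
    have "c l * f l = (if l = i then s * f i else 0) + (if l = j then t * f j else 0)"
      "cnj (c l) * f l = (if l = i then cnj s * f i else 0) + (if l = j then cnj t * f j else 0)" for l f
      by (auto simp: c_def algebra_simps)
    then have eval: "(\<Sum>l\<in>I. c l * f l) = s * f i + t * f j"
      "(\<Sum>l\<in>I. cnj (c l) * f l) = cnj s * f i + cnj t * f j" for f
      using I i j by (simp_all add: sum.distrib)
    have "(\<Sum>k\<in>I. \<Sum>l\<in>I. cnj (c k) * c l * K k l) = (\<Sum>k\<in>I. cnj (c k) * (\<Sum>l\<in>I. c l * K k l))"
      by (simp add: sum_distrib_left mult.assoc)
    then show ?thesis unfolding eval by (simp add: algebra_simps)
  qed
  then have "0 \<le> Re (cnj s * s * K i i) + Re (cnj s * t * K i j) + Re (cnj t * s * K j i) + Re (cnj t * t * K j j)"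
    using psd_nonneg[OF K, of c] by simp
  moreover have "Re (cnj t * s * K j i) = Re (cnj s * t * K i j)"
    unfolding psd_hermitian[OF K i j] by (simp add: algebra_simps)
  moreover have sq: "Re (cnj c * c * f) = (cmod c)\<^sup>2 * Re f" for c f
  proof -
    have "cnj c * c = of_real ((cmod c)\<^sup>2)" by (simp only: complex_norm_square mult.commute)
    then show ?thesis by (simp only: Re_complex_of_real times_complex.sel Im_complex_of_real)
  qed
  ultimately show ?thesis using sq[of s "K i i"] sq[of t "K j j"] by linarith
qed

lemma psd_diag:
  assumes K: "psd I K" and I: "finite I" and i: "i \<in> I"
  shows "0 \<le> Re (K i i)" "K i i = of_real (Re (K i i))"
proof -
  show "0 \<le> Re (K i i)" using psd_two_points[OF K I i i, of 1 0] by simp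
  have "Im (K i i) = 0" using psd_hermitian[OF K i i] by (metis cnj.sel(2) equal_neg_zero)
  then show "K i i = of_real (Re (K i i))" by (simp add: complex_eq_iff)
qed

text \<open>Test with \<open>t\<close> at \<open>i\<close> and minus the conjugate of
  \<open>K i j\<close> at \<open>j\<close>, then take the optimal \<open>t = k / Re (K i i)\<close>.
  If that diagonal entry is zero, the inequality is linear in \<open>t\<close>, and a large
  \<open>t\<close> forces \<open>K i j\<close> to vanish.\<close>

lemma psd_cauchy_schwarz:
  assumes K: "psd I K" and I: "finite I" and i: "i \<in> I" and j: "j \<in> I"
  shows "(cmod (K i j))\<^sup>2 \<le> Re (K i i) * Re (K j j)"
proof -
  define z where "z = K i j"
  define k where "k = (cmod z)\<^sup>2"
  have k: "0 \<le> k" by (simp add: k_def)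
  note di = psd_diag(1)[OF K I i] and dj = psd_diag(1)[OF K I j]
  have ineq: "2 * t * k \<le> t\<^sup>2 * Re (K i i) + k * Re (K j j)" for t :: real
  proof -
    have "cnj (of_real t) * (- cnj z) * K i j = of_real (- (t * k))"
      unfolding z_def[symmetric] k_def of_real_minus of_real_mult complex_norm_square by simp
    then have "Re (cnj (of_real t) * (- cnj z) * K i j) = - (t * k)" by (simp only: Re_complex_of_real)
    then show ?thesis
      using psd_two_points[OF K I i j, of "of_real t" "- cnj z"] by (simp add: k_def)
  qed
  show ?thesis
  proof (cases "Re (K i i) = 0")
    case True
    have "2 * (Re (K j j) + 1) * k \<le> k * Re (K j j)" using ineq[of "Re (K j j) + 1"] True by simp
    then have "k * (Re (K j j) + 2) \<le> 0" by (simp add: algebra_simps)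
    then have "k \<le> 0" using dj by (simp add: mult_le_0_iff)
    then show ?thesis using True by (simp add: k_def z_def)
  next
    case False
    then have p: "Re (K i i) > 0" using di by simp
    have "2 * (k / Re (K i i)) * k \<le> (k / Re (K i i))\<^sup>2 * Re (K i i) + k * Re (K j j)" by (rule ineq)
    also have "(k / Re (K i i))\<^sup>2 * Re (K i i) = (k / Re (K i i)) * k"
      using p by (simp add: power2_eq_square)
    finally have "(k / Re (K i i)) * k \<le> k * Re (K j j)" by simp
    then have "k * k \<le> k * (Re (K i i) * Re (K j j))" using p by (simp add: field_simps)
    then have "k \<le> Re (K i i) * Re (K j j)"
      using k di dj by (cases "k = 0") auto
    then show ?thesis by (simp add: k_def z_def)
  qed
qed

text \<open>The form of the Schur complement at \<open>c\<close> is the form of \<open>K\<close> at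
  \<open>c\<close> extended to \<open>p\<close> by the minimising value. If \<open>K p p\<close> is
  zero, the divisions give zero, which is right because Cauchy-Schwarz kills the whole row of
  \<open>p\<close>.\<close>

lemma psd_schur_complement:
  assumes K: "psd (insert p I) K" and I: "finite I" "p \<notin> I"
  shows "psd I (\<lambda>i j. K i j - K i p * K p j / K p p)"
  unfolding psd_def
proof (intro conjI ballI allI)
  define \<kappa> where "\<kappa> = Re (K p p)"
  have \<kappa>: "K p p = of_real \<kappa>" using psd_diag(2)[OF K] I by (simp add: \<kappa>_def)
  have h: "K j i = cnj (K i j)" if "i \<in> insert p I" "j \<in> insert p I" for i j
    using psd_hermitian[OF K that] .
  show "K j i - K j p * K p i / K p p = cnj (K i j - K i p * K p j / K p p)"
    if "i \<in> I" "j \<in> I" for i j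
    using h[of i j] h[of p i] h[of p j] that by (simp add: \<kappa> mult.commute)
  fix c
  define S where "S = (\<Sum>j\<in>I. c j * K p j)"
  have cS: "(\<Sum>i\<in>I. cnj (c i) * K i p) = cnj S"
    using h[of p] by (auto simp: S_def intro!: sum.cong)
  define c' where "c' i = (if i = p then - S / of_real \<kappa> else c i)" for i
  have c': "c' i = c i" if "i \<in> I" for i using that I by (auto simp: c'_def)
  have z: "S = 0" if "\<kappa> = 0"
  proof -
    have "(cmod (K p j))\<^sup>2 \<le> 0" if "j \<in> I" for j
      using psd_cauchy_schwarz[OF K _ _ , of p j] I that \<open>\<kappa> = 0\<close> by (simp add: \<kappa>_def)
    then show ?thesis by (simp add: S_def)
  qed
  have "(\<Sum>i\<in>insert p I. \<Sum>j\<in>insert p I. cnj (c' i) * c' j * K i j)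
    = cnj (c' p) * c' p * K p p + cnj (c' p) * S + c' p * cnj S + (\<Sum>i\<in>I. \<Sum>j\<in>I. cnj (c i) * c j * K i j)"
  proof -
    have "(\<Sum>j\<in>insert p I. cnj (c' i) * c' j * K i j) = cnj (c' i) * (c' p * K i p + (\<Sum>j\<in>I. c j * K i j))" for i
      using I c' by (simp add: sum_distrib_left algebra_simps)
    moreover have "(\<Sum>i\<in>I. cnj (c' i) * (c' p * K i p + (\<Sum>j\<in>I. c j * K i j)))
      = c' p * cnj S + (\<Sum>i\<in>I. \<Sum>j\<in>I. cnj (c i) * c j * K i j)"
      unfolding cS[symmetric] using c' by (simp add: sum.distrib sum_distrib_left algebra_simps)
    ultimately show ?thesis using I by (simp add: S_def algebra_simps)
  qed
  also have "cnj (c' p) * c' p * K p p + cnj (c' p) * S + c' p * cnj S = - (S * cnj S / of_real \<kappa>)"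
    using z by (cases "\<kappa> = 0") (auto simp: c'_def \<kappa>)
  also have "- (S * cnj S / of_real \<kappa>) + (\<Sum>i\<in>I. \<Sum>j\<in>I. cnj (c i) * c j * K i j)
    = (\<Sum>i\<in>I. \<Sum>j\<in>I. cnj (c i) * c j * (K i j - K i p * K p j / K p p))"
  proof -
    have "S * cnj S / of_real \<kappa> = (\<Sum>i\<in>I. \<Sum>j\<in>I. cnj (c i) * c j * (K i p * K p j / K p p))"
      unfolding cS[symmetric] unfolding S_def
      by (simp add: \<kappa> sum_product sum_divide_distrib mult_ac)
        (subst sum.swap, simp add: mult_ac)
    then show ?thesis by (simp add: right_diff_distrib sum_subtractf)
  qed
  finally show "0 \<le> Re (\<Sum>i\<in>I. \<Sum>j\<in>I. cnj (c i) * c j * (K i j - K i p * K p j / K p p))"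
    using psd_nonneg[OF K, of c'] by simp
qed

text \<open>Cholesky factorisation: the new coordinate \<open>p\<close> carries the row of
  \<open>K\<close> at \<open>p\<close> divided by the root of the pivot, and the other coordinates
  realise the Schur complement.\<close>

theorem psd_gram:
  assumes "finite I" "psd I K"
  shows "\<exists>u. (\<forall>i\<in>I. u i \<in> carrier (fn_space I)) \<and> (\<forall>i\<in>I. \<forall>j\<in>I. K i j = ip (fn_space I) (u j) (u i))"
  using assms
proof (induction arbitrary: K rule: finite_induct)
  case (insert p I)
  note K = insert.prems
  define \<kappa> where "\<kappa> = Re (K p p)"
  have \<kappa>: "K p p = of_real \<kappa>" "0 \<le> \<kappa>" using psd_diag[OF K] insert.hyps by (simp_all add: \<kappa>_def)
  have z: "K p j = 0" if "j \<in> I" "\<kappa> = 0" for j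
    using psd_cauchy_schwarz[OF K _ _ , of p j] insert.hyps that by (simp add: \<kappa>_def)
  have h: "K j i = cnj (K i j)" if "i \<in> insert p I" "j \<in> insert p I" for i j
    using psd_hermitian[OF K that] .
  obtain u where u: "\<And>i. i \<in> I \<Longrightarrow> u i \<in> carrier (fn_space I)"
    "\<And>i j. i \<in> I \<Longrightarrow> j \<in> I \<Longrightarrow> K i j - K i p * K p j / K p p = ip (fn_space I) (u j) (u i)"
    using insert.IH[OF psd_schur_complement[OF K insert.hyps]] by blast
  define v where "v i = (if i = p then (\<lambda>k. if k = p then of_real (sqrt \<kappa>) else 0)
    else (u i)(p := K p i / of_real (sqrt \<kappa>)))" for i
  have pI: "p \<notin> I" "finite I" using insert.hyps by auto
  have ip: "ip (fn_space (insert p I)) x y = x p * cnj (y p) + ip (fn_space I) x y" for x y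
    using pI by (simp add: ip_fn_space)
  have vI: "v i p = K p i / of_real (sqrt \<kappa>)" "k \<in> I \<Longrightarrow> v i k = u i k" if "i \<in> I" for i k
    using that pI by (auto simp: v_def)
  have vp: "v p p = of_real (sqrt \<kappa>)" "k \<in> I \<Longrightarrow> v p k = 0" for k using pI by (auto simp: v_def)
  have sq: "complex_of_real (sqrt \<kappa>) * of_real (sqrt \<kappa>) = of_real \<kappa>"
    using \<kappa>(2) by (simp flip: of_real_mult)
  have "K i j = ip (fn_space (insert p I)) (v j) (v i)" if ij: "i \<in> insert p I" "j \<in> insert p I" for i j
  proof -
    consider "i = p" "j = p" | "i = p" "j \<in> I" | "i \<in> I" "j = p" | "i \<in> I" "j \<in> I" using ij by auto
    then show ?thesis
    proof cases
      case 1 then show ?thesis by (simp only: ip) (simp add: vp ip_fn_space sq \<kappa>)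
    next
      case 2
      have "ip (fn_space I) (v j) (v p) = 0" by (simp add: ip_fn_space vp)
      then show ?thesis using 2 z \<kappa>(2) by (cases "\<kappa> = 0") (auto simp: ip vp vI)
    next
      case 3
      have "ip (fn_space I) (v p) (v i) = 0" by (simp add: ip_fn_space vp)
      moreover have "K i p = cnj (K p i)" using h[of p i] 3 by auto
      ultimately show ?thesis using 3 z \<kappa>(2) by (cases "\<kappa> = 0") (auto simp: ip vp vI)
    next
      case 4
      have "ip (fn_space I) (v j) (v i) = ip (fn_space I) (u j) (u i)"
        using 4 by (simp add: ip_fn_space vI)
      moreover have "K i p = cnj (K p i)" using h[of p i] 4 by auto
      moreover have "v j p * cnj (v i p) = K i p * K p j / K p p"
        using 4 \<open>K i p = cnj (K p i)\<close> by (simp add: vI sq \<kappa> mult.commute)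
      ultimately show ?thesis using u(2)[OF 4] by (simp add: ip algebra_simps)
    qed
  qed
  moreover have "v i \<in> carrier (fn_space (insert p I))" if "i \<in> insert p I" for i
    using that u(1) by (auto simp: v_def)
  ultimately show ?case by blast
qed simp

section \<open>Von Neumann's inequality for two commuting isometries\<close>

lemma root_of_unity_orthogonality:
  fixes R :: nat
  assumes "a < R" "b < R"
  defines "\<omega> \<equiv> \<lambda>k. cis (2 * pi * real k / real R)"
  shows "(\<Sum>k<R. \<omega> k ^ a * cnj (\<omega> k) ^ b) = (if a = b then of_nat R else 0)"
proof -
  have R: "R > 0" using assms by simp
  define \<zeta> where "\<zeta> = cis (2 * pi * (real a - real b) / real R)"
  have "\<omega> k ^ a * cnj (\<omega> k) ^ b = \<zeta> ^ k" for k
    unfolding \<omega>_def \<zeta>_def cis_cnj Complex.DeMoivre cis_mult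
    by (rule arg_cong[where f = cis]) (simp add: algebra_simps diff_divide_distrib)
  then have eq: "(\<Sum>k<R. \<omega> k ^ a * cnj (\<omega> k) ^ b) = (\<Sum>k<R. \<zeta> ^ k)" by simp
  show ?thesis
  proof (cases "a = b")
    case True
    then show ?thesis unfolding eq by (simp add: \<zeta>_def)
  next
    case False
    have "\<zeta> ^ R = 1"
    proof -
      have "\<zeta> ^ R = cis (2 * pi * of_int (int a - int b))"
        unfolding \<zeta>_def Complex.DeMoivre using R by simp
      also have "\<dots> = 1" by (rule cis_multiple_2pi) (auto intro: Ints_diff)
      finally show ?thesis .
    qed
    moreover have "\<zeta> \<noteq> 1"
    proof
      assume "\<zeta> = 1"
      then have "cos (2 * pi * (real a - real b) / real R) = 1" by (metis \<zeta>_def cis.sel(1) one_complex.sel(1))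
      then obtain n where n: "2 * pi * (real a - real b) / real R = of_int n * 2 * pi"
        unfolding cos_one_2pi_int by blast
      then have "(2 * pi) * (real a - real b) = (2 * pi) * (of_int n * real R)"
        using R by (simp add: field_simps)
      then have "real a - real b = of_int n * real R"
        unfolding mult_cancel_left using pi_gt_zero by linarith
      then have "of_int (int a - int b) = (of_int (n * int R) :: real)" by simp
      then have e: "int a - int b = n * int R" by (simp only: of_int_eq_iff)
      have "\<bar>n * int R\<bar> < int R" using e assms by simp
      then have "\<bar>n\<bar> * int R < 1 * int R" by (simp add: abs_mult)
      then have "\<bar>n\<bar> < 1" using R by (simp only: mult_less_cancel_right_pos of_nat_0_less_iff)
      then show False using e False by simp
    qed
    ultimately show ?thesis unfolding eq using False by (simp add: sum_gp_strict)
  qed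
qed

text \<open>Stated for any matrix with orthogonal columns of square norm \<open>R\<close>, because
  it is applied both to the Fourier matrix and to its conjugate.\<close>

lemma dft_parseval:
  fixes U :: "nat \<Rightarrow> nat \<Rightarrow> complex" and y :: "nat \<Rightarrow> complex"
  assumes U: "\<And>a b. \<lbrakk>a < R; b < R\<rbrakk> \<Longrightarrow> (\<Sum>k<R. U k a * cnj (U k b)) = (if a = b then of_nat R else 0)"
  shows "(\<Sum>k<R. (cmod (\<Sum>a<R. U k a * y a))\<^sup>2) = real R * (\<Sum>a<R. (cmod (y a))\<^sup>2)"
proof -
  have "complex_of_real (\<Sum>k<R. (cmod (\<Sum>a<R. U k a * y a))\<^sup>2)
    = (\<Sum>k<R. \<Sum>a<R. \<Sum>b<R. (U k a * cnj (U k b)) * (y a * cnj (y b)))"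
    unfolding of_real_sum complex_norm_square by (simp add: sum_product mult_ac)
  also have "\<dots> = (\<Sum>a<R. \<Sum>b<R. (\<Sum>k<R. U k a * cnj (U k b)) * (y a * cnj (y b)))"
    by (subst sum.swap, rule sum.cong[OF refl], subst sum.swap) (simp add: sum_distrib_right)
  also have "\<dots> = (\<Sum>a<R. \<Sum>b<R. if a = b then of_nat R * (y a * cnj (y b)) else 0)"
    by (intro sum.cong refl) (simp add: U)
  also have "\<dots> = (\<Sum>a<R. of_nat R * (y a * cnj (y a)))"
    by (intro sum.cong refl) simp
  also have "\<dots> = complex_of_real (real R * (\<Sum>a<R. (cmod (y a))\<^sup>2))"
    unfolding of_real_mult of_real_sum complex_norm_square by (simp add: sum_distrib_left)
  finally show ?thesis using of_real_eq_iff by blast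
qed

lemma linear_op_funpow:
  assumes "linear_op M V" shows "linear_op M (V ^^ n)"
  using assms by (induction n) (auto simp: linear_op_def Pi_iff)

context
  fixes J :: "'k set"
  assumes J: "finite J"
begin

abbreviation H where "H \<equiv> fn_space J"

text \<open>
  Averaging over the \<open>R\<close>-th roots of unity \<open>\<omega>\<close>: the vectors \<open>\<Sum>p<R. \<omega>\<^sup>-\<^sup>p V\<^sup>p x\<close> have mean square norm
  \<open>R \<parallel>x\<parallel>\<^sup>2\<close>, and the operator \<open>\<Sum>a. \<omega>\<^sup>a A\<^sub>a\<close> maps them to vectors whose \<open>m\<close>-th Fourier coefficient is
  \<open>V\<^sup>m (\<Sum>a. A\<^sub>a V\<^sup>a x)\<close> as long as \<open>m + D < R\<close>.
\<close>

theorem von_neumann_step: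
  fixes V :: "('k \<Rightarrow> complex) \<Rightarrow> 'k \<Rightarrow> complex" and A :: "nat \<Rightarrow> ('k \<Rightarrow> complex) \<Rightarrow> 'k \<Rightarrow> complex"
  assumes V: "linear_op H V"
    and A: "\<And>a. a < D \<Longrightarrow> linear_op H (A a)"
    and iso: "\<And>x. x \<in> carrier H \<Longrightarrow> hnorm H (V x) = hnorm H x"
    and comm: "\<And>a x. \<lbrakk>a < D; x \<in> carrier H\<rbrakk> \<Longrightarrow> A a (V x) = V (A a x)"
    and bound: "\<And>\<omega> x. \<lbrakk>cmod \<omega> = 1; x \<in> carrier H\<rbrakk>
      \<Longrightarrow> hnorm H (\<lambda>k. \<Sum>a<D. \<omega> ^ a * A a x k) \<le> hnorm H x"
    and x: "x \<in> carrier H"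
  shows "hnorm H (\<lambda>k. \<Sum>a<D. A a ((V ^^ a) x) k) \<le> hnorm H x"
proof -
  interpret inner_space H by (rule inner_space_fn_space[OF J])
  define y where "y = (\<lambda>k. \<Sum>a<D. A a ((V ^^ a) x) k)"
  have Vx: "(V ^^ p) z \<in> carrier H" if "z \<in> carrier H" for p z
    using linear_op_closed[OF linear_op_funpow[OF V] that] .
  have Vnorm: "hnorm H ((V ^^ p) z) = hnorm H z" if "z \<in> carrier H" for p z
    by (induction p) (use Vx[OF that] iso in \<open>auto simp del: fn_space_simps\<close>)
  have y: "y \<in> carrier H"
    using linear_op_closed[OF A] Vx[OF x] by (auto simp: y_def intro!: sum.neutral)
  have VA: "(V ^^ m) (A a z) = A a ((V ^^ m) z)" if "a < D" "z \<in> carrier H" for m a z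
    by (induction m) (use Vx[OF that(2)] comm[OF that(1)] in \<open>auto simp del: fn_space_simps\<close>)
  have Vy: "(V ^^ m) y = (\<lambda>k. \<Sum>a<D. A a ((V ^^ (m + a)) x) k)" for m
  proof -
    have "(V ^^ m) y = (\<lambda>k. \<Sum>a<D. 1 * (V ^^ m) (A a ((V ^^ a) x)) k)"
      unfolding y_def
      using linear_op_fn_space_sum[OF linear_op_funpow[OF V, of m] J, of "{..<D}" "\<lambda>a. A a ((V ^^ a) x)" "\<lambda>_. 1"]
        linear_op_closed[OF A] Vx[OF x] by (simp del: fn_space_simps)
    also have "\<dots> = (\<lambda>k. \<Sum>a<D. A a ((V ^^ (m + a)) x) k)"
      using VA Vx[OF x] by (auto simp: funpow_add simp del: fn_space_simps)
    finally show ?thesis .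
  qed
  have ineq: "real (R - D) * (hnorm H y)\<^sup>2 \<le> real R * (hnorm H x)\<^sup>2" if R: "R > D" for R
  proof -
    define \<omega> where "\<omega> k = cis (2 * pi * real k / real R)" for k
    have \<omega>1: "cmod (\<omega> k) = 1" for k by (simp add: \<omega>_def)
    have orth: "(\<Sum>k<R. \<omega> k ^ a * cnj (\<omega> k) ^ b) = (if a = b then of_nat R else 0)" if "a < R" "b < R" for a b
      unfolding \<omega>_def by (rule root_of_unity_orthogonality[OF that])
    \<comment> \<open>The Fourier matrix is symmetric, so its rows are orthogonal as well as its
      columns.\<close>
    have sym: "\<omega> k ^ a = \<omega> a ^ k" for k a
      unfolding \<omega>_def Complex.DeMoivre by (simp add: mult_ac)
    define F where "F k = (\<lambda>i. \<Sum>p<R. cnj (\<omega> k) ^ p * (V ^^ p) x i)" for k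
    have F: "F k \<in> carrier H" for k
      using Vx[OF x] by (auto simp: F_def intro!: sum.neutral)
    define Z where "Z k = (\<lambda>i. \<Sum>a<D. \<omega> k ^ a * A a (F k) i)" for k
    have ZF: "(hnorm H (Z k))\<^sup>2 \<le> (hnorm H (F k))\<^sup>2" for k
      unfolding Z_def using bound[OF \<omega>1 F] by (intro power_mono) (auto simp: hnorm_fn_space sum_nonneg)
    have AF: "A a (F k) = (\<lambda>i. \<Sum>p<R. cnj (\<omega> k) ^ p * A a ((V ^^ p) x) i)" if "a < D" for a k
      unfolding F_def by (rule linear_op_fn_space_sum[OF A[OF that] J]) (use Vx[OF x] in auto)
    have coeff: "(\<Sum>k<R. \<omega> k ^ m * Z k i) = of_nat R * (V ^^ m) y i" if m: "m < R - D" for m i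
    proof -
      have "(\<Sum>k<R. \<omega> k ^ m * Z k i)
        = (\<Sum>k<R. \<Sum>a<D. \<Sum>p<R. (\<omega> k ^ (m + a) * cnj (\<omega> k) ^ p) * A a ((V ^^ p) x) i)"
        by (simp add: Z_def AF sum_distrib_left power_add mult.assoc)
      also have "\<dots> = (\<Sum>a<D. \<Sum>p<R. (\<Sum>k<R. \<omega> k ^ (m + a) * cnj (\<omega> k) ^ p) * A a ((V ^^ p) x) i)"
        by (subst sum.swap, rule sum.cong[OF refl], subst sum.swap) (simp add: sum_distrib_right)
      also have "\<dots> = (\<Sum>a<D. \<Sum>p<R. if m + a = p then of_nat R * A a ((V ^^ p) x) i else 0)"
        using m by (intro sum.cong refl) (simp add: orth)
      also have "\<dots> = (\<Sum>a<D. of_nat R * A a ((V ^^ (m + a)) x) i)"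
        using m by (intro sum.cong refl) simp
      also have "\<dots> = of_nat R * (V ^^ m) y i" by (simp add: Vy sum_distrib_left)
      finally show ?thesis .
    qed
    have "(\<Sum>k<R. (hnorm H (F k))\<^sup>2) = (\<Sum>i\<in>J. \<Sum>k<R. (cmod (F k i))\<^sup>2)"
      unfolding hnorm_fn_space_sq by (rule sum.swap)
    also have "\<dots> = (\<Sum>i\<in>J. real R * (\<Sum>p<R. (cmod ((V ^^ p) x i))\<^sup>2))"
    proof (rule sum.cong[OF refl])
      fix i
      show "(\<Sum>k<R. (cmod (F k i))\<^sup>2) = real R * (\<Sum>p<R. (cmod ((V ^^ p) x i))\<^sup>2)"
        unfolding F_def
      proof (rule dft_parseval)
        show "(\<Sum>k<R. cnj (\<omega> k) ^ a * cnj (cnj (\<omega> k) ^ b)) = (if a = b then of_nat R else 0)"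
          if "a < R" "b < R" for a b
          using orth[OF that(2,1)] by (auto simp: mult.commute)
      qed
    qed
    also have "\<dots> = real R * (\<Sum>p<R. (hnorm H ((V ^^ p) x))\<^sup>2)"
      unfolding hnorm_fn_space_sq by (simp add: sum_distrib_left) (rule sum.swap)
    also have "\<dots> = real R * (real R * (hnorm H x)\<^sup>2)" by (simp add: Vnorm[OF x])
    finally have F_sum: "(\<Sum>k<R. (hnorm H (F k))\<^sup>2) = real R * (real R * (hnorm H x)\<^sup>2)" .
    have "real R * (\<Sum>k<R. (hnorm H (Z k))\<^sup>2) = (\<Sum>i\<in>J. real R * (\<Sum>k<R. (cmod (Z k i))\<^sup>2))"
      unfolding hnorm_fn_space_sq by (subst sum.swap) (simp add: sum_distrib_left)
    also have "\<dots> = (\<Sum>i\<in>J. \<Sum>m<R. (cmod (\<Sum>k<R. \<omega> k ^ m * Z k i))\<^sup>2)"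
    proof (rule sum.cong[OF refl], rule dft_parseval[symmetric])
      show "(\<Sum>k<R. \<omega> a ^ k * cnj (\<omega> b ^ k)) = (if a = b then of_nat R else 0)" if "a < R" "b < R" for a b
        using orth[OF that] by (simp add: sym[of a] sym[of b])
    qed
    \<comment> \<open>For \<open>m\<close> beyond \<open>R - D\<close> the exponent
      \<open>m + a\<close> may reach \<open>R\<close> and alias. These at most \<open>D\<close>
      coefficients are given up.\<close>
    also have "\<dots> \<ge> (\<Sum>i\<in>J. \<Sum>m<R - D. (cmod (\<Sum>k<R. \<omega> k ^ m * Z k i))\<^sup>2)"
      by (intro sum_mono sum_mono2) auto
    also have "(\<Sum>i\<in>J. \<Sum>m<R - D. (cmod (\<Sum>k<R. \<omega> k ^ m * Z k i))\<^sup>2)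
        = (\<Sum>i\<in>J. \<Sum>m<R - D. (real R)\<^sup>2 * (cmod ((V ^^ m) y i))\<^sup>2)"
      by (intro sum.cong refl) (simp add: coeff norm_mult power_mult_distrib)
    also have "\<dots> = (\<Sum>m<R - D. (real R)\<^sup>2 * (hnorm H ((V ^^ m) y))\<^sup>2)"
      unfolding hnorm_fn_space_sq by (subst sum.swap) (simp add: sum_distrib_left)
    also have "\<dots> = real (R - D) * (real R)\<^sup>2 * (hnorm H y)\<^sup>2" by (simp add: Vnorm[OF y])
    finally have "real (R - D) * (real R)\<^sup>2 * (hnorm H y)\<^sup>2 \<le> real R * (\<Sum>k<R. (hnorm H (Z k))\<^sup>2)" .
    also have "\<dots> \<le> real R * (real R * (real R * (hnorm H x)\<^sup>2))"
      unfolding F_sum[symmetric] by (intro mult_left_mono sum_mono ZF) auto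
    finally have "(real R)\<^sup>2 * (real (R - D) * (hnorm H y)\<^sup>2) \<le> (real R)\<^sup>2 * (real R * (hnorm H x)\<^sup>2)"
      by (simp add: power2_eq_square mult_ac)
    then show ?thesis using R by (simp add: mult_le_cancel_left)
  qed
  \<comment> \<open>Here \<open>R = Suc n + D\<close>; the loss of \<open>D\<close> coefficients out
    of \<open>R\<close> vanishes in the limit.\<close>
  have "(\<lambda>n. real (Suc n) / real (Suc n + D)) \<longlonglongrightarrow> 1" by real_asymp
  then have "(\<lambda>n. real (Suc n) / real (Suc n + D) * (hnorm H y)\<^sup>2) \<longlonglongrightarrow> 1 * (hnorm H y)\<^sup>2"
    by (intro tendsto_mult tendsto_const)
  moreover have "real (Suc n) / real (Suc n + D) * (hnorm H y)\<^sup>2 \<le> (hnorm H x)\<^sup>2" for n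
    using ineq[of "Suc n + D"] by (simp add: divide_le_eq mult.commute)
  ultimately have "1 * (hnorm H y)\<^sup>2 \<le> (hnorm H x)\<^sup>2"
    by (intro LIMSEQ_le_const2) auto
  then show ?thesis using x by (auto simp: y_def intro: power2_le_imp_le simp del: fn_space_simps)
qed

text \<open>The one-variable step is used twice. For fixed \<open>\<omega>\<close> on the circle it
  is applied to \<open>W\<close> with scalar coefficients, where \<open>bound\<close> is the
  hypothesis. The result is the bound on the operator polynomial in \<open>\<omega>\<close> that the
  second application, to \<open>V\<close>, requires.\<close>

theorem von_neumann_inequality:
  assumes V: "linear_op H V" and W: "linear_op H W"
    and isoV: "\<And>x. x \<in> carrier H \<Longrightarrow> hnorm H (V x) = hnorm H x"
    and isoW: "\<And>x. x \<in> carrier H \<Longrightarrow> hnorm H (W x) = hnorm H x"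
    and comm: "\<And>x. x \<in> carrier H \<Longrightarrow> W (V x) = V (W x)"
    and bound: "\<And>z w. \<lbrakk>cmod z = 1; cmod w = 1\<rbrakk> \<Longrightarrow> cmod (\<Sum>m<D. \<Sum>k<D. c m k * z ^ m * w ^ k) \<le> 1"
    and x: "x \<in> carrier H"
  shows "hnorm H (\<lambda>i. \<Sum>m<D. \<Sum>k<D. c m k * (W ^^ k) ((V ^^ m) x) i) \<le> hnorm H x"
proof -
  interpret inner_space H by (rule inner_space_fn_space[OF J])
  define A where "A m x = (\<lambda>i. \<Sum>k<D. c m k * (W ^^ k) x i)" for m x
  have Wx: "(W ^^ p) z \<in> carrier H" if "z \<in> carrier H" for p z
    using linear_op_closed[OF linear_op_funpow[OF W] that] .
  have WV: "(W ^^ k) (V z) = V ((W ^^ k) z)" if "z \<in> carrier H" for k z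
    by (induction k) (use Wx[OF that] comm in \<open>auto simp del: fn_space_simps\<close>)
  have "linear_op H (A m)" for m
  proof -
    have L: "linear_op H (W ^^ k)" for k by (rule linear_op_funpow[OF W])
    show ?thesis
      unfolding linear_op_def
      using linear_op_closed[OF L] linear_op_add[OF L] linear_op_smult[OF L]
      by (auto simp: A_def algebra_simps sum.distrib sum_distrib_left intro!: sum.neutral)
  qed
  moreover have "A m (V z) = V (A m z)" if z: "z \<in> carrier H" for m z
    unfolding A_def
    by (subst linear_op_fn_space_sum[OF V J]) (use Wx[OF z] WV[OF z] in auto)
  moreover have "hnorm H (\<lambda>i. \<Sum>m<D. \<omega> ^ m * A m z i) \<le> hnorm H z"
    if \<omega>: "cmod \<omega> = 1" and z: "z \<in> carrier H" for \<omega> z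
  proof -
    define s where "s k = (\<Sum>m<D. c m k * \<omega> ^ m)" for k
    have "hnorm H (\<lambda>i. \<Sum>k<D. (\<lambda>z i. s k * z i) ((W ^^ k) z) i) \<le> hnorm H z"
    proof (rule von_neumann_step[OF W _ isoW _ _ z])
      show "linear_op H (\<lambda>z i. s k * z i)" for k
        by (auto simp: linear_op_def algebra_simps)
      show "(\<lambda>i. s k * W z i) = W (\<lambda>i. s k * z i)" if "z \<in> carrier H" for k z
        using linear_op_smult[OF W that, of "s k"] by simp
      fix \<nu> z assume \<nu>: "cmod \<nu> = 1" and z: "z \<in> carrier H"
      have "(\<Sum>k<D. \<nu> ^ k * s k) = (\<Sum>m<D. \<Sum>k<D. c m k * \<omega> ^ m * \<nu> ^ k)"
        unfolding s_def by (subst sum.swap) (simp add: sum_distrib_left mult_ac)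
      then have "cmod (\<Sum>k<D. \<nu> ^ k * s k) \<le> 1" using bound[OF \<omega> \<nu>] by simp
      moreover have "(\<lambda>i. \<Sum>k<D. \<nu> ^ k * (s k * z i)) = (\<Sum>k<D. \<nu> ^ k * s k) \<odot>\<^bsub>H\<^esub> z"
        by (simp add: sum_distrib_right mult.assoc)
      ultimately show "hnorm H (\<lambda>i. \<Sum>k<D. \<nu> ^ k * (s k * z i)) \<le> hnorm H z"
        using z hnorm_smult[OF z, of "\<Sum>k<D. \<nu> ^ k * s k"] mult_right_mono[of _ 1 "hnorm H z"]
        by (simp del: fn_space_simps)
    qed
    also have "(\<lambda>i. \<Sum>k<D. (\<lambda>z i. s k * z i) ((W ^^ k) z) i) = (\<lambda>i. \<Sum>m<D. \<omega> ^ m * A m z i)"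
      unfolding s_def A_def
      by (rule ext, simp add: sum_distrib_left sum_distrib_right, subst sum.swap, simp add: mult_ac)
    finally show ?thesis .
  qed
  ultimately have "hnorm H (\<lambda>i. \<Sum>m<D. A m ((V ^^ m) x) i) \<le> hnorm H x"
    by (intro von_neumann_step[OF V _ isoV _ _ x]) auto
  then show ?thesis by (simp add: A_def)
qed

end

section \<open>Ando's inequality for kernels\<close>

text \<open>An orthogonal sum of two copies of \<open>fn_space I\<close>, indexed by
  \<open>I \<times> UNIV\<close> so that it is again of the form \<open>fn_space\<close>.\<close>

definition dpair :: "('k \<Rightarrow> complex) \<Rightarrow> ('k \<Rightarrow> complex) \<Rightarrow> 'k \<times> bool \<Rightarrow> complex"
  where "dpair x y p = (if snd p then x (fst p) else y (fst p))"

lemma dpair_simps [simp]: "dpair x y (k, True) = x k" "dpair x y (k, False) = y k"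
  by (simp_all add: dpair_def)

lemma ip_dpair: "ip (fn_space (I \<times> UNIV)) (dpair x y) (dpair x' y') = ip (fn_space I) x x' + ip (fn_space I) y y'"
  by (simp add: ip_fn_space sum.cartesian_product' UNIV_bool sum.distrib add.commute)

lemma hnorm_slices:
  assumes "finite J"
  shows "(hnorm (fn_space ({..<N} \<times> J)) x)\<^sup>2 = (\<Sum>k<N. (hnorm (fn_space J) (\<lambda>p. x (k, p)))\<^sup>2)"
  by (simp add: hnorm_fn_space_sq sum.cartesian_product)

section \<open>Cyclic sequences: entrywise operators and a half shift\<close>

definition lift_op :: "(('p \<Rightarrow> complex) \<Rightarrow> 'p \<Rightarrow> complex) \<Rightarrow> (nat \<times> 'p \<Rightarrow> complex) \<Rightarrow> nat \<times> 'p \<Rightarrow> complex"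
  where "lift_op W x = (\<lambda>(k, p). W (\<lambda>q. x (k, q)) p)"

lemma lift_op_apply [simp]: "lift_op W x (k, p) = W (\<lambda>q. x (k, q)) p"
  by (simp add: lift_op_def)

text \<open>Read the components in the order \<open>(0, False)\<close>, \<open>(0, True)\<close>,
  \<open>(1, False)\<close>, \<open>(1, True)\<close> and so on: this is the backward cyclic shift
  by one place. It is half a shift of the sequence; its square is the full cyclic shift in
  \<open>k\<close>, which commutes with every entrywise operator.\<close>

definition shift_op :: "nat \<Rightarrow> (nat \<times> 'p \<times> bool \<Rightarrow> complex) \<Rightarrow> nat \<times> 'p \<times> bool \<Rightarrow> complex"
  where "shift_op N x = (\<lambda>(k, p, \<epsilon>). if k < N then if \<epsilon> then x (Suc k mod N, p, False) else x (k, p, True) else 0)"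

lemma shift_op_apply [simp]:
  "k < N \<Longrightarrow> shift_op N x (k, p, True) = x (Suc k mod N, p, False)"
  "k < N \<Longrightarrow> shift_op N x (k, p, False) = x (k, p, True)"
  "\<not> k < N \<Longrightarrow> shift_op N x (k, q) = 0"
  by (simp_all add: shift_op_def split: prod.split)

lemma linear_op_lift_op:
  assumes W: "linear_op (fn_space J) W" and J: "finite J"
  shows "linear_op (fn_space ({..<N} \<times> J)) (lift_op W)"
proof -
  have slice: "(\<lambda>q. x (k, q)) \<in> carrier (fn_space J)" if "x \<in> carrier (fn_space ({..<N} \<times> J))" for x k
    using that by auto
  have "lift_op W x \<in> carrier (fn_space ({..<N} \<times> J))" if x: "x \<in> carrier (fn_space ({..<N} \<times> J))" for x
  proof -
    interpret inner_space "fn_space J" by (rule inner_space_fn_space[OF J])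
    have "W (\<lambda>q. x (k, q)) p = 0" if "\<not> (k < N \<and> p \<in> J)" for k p
    proof (cases "k < N")
      case True
      then show ?thesis using linear_op_closed[OF W slice[OF x, of k]] that by auto
    next
      case False
      then have "(\<lambda>q. x (k, q)) = \<zero>\<^bsub>fn_space J\<^esub>" using x by auto
      then show ?thesis using linear_op_zero[OF W] by simp
    qed
    then show ?thesis by (auto simp: lift_op_def)
  qed
  moreover have "W (\<lambda>q. x (k, q) + y (k, q)) p = W (\<lambda>q. x (k, q)) p + W (\<lambda>q. y (k, q)) p"
    if "x \<in> carrier (fn_space ({..<N} \<times> J))" "y \<in> carrier (fn_space ({..<N} \<times> J))" for x y k p
    using linear_op_add[OF W slice[OF that(1), of k] slice[OF that(2), of k]] by simp
  moreover have "W (\<lambda>q. c * x (k, q)) p = c * W (\<lambda>q. x (k, q)) p"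
    if "x \<in> carrier (fn_space ({..<N} \<times> J))" for x k p c
    using linear_op_smult[OF W slice[OF that, of k], of c] by simp
  ultimately show ?thesis unfolding linear_op_def by (auto simp: fun_eq_iff simp del: fn_space_simps(1)) 
qed

lemma hnorm_lift_op:
  assumes J: "finite J" and W: "\<And>x. x \<in> carrier (fn_space J) \<Longrightarrow> hnorm (fn_space J) (W x) = hnorm (fn_space J) x"
    and x: "x \<in> carrier (fn_space ({..<N} \<times> J))"
  shows "hnorm (fn_space ({..<N} \<times> J)) (lift_op W x) = hnorm (fn_space ({..<N} \<times> J)) x"
proof -
  have "(\<lambda>q. x (k, q)) \<in> carrier (fn_space J)" for k using x by auto
  then have "(hnorm (fn_space ({..<N} \<times> J)) (lift_op W x))\<^sup>2 = (hnorm (fn_space ({..<N} \<times> J)) x)\<^sup>2"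
    unfolding hnorm_slices[OF J] by (simp add: W del: fn_space_simps)
  then show ?thesis by (simp add: hnorm_fn_space sum_nonneg)
qed

lemma linear_op_shift_op: "linear_op (fn_space ({..<N} \<times> I \<times> UNIV)) (shift_op N)"
  unfolding linear_op_def
proof (intro conjI ballI allI)
  show "shift_op N \<in> carrier (fn_space ({..<N} \<times> I \<times> UNIV)) \<rightarrow> carrier (fn_space ({..<N} \<times> I \<times> UNIV))"
    by (auto simp: shift_op_def)
qed (auto simp: shift_op_def fun_eq_iff)

lemma sum_cyclic_shift: "(\<Sum>k<N. f (Suc k mod N)) = (\<Sum>k<N. f k :: real)"
proof (cases N)
  case (Suc m)
  have "(\<Sum>k<N. f (Suc k mod N)) = (\<Sum>k<m. f (Suc k mod N)) + f 0" by (simp add: Suc)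
  also have "(\<Sum>k<m. f (Suc k mod N)) = (\<Sum>k<m. f (Suc k))" by (simp add: Suc)
  also have "\<dots> + f 0 = (\<Sum>k<N. f k)" unfolding Suc sum.lessThan_Suc_shift by simp
  finally show ?thesis .
qed simp

lemma hnorm_shift_op:
  "hnorm (fn_space ({..<N} \<times> I \<times> UNIV)) (shift_op N x) = hnorm (fn_space ({..<N} \<times> I \<times> UNIV)) x"
proof -
  have split: "(\<Sum>q\<in>{..<N} \<times> I \<times> UNIV. (cmod (y q))\<^sup>2)
      = (\<Sum>k<N. \<Sum>p\<in>I. (cmod (y (k, p, True)))\<^sup>2) + (\<Sum>k<N. \<Sum>p\<in>I. (cmod (y (k, p, False)))\<^sup>2)"
    for y :: "nat \<times> 'a \<times> bool \<Rightarrow> complex"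
    by (simp add: sum.cartesian_product' UNIV_bool sum.distrib add.commute)
  have "(\<Sum>q\<in>{..<N} \<times> I \<times> UNIV. (cmod (shift_op N x q))\<^sup>2) = (\<Sum>q\<in>{..<N} \<times> I \<times> UNIV. (cmod (x q))\<^sup>2)"
    unfolding split using sum_cyclic_shift[of "\<lambda>k. \<Sum>p\<in>I. (cmod (x (k, p, False)))\<^sup>2" N]
    by simp
  then show ?thesis by (simp add: hnorm_fn_space)
qed

lemma sum_geometric_limit:
  fixes \<tau> :: "'i \<Rightarrow> complex"
  assumes I: "finite I" and \<tau>: "\<And>i. i \<in> I \<Longrightarrow> cmod (\<tau> i) < 1"
  shows "(\<lambda>n. Re (\<Sum>i\<in>I. \<Sum>j\<in>I. f i j * (1 - (cnj (\<tau> i) * \<tau> j) ^ n))) \<longlonglongrightarrow> Re (\<Sum>i\<in>I. \<Sum>j\<in>I. f i j)"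
proof -
  have "(\<lambda>n. f i j * (1 - (cnj (\<tau> i) * \<tau> j) ^ n)) \<longlonglongrightarrow> f i j * (1 - 0)" if "i \<in> I" "j \<in> I" for i j
  proof (intro tendsto_intros LIMSEQ_power_zero)
    have "cmod (\<tau> i) * cmod (\<tau> j) < 1 * 1" using \<tau> that by (intro mult_strict_mono') auto
    then show "norm (cnj (\<tau> i) * \<tau> j) < 1" by (simp add: norm_mult)
  qed
  then show ?thesis by (intro tendsto_Re tendsto_sum) simp
qed

text \<open>Point \<open>j\<close> is represented by the sequence with entries
  \<open>\<tau> j ^ k * e j\<close>, where \<open>\<tau>\<close> is the product of the coordinates.
  Since the Gram matrix of the \<open>e j\<close> is \<open>1 - cnj (\<tau> i) * \<tau> j\<close>
  times \<open>l\<close>, geometric summation makes \<open>l\<close> the Gram matrix of these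
  sequences. On them \<open>V1\<close> and \<open>V2\<close> multiply by \<open>a j\<close> and
  \<open>b j\<close>, so the polynomial multiplies by \<open>g j\<close>, and the von Neumann
  inequality compares the two quadratic forms.\<close>

theorem ando_kernel_inequality:
  fixes I :: "'i set" and a b :: "'i \<Rightarrow> complex" and l :: "'i \<Rightarrow> 'i \<Rightarrow> complex" and c :: "nat \<Rightarrow> nat \<Rightarrow> complex"
  assumes I: "finite I" and a: "\<And>i. i \<in> I \<Longrightarrow> cmod (a i) < 1" and b: "\<And>i. i \<in> I \<Longrightarrow> cmod (b i) < 1"
    and psd_a: "psd I (\<lambda>i j. (1 - cnj (a i) * a j) * l i j)"
    and psd_b: "psd I (\<lambda>i j. (1 - cnj (b i) * b j) * l i j)"
    and bound: "\<And>z w. \<lbrakk>cmod z = 1; cmod w = 1\<rbrakk> \<Longrightarrow> cmod (\<Sum>m<D. \<Sum>k<D. c m k * z ^ m * w ^ k) \<le> 1"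
  defines "g \<equiv> \<lambda>i. \<Sum>m<D. \<Sum>k<D. c m k * a i ^ m * b i ^ k"
  shows "0 \<le> Re (\<Sum>i\<in>I. \<Sum>j\<in>I. (1 - cnj (g i) * g j) * l i j)"
proof -
  obtain \<alpha> where \<alpha>: "\<And>i. i \<in> I \<Longrightarrow> \<alpha> i \<in> carrier (fn_space I)"
    "\<And>i j. i \<in> I \<Longrightarrow> j \<in> I \<Longrightarrow> (1 - cnj (a i) * a j) * l i j = ip (fn_space I) (\<alpha> j) (\<alpha> i)"
    using psd_gram[OF I psd_a] by blast
  obtain \<beta> where \<beta>: "\<And>i. i \<in> I \<Longrightarrow> \<beta> i \<in> carrier (fn_space I)"
    "\<And>i j. i \<in> I \<Longrightarrow> j \<in> I \<Longrightarrow> (1 - cnj (b i) * b j) * l i j = ip (fn_space I) (\<beta> j) (\<beta> i)"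
    using psd_gram[OF I psd_b] by blast
  define J where "J = I \<times> (UNIV :: bool set)"
  have J: "finite J" using I by (simp add: J_def)
  interpret I: inner_space "fn_space I" by (rule inner_space_fn_space[OF I])
  interpret E: inner_space "fn_space J" by (rule inner_space_fn_space[OF J])
  define \<tau> where "\<tau> i = a i * b i" for i
  have \<tau>: "cmod (\<tau> i) < 1" if "i \<in> I" for i
    using mult_strict_mono'[OF a[OF that] b[OF that]] by (simp add: \<tau>_def norm_mult)
  \<comment> \<open>The factor \<open>1 - cnj (\<tau> i) * \<tau> j\<close> splits in two ways: as
    the factor of \<open>b\<close> plus \<open>cnj (b i) * b j\<close> times the factor of
    \<open>a\<close>, and with \<open>a\<close> and \<open>b\<close> exchanged. So \<open>e\<close>
    and \<open>e'\<close> have the same Gram matrix, and a unitary \<open>W\<close> takes one to the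
    other.\<close>
  define e where "e j = dpair (\<lambda>k. b j * \<alpha> j k) (\<beta> j)" for j
  define e' where "e' j = dpair (\<lambda>k. a j * \<beta> j k) (\<alpha> j)" for j
  have e: "e j \<in> carrier (fn_space J)" "e' j \<in> carrier (fn_space J)" if "j \<in> I" for j
    using \<alpha>(1)[OF that] \<beta>(1)[OF that] by (auto simp: e_def e'_def dpair_def J_def)
  have ip_scale: "ip (fn_space I) (\<lambda>k. s * x k) (\<lambda>k. t * y k) = s * cnj t * ip (fn_space I) x y" for s t x y
    by (simp add: ip_fn_space sum_distrib_left mult_ac)
  have ee: "ip (fn_space J) (e j) (e i) = (1 - cnj (\<tau> i) * \<tau> j) * l i j" if "i \<in> I" "j \<in> I" for i j
    unfolding e_def J_def ip_dpair ip_scale \<alpha>(2)[OF that, symmetric] \<beta>(2)[OF that, symmetric]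
    by (simp add: \<tau>_def algebra_simps)
  have ee': "ip (fn_space J) (e' j) (e' i) = (1 - cnj (\<tau> i) * \<tau> j) * l i j" if "i \<in> I" "j \<in> I" for i j
    unfolding e'_def J_def ip_dpair ip_scale \<alpha>(2)[OF that, symmetric] \<beta>(2)[OF that, symmetric]
    by (simp add: \<tau>_def algebra_simps)
  obtain W W' where WW': "E.unitary_pair W W'" and We: "\<And>j. j \<in> I \<Longrightarrow> W (e j) = e' j"
    using E.unitary_extension[OF I, of e e'] e ee ee' by auto
  have W'e: "W' (e' j) = e j" if "j \<in> I" for j
    using We[OF that] E.unitary_pairD(6)[OF WW', of "e j"] e[OF that] by simp
  note lin = E.unitary_pairD(1,2)[OF WW']
  have W_norm: "hnorm (fn_space J) (W x) = hnorm (fn_space J) x" and W'_norm: "hnorm (fn_space J) (W' x) = hnorm (fn_space J) x"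
    if "x \<in> carrier (fn_space J)" for x
    using E.unitary_pairD(8,9)[OF WW', of x x] that by (simp_all add: hnorm_def)

  \<comment> \<open>The square norm of the first \<open>n\<close> entries of the sequence with
    coefficients \<open>h\<close>.\<close>
  define \<Theta> where "\<Theta> h n = (\<Sum>k<n. \<Sum>p\<in>J. (cmod (\<Sum>j\<in>I. (h j * \<tau> j ^ k) * e j p))\<^sup>2)" for h n
  have \<Theta>: "\<Theta> h n = Re (\<Sum>i\<in>I. \<Sum>j\<in>I. (cnj (h i) * h j * l i j) * (1 - (cnj (\<tau> i) * \<tau> j) ^ n))" for h n
  proof -
    have "complex_of_real (\<Theta> h n) = (\<Sum>k<n. \<Sum>p\<in>J. \<Sum>j\<in>I. \<Sum>i\<in>I.
        (cnj (h i) * h j) * (cnj (\<tau> i) * \<tau> j) ^ k * (e j p * cnj (e i p)))"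
      unfolding \<Theta>_def of_real_sum complex_norm_square
      by (simp add: sum_product power_mult_distrib mult_ac)
    also have "\<dots> = (\<Sum>k<n. \<Sum>j\<in>I. \<Sum>i\<in>I.
        (cnj (h i) * h j) * (cnj (\<tau> i) * \<tau> j) ^ k * ip (fn_space J) (e j) (e i))"
      unfolding ip_fn_space
      by (rule sum.cong[OF refl], subst sum.swap, rule sum.cong[OF refl], subst sum.swap) (simp add: sum_distrib_left)
    also have "\<dots> = (\<Sum>j\<in>I. \<Sum>i\<in>I. \<Sum>k<n.
        (cnj (h i) * h j) * (cnj (\<tau> i) * \<tau> j) ^ k * ip (fn_space J) (e j) (e i))"
      by (subst sum.swap, rule sum.cong[OF refl], subst sum.swap) simp
    also have "\<dots> = (\<Sum>j\<in>I. \<Sum>i\<in>I. (cnj (h i) * h j * l i j) * (1 - (cnj (\<tau> i) * \<tau> j) ^ n))"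
    proof (intro sum.cong refl)
      fix i j assume ij: "j \<in> I" "i \<in> I"
      have "(\<Sum>k<n. (cnj (h i) * h j) * (cnj (\<tau> i) * \<tau> j) ^ k * ip (fn_space J) (e j) (e i))
        = (cnj (h i) * h j * l i j) * ((1 - cnj (\<tau> i) * \<tau> j) * (\<Sum>k<n. (cnj (\<tau> i) * \<tau> j) ^ k))"
        unfolding ee[OF ij(2,1)] by (simp add: sum_distrib_left mult_ac)
      also have "(1 - cnj (\<tau> i) * \<tau> j) * (\<Sum>k<n. (cnj (\<tau> i) * \<tau> j) ^ k) = 1 - (cnj (\<tau> i) * \<tau> j) ^ n"
        by (rule one_diff_power_eq[symmetric])
      finally show "(\<Sum>k<n. (cnj (h i) * h j) * (cnj (\<tau> i) * \<tau> j) ^ k * ip (fn_space J) (e j) (e i))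
        = (cnj (h i) * h j * l i j) * (1 - (cnj (\<tau> i) * \<tau> j) ^ n)" .
    qed
    also have "\<dots> = (\<Sum>i\<in>I. \<Sum>j\<in>I. (cnj (h i) * h j * l i j) * (1 - (cnj (\<tau> i) * \<tau> j) ^ n))"
      by (rule sum.swap)
    finally show ?thesis by (metis Re_complex_of_real)
  qed

  have main: "\<Theta> g n \<le> \<Theta> (\<lambda>_. 1) (n + 2 * D)" for n
  proof -
    \<comment> \<open>Each application of \<open>V1\<close> or \<open>V2\<close> spoils one entry at
      the end; fewer than \<open>2 * D\<close> applications occur, so the first \<open>n\<close>
      entries survive.\<close>
    define N where "N = n + 2 * D"
    define JN where "JN = {..<N} \<times> J"
    have JN: "finite JN" "JN = {..<N} \<times> I \<times> UNIV" using J by (auto simp: JN_def J_def)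
    define V1 where "V1 x = shift_op N (lift_op W x)" for x
    define V2 where "V2 x = lift_op W' (shift_op N x)" for x
    have liftW: "linear_op (fn_space JN) (lift_op W)" "linear_op (fn_space JN) (lift_op W')"
      unfolding JN_def using linear_op_lift_op[OF _ J] lin by auto
    have shiftN: "linear_op (fn_space JN) (shift_op N :: (nat \<times> 'i \<times> bool \<Rightarrow> complex) \<Rightarrow> _)"
      unfolding JN(2) by (rule linear_op_shift_op)
    have V: "linear_op (fn_space JN) V1" "linear_op (fn_space JN) V2"
      using liftW shiftN unfolding V1_def V2_def linear_op_def Pi_iff by auto
    have iso: "hnorm (fn_space JN) (V1 x) = hnorm (fn_space JN) x" "hnorm (fn_space JN) (V2 x) = hnorm (fn_space JN) x"
      if x: "x \<in> carrier (fn_space JN)" for x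
    proof -
      have s: "hnorm (fn_space JN) (shift_op N y) = hnorm (fn_space JN) y" for y :: "nat \<times> 'i \<times> bool \<Rightarrow> complex"
        unfolding JN(2) by (rule hnorm_shift_op)
      have w: "hnorm (fn_space JN) (lift_op W y) = hnorm (fn_space JN) y" "hnorm (fn_space JN) (lift_op W' y) = hnorm (fn_space JN) y"
        if "y \<in> carrier (fn_space JN)" for y
        using that unfolding JN_def
        by (auto intro!: hnorm_lift_op J W_norm W'_norm simp del: fn_space_simps)
      show "hnorm (fn_space JN) (V1 x) = hnorm (fn_space JN) x" "hnorm (fn_space JN) (V2 x) = hnorm (fn_space JN) x"
        unfolding V1_def V2_def using s w x linear_op_closed[OF shiftN x] by simp_all
    qed
    have slice: "(\<lambda>q. x (k, q)) \<in> carrier (fn_space J)" if "x \<in> carrier (fn_space JN)" for x k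
      using that by (auto simp: JN_def)
    have SS: "shift_op N (shift_op N x) = (\<lambda>(k, q). if k < N then x (Suc k mod N, q) else 0)"
      for x :: "nat \<times> 'i \<times> bool \<Rightarrow> complex"
    proof (rule ext, clarify)
      fix k :: nat and p :: 'i and \<epsilon> :: bool
      show "shift_op N (shift_op N x) (k, p, \<epsilon>) = (if k < N then x (Suc k mod N, p, \<epsilon>) else 0)"
        by (cases "k < N"; cases \<epsilon>) simp_all
    qed
    \<comment> \<open>In both orders \<open>W\<close> and \<open>W'\<close> cancel and two half
      shifts remain: \<open>V1\<close> is the half shift after \<open>W\<close>, and
      \<open>V2\<close> is \<open>W'\<close> after the half shift.\<close>
    have comm: "V2 (V1 x) = V1 (V2 x)" if x: "x \<in> carrier (fn_space JN)" for x
    proof -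
      have "lift_op W (lift_op W' y) = y" if "y \<in> carrier (fn_space JN)" for y
        using E.unitary_pairD(5)[OF WW' slice[OF that]] by (simp add: lift_op_def fun_eq_iff)
      then have "V1 (V2 x) = shift_op N (shift_op N x)"
        using linear_op_closed[OF shiftN x] by (simp add: V1_def V2_def)
      moreover have "V2 (V1 x) = shift_op N (shift_op N x)"
      proof (rule ext, clarify)
        fix k :: nat and p :: 'i and \<epsilon> :: bool
        show "V2 (V1 x) (k, p, \<epsilon>) = shift_op N (shift_op N x) (k, p, \<epsilon>)"
        proof (cases "k < N")
          case True
          then have "V2 (V1 x) (k, p, \<epsilon>) = W' (W (\<lambda>q. x (Suc k mod N, q))) (p, \<epsilon>)"
            by (simp add: V1_def V2_def SS)
          then show ?thesis using True E.unitary_pairD(6)[OF WW' slice[OF x]] by (simp add: SS)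
        next
          case False
          have "W' (\<lambda>q. 0) = (\<lambda>q. 0)" using E.linear_op_zero[OF lin(2)] by simp
          then show ?thesis using False by (simp add: V1_def V2_def SS)
        qed
      qed
      ultimately show ?thesis by simp
    qed
    \<comment> \<open>The first \<open>r\<close> entries are still those of the combination with
      coefficients \<open>h\<close>; nothing is claimed about the entries affected by the
      wrap-around.\<close>
    define good where "good r h x \<longleftrightarrow> x \<in> carrier (fn_space JN) \<and>
      (\<forall>k<r. (\<lambda>q. x (k, q)) = (\<lambda>q. \<Sum>j\<in>I. (h j * \<tau> j ^ k) * e j q))" for r h x
    have Wsum: "W (\<lambda>q. \<Sum>j\<in>I. h j * e j q) = (\<lambda>q. \<Sum>j\<in>I. h j * e' j q)"
      "W' (\<lambda>q. \<Sum>j\<in>I. h j * e' j q) = (\<lambda>q. \<Sum>j\<in>I. h j * e j q)" for h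
      using linear_op_fn_space_sum[OF lin(1) J I, of e h] linear_op_fn_space_sum[OF lin(2) J I, of e' h] e We W'e
      by (simp_all del: fn_space_simps)
    have good_V1: "good r (\<lambda>j. a j * h j) (V1 x)" if g: "good (Suc r) h x" and r: "Suc r \<le> N" for r h x
      unfolding good_def
    proof (intro conjI allI impI ext)
      have x: "x \<in> carrier (fn_space JN)" using g by (simp add: good_def)
      show "V1 x \<in> carrier (fn_space JN)" using linear_op_closed[OF V(1) x] .
      fix k :: nat and q :: "'i \<times> bool" assume k: "k < r"
      have sl: "(\<lambda>q. x (k, q)) = (\<lambda>q. \<Sum>j\<in>I. (h j * \<tau> j ^ k) * e j q)"
        "(\<lambda>q. x (Suc k, q)) = (\<lambda>q. \<Sum>j\<in>I. (h j * \<tau> j ^ Suc k) * e j q)"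
        using g k by (auto simp: good_def)
      have kN: "k < N" "Suc k mod N = Suc k" using k r by auto
      obtain p \<epsilon> where q: "q = (p, \<epsilon>)" by force
      show "V1 x (k, q) = (\<Sum>j\<in>I. (a j * h j * \<tau> j ^ k) * e j q)"
        unfolding q V1_def using kN
        by (cases \<epsilon>) (simp_all only: shift_op_apply lift_op_apply sl Wsum, simp_all add: e_def e'_def \<tau>_def mult_ac)
    qed
    have good_V2: "good r (\<lambda>j. b j * h j) (V2 x)" if g: "good (Suc r) h x" and r: "Suc r \<le> N" for r h x
      unfolding good_def
    proof (intro conjI allI impI)
      have x: "x \<in> carrier (fn_space JN)" using g by (simp add: good_def)
      show "V2 x \<in> carrier (fn_space JN)" using linear_op_closed[OF V(2) x] .
      fix k assume k: "k < r"
      have rows: "(\<lambda>q. x (k, q)) = (\<lambda>q. \<Sum>j\<in>I. (h j * \<tau> j ^ k) * e j q)"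
        "(\<lambda>q. x (Suc k, q)) = (\<lambda>q. \<Sum>j\<in>I. (h j * \<tau> j ^ Suc k) * e j q)"
        using g k by (auto simp: good_def)
      note sl = fun_cong[OF rows(1)] fun_cong[OF rows(2)]
      have kN: "k < N" "Suc k mod N = Suc k" using k r by auto
      have "(\<lambda>q. shift_op N x (k, q)) = (\<lambda>q. \<Sum>j\<in>I. (b j * h j * \<tau> j ^ k) * e' j q)"
      proof (rule ext, clarify)
        fix p \<epsilon>
        show "shift_op N x (k, p, \<epsilon>) = (\<Sum>j\<in>I. (b j * h j * \<tau> j ^ k) * e' j (p, \<epsilon>))"
          using kN by (cases \<epsilon>) (simp_all only: shift_op_apply sl, simp_all add: e_def e'_def \<tau>_def mult_ac)
      qed
      then have "(\<lambda>q. V2 x (k, q)) = W' (\<lambda>q. \<Sum>j\<in>I. (b j * h j * \<tau> j ^ k) * e' j q)"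
        by (simp add: V2_def)
      then show "(\<lambda>q. V2 x (k, q)) = (\<lambda>q. \<Sum>j\<in>I. (b j * h j * \<tau> j ^ k) * e j q)"
        unfolding Wsum .
    qed
    have good_V1_pow: "good (N - m) (\<lambda>j. a j ^ m * h j) ((V1 ^^ m) x)" if "good N h x" "m \<le> N" for m h x
      using that(2)
    proof (induction m)
      case (Suc m)
      then have "good (Suc (N - Suc m)) (\<lambda>j. a j ^ m * h j) ((V1 ^^ m) x)" by (simp add: Suc_diff_Suc)
      from good_V1[OF this] show ?case using Suc.prems by (simp add: mult_ac)
    qed (use that(1) in simp)
    have good_V2_pow: "good (r - k) (\<lambda>j. b j ^ k * h j) ((V2 ^^ k) x)" if "good r h x" "k \<le> r" "r \<le> N" for r k h x
      using that(2)
    proof (induction k)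
      case (Suc k)
      then have "good (Suc (r - Suc k)) (\<lambda>j. b j ^ k * h j) ((V2 ^^ k) x)" by (simp add: Suc_diff_Suc)
      from good_V2[OF this] show ?case using Suc.prems that(3) by (simp add: mult_ac)
    qed (use that(1) in simp)
    define x where "x = (\<lambda>(k, q). if k < N then \<Sum>j\<in>I. (1 * \<tau> j ^ k) * e j q else 0)"
    have x: "x \<in> carrier (fn_space JN)" using e(1) by (auto simp: x_def JN_def intro!: sum.neutral)
    have good_x: "good N (\<lambda>_. 1) x" unfolding good_def using x by (simp add: x_def)
    define y where "y = (\<lambda>i. \<Sum>m<D. \<Sum>k<D. c m k * (V2 ^^ k) ((V1 ^^ m) x) i)"
    have y_row: "y (k, q) = (\<Sum>j\<in>I. (g j * \<tau> j ^ k) * e j q)" if k: "k < n" for k q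
    proof -
      have "(V2 ^^ k') ((V1 ^^ m) x) (k, q) = (\<Sum>j\<in>I. (b j ^ k' * (a j ^ m * 1) * \<tau> j ^ k) * e j q)"
        if "m < D" "k' < D" for m k'
      proof -
        have good: "good (N - m - k') (\<lambda>j. b j ^ k' * (a j ^ m * 1)) ((V2 ^^ k') ((V1 ^^ m) x))"
          using that by (intro good_V2_pow good_V1_pow good_x) (auto simp: N_def)
        have "k < N - m - k'" using that k by (simp add: N_def)
        with good have "(\<lambda>q. (V2 ^^ k') ((V1 ^^ m) x) (k, q))
            = (\<lambda>q. \<Sum>j\<in>I. (b j ^ k' * (a j ^ m * 1) * \<tau> j ^ k) * e j q)"
          unfolding good_def by blast
        from fun_cong[OF this, of q] show ?thesis .
      qed
      then have "y (k, q) = (\<Sum>m<D. \<Sum>k'<D. \<Sum>j\<in>I. c m k' * ((b j ^ k' * (a j ^ m * 1) * \<tau> j ^ k) * e j q))"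
        unfolding y_def by (intro sum.cong refl) (simp add: sum_distrib_left)
      also have "\<dots> = (\<Sum>j\<in>I. \<Sum>m<D. \<Sum>k'<D. c m k' * ((b j ^ k' * (a j ^ m * 1) * \<tau> j ^ k) * e j q))"
        by (rule trans[OF sum.cong[OF refl sum.swap] sum.swap])
      also have "\<dots> = (\<Sum>j\<in>I. (g j * \<tau> j ^ k) * e j q)"
        by (simp add: g_def sum_distrib_left sum_distrib_right mult_ac)
      finally show ?thesis .
    qed
    have vN: "hnorm (fn_space JN) y \<le> hnorm (fn_space JN) x"
      unfolding y_def
    proof (rule von_neumann_inequality[where c = c and D = D and V = V1 and W = V2 and x = x])
      show "finite JN" "linear_op (fn_space JN) V1" "linear_op (fn_space JN) V2" "x \<in> carrier (fn_space JN)"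
        by (rule JN V x)+
    qed (rule iso comm bound; assumption)+
    have "\<Theta> g n = (\<Sum>k<n. (hnorm (fn_space J) (\<lambda>q. y (k, q)))\<^sup>2)"
      unfolding \<Theta>_def hnorm_fn_space_sq by (intro sum.cong refl) (simp add: y_row)
    also have "\<dots> \<le> (\<Sum>k<N. (hnorm (fn_space J) (\<lambda>q. y (k, q)))\<^sup>2)"
      by (rule sum_mono2) (auto simp: N_def)
    also have "\<dots> = (hnorm (fn_space JN) y)\<^sup>2" unfolding JN_def hnorm_slices[OF J] ..
    also have "\<dots> \<le> (hnorm (fn_space JN) x)\<^sup>2"
      using vN by (intro power_mono) (auto simp: hnorm_fn_space sum_nonneg)
    also have "\<dots> = \<Theta> (\<lambda>_. 1) N"
      unfolding \<Theta>_def JN_def hnorm_slices[OF J] unfolding hnorm_fn_space_sq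
      by (intro sum.cong refl) (simp add: x_def)
    finally show ?thesis by (simp add: N_def)
  qed
  \<comment> \<open>All \<open>\<tau> i\<close> lie in the open disc, so both sides of
    \<open>main\<close> converge and the lag \<open>2 * D\<close> disappears.\<close>
  have "Re (\<Sum>i\<in>I. \<Sum>j\<in>I. cnj (g i) * g j * l i j) \<le> Re (\<Sum>i\<in>I. \<Sum>j\<in>I. cnj 1 * 1 * l i j)"
  proof (rule LIMSEQ_le)
    show "(\<lambda>n. \<Theta> g n) \<longlonglongrightarrow> Re (\<Sum>i\<in>I. \<Sum>j\<in>I. cnj (g i) * g j * l i j)"
      unfolding \<Theta> by (rule sum_geometric_limit[OF I \<tau>])
    have "(\<lambda>n. \<Theta> (\<lambda>_. 1) n) \<longlonglongrightarrow> Re (\<Sum>i\<in>I. \<Sum>j\<in>I. cnj 1 * 1 * l i j)"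
      unfolding \<Theta> by (rule sum_geometric_limit[OF I \<tau>])
    then show "(\<lambda>n. \<Theta> (\<lambda>_. 1) (n + 2 * D)) \<longlonglongrightarrow> Re (\<Sum>i\<in>I. \<Sum>j\<in>I. cnj 1 * 1 * l i j)"
      by (rule LIMSEQ_ignore_initial_segment)
  qed (use main in blast)
  then show ?thesis by (simp add: left_diff_distrib sum_subtractf)
qed

section \<open>Polynomial approximation on the bidisc\<close>

text \<open>The Lagrange basis polynomial for the node \<open>k\<close> among the
  \<open>R\<close>-th roots of unity. Being bounded by 1 on the disc, it propagates node errors
  without amplification.\<close>

definition dft_kernel :: "nat \<Rightarrow> nat \<Rightarrow> complex \<Rightarrow> complex"
  where "dft_kernel R k z = (\<Sum>a<R. z ^ a * cnj (cis (2 * pi * real k / real R)) ^ a) / of_nat R"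

lemma cmod_dft_kernel_le: "cmod z \<le> 1 \<Longrightarrow> cmod (dft_kernel R k z) \<le> 1"
proof -
  assume z: "cmod z \<le> 1"
  have "cmod (\<Sum>a<R. z ^ a * cnj (cis (2 * pi * real k / real R)) ^ a) \<le> (\<Sum>a<R. 1)"
    using z by (intro sum_norm_le) (simp add: norm_mult norm_power power_le_one)
  then show ?thesis by (cases "R = 0") (simp_all add: dft_kernel_def norm_divide divide_le_eq)
qed

lemma dft_kernel_reproduces:
  assumes R: "R > 0"
  shows "(\<Sum>k<R. (\<Sum>a<R. c a * cis (2 * pi * real k / real R) ^ a) * dft_kernel R k z) = (\<Sum>a<R. c a * z ^ a)"
proof -
  define \<omega> where "\<omega> k = cis (2 * pi * real k / real R)" for k
  have "(\<Sum>k<R. (\<Sum>a<R. c a * \<omega> k ^ a) * (\<Sum>b<R. z ^ b * cnj (\<omega> k) ^ b))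
    = (\<Sum>k<R. \<Sum>a<R. \<Sum>b<R. (\<omega> k ^ a * cnj (\<omega> k) ^ b) * (c a * z ^ b))"
    by (simp add: sum_product mult_ac)
  also have "\<dots> = (\<Sum>a<R. \<Sum>b<R. \<Sum>k<R. (\<omega> k ^ a * cnj (\<omega> k) ^ b) * (c a * z ^ b))"
    by (subst sum.swap, rule sum.cong[OF refl], rule sum.swap)
  also have "\<dots> = (\<Sum>a<R. \<Sum>b<R. if a = b then of_nat R * (c a * z ^ b) else 0)"
    by (intro sum.cong refl) (simp add: sum_distrib_right[symmetric] \<omega>_def root_of_unity_orthogonality)
  also have "\<dots> = of_nat R * (\<Sum>a<R. c a * z ^ a)" by (simp add: sum_distrib_left)
  finally show ?thesis
    using R by (simp add: dft_kernel_def sum_divide_distrib[symmetric] flip: \<omega>_def)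
qed

lemma cmod_scale_less:
  assumes "0 < \<rho>" "\<rho> < 1" "cmod t \<le> 1"
  shows "cmod (of_real \<rho> * t) < 1"
proof -
  have "\<rho> * cmod t \<le> \<rho> * 1" using assms by (intro mult_left_mono) auto
  then have "\<rho> * cmod t < 1" using assms by linarith
  then show ?thesis using assms by (simp add: norm_mult)
qed

text \<open>Interpolation reproduces the Taylor polynomial of degree below \<open>R\<close> exactly.
  What is left is the Taylor tail at the \<open>R\<close> nodes and at \<open>z\<close> itself,
  \<open>R + 1\<close> tails in all, each bounded by Cauchy's estimate on the radius
  \<open>r\<close> between \<open>\<rho>\<close> and 1.\<close>

lemma interpolation_error:
  fixes g :: "complex \<Rightarrow> complex"
  assumes \<rho>: "0 < \<rho>" "\<rho> < r" "r < 1" and g: "g holomorphic_on ball 0 1"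
    and g1: "\<And>z. cmod z < 1 \<Longrightarrow> cmod (g z) \<le> 1" and R: "R > 0" and z: "cmod z \<le> 1"
  shows "cmod ((\<Sum>k<R. g (of_real \<rho> * cis (2 * pi * real k / real R)) * dft_kernel R k z) - g (of_real \<rho> * z))
    \<le> (real R + 1) * ((\<rho> / r) ^ R / (1 - \<rho> / r))"
proof -
  define \<omega> where "\<omega> k = cis (2 * pi * real k / real R)" for k
  define c where "c a = (deriv ^^ a) g 0 / fact a" for a
  define \<theta> where "\<theta> = \<rho> / r"
  have \<theta>: "0 \<le> \<theta>" "\<theta> < 1" using \<rho> by (auto simp: \<theta>_def)
  have "cball 0 r \<subseteq> ball (0::complex) 1" "ball 0 r \<subseteq> ball (0::complex) 1" using \<rho> by auto
  then have "continuous_on (cball 0 r) g" "g holomorphic_on ball 0 r"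
    using holomorphic_on_imp_continuous_on[OF holomorphic_on_subset[OF g]] holomorphic_on_subset[OF g]
    by auto
  then have "cmod ((deriv ^^ a) g 0) \<le> fact a * 1 / r ^ a" for a
    using \<rho> by (intro Cauchy_inequality) (auto intro: g1)
  then have c: "cmod (c a) \<le> 1 / r ^ a" for a
    by (simp add: c_def norm_divide divide_le_eq)
  have tail: "cmod (g (of_real \<rho> * t) - (\<Sum>a<R. c a * (of_real \<rho> * t) ^ a)) \<le> \<theta> ^ R / (1 - \<theta>)"
    if t: "cmod t \<le> 1" for t
  proof (rule norm_sums_le)
    have "cmod (of_real \<rho> * t) < 1"
      using \<rho> t by (intro cmod_scale_less) auto
    then have "(\<lambda>a. c a * (of_real \<rho> * t) ^ a) sums g (of_real \<rho> * t)"
      using holomorphic_power_series[OF g, of "of_real \<rho> * t"] by (simp add: c_def)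
    then show "(\<lambda>a. c (a + R) * (of_real \<rho> * t) ^ (a + R)) sums (g (of_real \<rho> * t) - (\<Sum>a<R. c a * (of_real \<rho> * t) ^ a))"
      by (rule sums_split_initial_segment)
    have "(\<lambda>a. \<theta> ^ R * \<theta> ^ a) sums (\<theta> ^ R * (1 / (1 - \<theta>)))"
      using \<theta> by (intro sums_mult geometric_sums) simp
    then show "(\<lambda>a. \<theta> ^ (a + R)) sums (\<theta> ^ R / (1 - \<theta>))" by (simp add: power_add mult.commute)
    show "cmod (c (a + R) * (of_real \<rho> * t) ^ (a + R)) \<le> \<theta> ^ (a + R)" for a
    proof -
      have "cmod (c (a + R) * (of_real \<rho> * t) ^ (a + R)) = cmod (c (a + R)) * (\<rho> ^ (a + R) * cmod t ^ (a + R))"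
        using \<rho> by (simp add: norm_mult norm_power power_mult_distrib)
      also have "\<dots> \<le> 1 / r ^ (a + R) * (\<rho> ^ (a + R) * 1)"
        using c[of "a + R"] t \<rho> by (intro mult_mono) (auto intro: power_le_one)
      finally show ?thesis by (simp add: \<theta>_def power_divide)
    qed
  qed
  define e where "e t = g (of_real \<rho> * t) - (\<Sum>a<R. c a * (of_real \<rho> * t) ^ a)" for t
  have e: "cmod (e t) \<le> \<theta> ^ R / (1 - \<theta>)" if "cmod t \<le> 1" for t unfolding e_def by (rule tail[OF that])
  have "(\<Sum>k<R. g (of_real \<rho> * \<omega> k) * dft_kernel R k z)
    = (\<Sum>k<R. e (\<omega> k) * dft_kernel R k z) + (\<Sum>k<R. (\<Sum>a<R. (c a * of_real \<rho> ^ a) * \<omega> k ^ a) * dft_kernel R k z)"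
    by (simp add: e_def sum.distrib[symmetric] ring_distribs power_mult_distrib mult.assoc)
  also have "(\<Sum>k<R. (\<Sum>a<R. (c a * of_real \<rho> ^ a) * \<omega> k ^ a) * dft_kernel R k z) = (\<Sum>a<R. (c a * of_real \<rho> ^ a) * z ^ a)"
    unfolding \<omega>_def by (rule dft_kernel_reproduces[OF R])
  also have "\<dots> = g (of_real \<rho> * z) - e z" by (simp add: e_def power_mult_distrib mult.assoc)
  finally have "(\<Sum>k<R. g (of_real \<rho> * \<omega> k) * dft_kernel R k z) - g (of_real \<rho> * z)
    = (\<Sum>k<R. e (\<omega> k) * dft_kernel R k z) - e z" by simp
  then have "cmod ((\<Sum>k<R. g (of_real \<rho> * \<omega> k) * dft_kernel R k z) - g (of_real \<rho> * z))
    \<le> cmod (\<Sum>k<R. e (\<omega> k) * dft_kernel R k z) + cmod (e z)"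
    by (metis norm_triangle_ineq4)
  also have "cmod (\<Sum>k<R. e (\<omega> k) * dft_kernel R k z) \<le> (\<Sum>k<R. \<theta> ^ R / (1 - \<theta>) * 1)"
    unfolding \<omega>_def
    by (rule sum_norm_le, unfold norm_mult, rule mult_mono)
       (use e cmod_dft_kernel_le[OF z] \<theta> in \<open>auto intro!: e divide_nonneg_nonneg\<close>)
  also have "cmod (e z) \<le> \<theta> ^ R / (1 - \<theta>)" by (rule e[OF z])
  finally show ?thesis by (simp add: \<omega>_def \<theta>_def distrib_right add_divide_distrib)
qed

text \<open>Interpolate the dilate in one variable at a time, so that separate holomorphy suffices.
  The error in \<open>w\<close> occurs at \<open>R\<close> nodes and is weighted by kernels bounded
  by 1; the error in \<open>z\<close> occurs once.\<close>

lemma polynomial_approximation: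
  fixes f :: "complex \<Rightarrow> complex \<Rightarrow> complex"
  assumes \<rho>: "0 < \<rho>" "\<rho> < 1" and \<epsilon>: "\<epsilon> > 0"
    and f1: "\<And>w. cmod w < 1 \<Longrightarrow> (\<lambda>z. f z w) holomorphic_on ball 0 1"
    and f2: "\<And>z. cmod z < 1 \<Longrightarrow> (\<lambda>w. f z w) holomorphic_on ball 0 1"
    and bound: "\<And>z w. \<lbrakk>cmod z < 1; cmod w < 1\<rbrakk> \<Longrightarrow> cmod (f z w) \<le> 1"
  shows "\<exists>D c. \<forall>z w. cmod z \<le> 1 \<longrightarrow> cmod w \<le> 1 \<longrightarrow>
    cmod ((\<Sum>m<D. \<Sum>k<D. c m k * z ^ m * w ^ k) - f (of_real \<rho> * z) (of_real \<rho> * w)) \<le> \<epsilon>"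
proof -
  define r where "r = (1 + \<rho>) / 2"
  have r: "\<rho> < r" "r < 1" using \<rho> by (auto simp: r_def)
  define \<theta> where "\<theta> = \<rho> / r"
  have \<theta>: "0 < \<theta>" "\<theta> < 1" using \<rho> r by (auto simp: \<theta>_def)
  define \<eta> where "\<eta> R = (real R + 1) * (\<theta> ^ R / (1 - \<theta>))" for R
  have \<eta>0: "0 \<le> \<eta> R" for R using \<theta> by (simp add: \<eta>_def)
  \<comment> \<open>Writing \<open>\<theta>\<close> as a square turns
    \<open>(R + 1)\<^sup>2 * \<theta> ^ R\<close> into the square of \<open>(R + 1) * s ^ R\<close>,
    which tends to zero.\<close>
  define s where "s = sqrt \<theta>"
  have s: "0 < s" "s < 1" using \<theta> by (auto simp: s_def)
  have "(\<lambda>n. real n * s ^ n + s ^ n) \<longlonglongrightarrow> 0 + 0"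
    using s by (intro tendsto_add powser_times_n_limit_0 LIMSEQ_realpow_zero) auto
  from tendsto_divide[OF tendsto_power[OF this, of 2] tendsto_const, of "1 - \<theta>"]
  have "(\<lambda>n. (real n * s ^ n + s ^ n)\<^sup>2 / (1 - \<theta>)) \<longlonglongrightarrow> (0 + 0)\<^sup>2 / (1 - \<theta>)"
    using \<theta> by simp
  moreover have "(real n * s ^ n + s ^ n)\<^sup>2 / (1 - \<theta>) = (real n + 1) * \<eta> n" for n
  proof -
    have "(real n * s ^ n + s ^ n)\<^sup>2 = ((real n + 1) * s ^ n)\<^sup>2" by (simp add: algebra_simps)
    also have "\<dots> = (real n + 1)\<^sup>2 * (s\<^sup>2) ^ n" by (simp add: power_mult_distrib power_mult[symmetric] mult.commute)
    also have "s\<^sup>2 = \<theta>" using \<theta> by (simp add: s_def)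
    finally show ?thesis by (simp add: \<eta>_def power2_eq_square mult.assoc)
  qed
  ultimately have "(\<lambda>n. (real n + 1) * \<eta> n) \<longlonglongrightarrow> 0" by simp
  from order_tendstoD(2)[OF this \<epsilon>] have "\<forall>\<^sub>F n in sequentially. (real n + 1) * \<eta> n < \<epsilon> \<and> n > 0"
    by (intro eventually_conj) (auto simp: eventually_gt_at_top)
  then obtain R where R: "(real R + 1) * \<eta> R < \<epsilon>" "R > 0" using eventually_happens by force
  define \<omega> where "\<omega> k = cis (2 * pi * real k / real R)" for k
  \<comment> \<open>Two-dimensional discrete Fourier coefficients of the dilated function, obtained
    by expanding the kernels in both variables.\<close>
  define c where "c m k = (\<Sum>p<R. \<Sum>q<R. f (of_real \<rho> * \<omega> p) (of_real \<rho> * \<omega> q) * cnj (\<omega> p) ^ m * cnj (\<omega> q) ^ k) / (of_nat R * of_nat R)" for m k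
  have small: "cmod (of_real \<rho> * t) < 1" if "cmod t \<le> 1" for t
    using \<rho> that by (intro cmod_scale_less)
  have \<omega>1: "cmod (\<omega> k) \<le> 1" for k by (simp add: \<omega>_def)
  have "cmod ((\<Sum>m<R. \<Sum>k<R. c m k * z ^ m * w ^ k) - f (of_real \<rho> * z) (of_real \<rho> * w)) \<le> \<epsilon>"
    if z: "cmod z \<le> 1" and w: "cmod w \<le> 1" for z w
  proof -
    define F where "F p q = f (of_real \<rho> * \<omega> p) (of_real \<rho> * \<omega> q)" for p q
    have "(\<Sum>p<R. (\<Sum>q<R. F p q * dft_kernel R q w) * dft_kernel R p z)
      = (\<Sum>p<R. \<Sum>q<R. \<Sum>m<R. \<Sum>k<R. (F p q * cnj (\<omega> p) ^ m * cnj (\<omega> q) ^ k) / (of_nat R * of_nat R) * z ^ m * w ^ k)"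
    proof (intro sum.cong refl)
      fix p
      have "(\<Sum>q<R. F p q * (B q / r')) * (A / r') = (\<Sum>q<R. F p q / (r' * r') * (A * B q))"
        for A B and r' :: complex
        by (subst sum_distrib_right, rule sum.cong[OF refl]) simp
      from this[of _ "of_nat R"] have "(\<Sum>q<R. F p q * dft_kernel R q w) * dft_kernel R p z = (\<Sum>q<R. F p q / (of_nat R * of_nat R) *
          ((\<Sum>m<R. z ^ m * cnj (\<omega> p) ^ m) * (\<Sum>k<R. w ^ k * cnj (\<omega> q) ^ k)))"
        unfolding dft_kernel_def \<omega>_def[symmetric] .
      also have "\<dots> = (\<Sum>q<R. \<Sum>m<R. \<Sum>k<R. (F p q * cnj (\<omega> p) ^ m * cnj (\<omega> q) ^ k) / (of_nat R * of_nat R) * z ^ m * w ^ k)"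
        unfolding sum_product by (simp add: sum_distrib_left mult_ac)
      finally show "(\<Sum>q<R. F p q * dft_kernel R q w) * dft_kernel R p z
        = (\<Sum>q<R. \<Sum>m<R. \<Sum>k<R. (F p q * cnj (\<omega> p) ^ m * cnj (\<omega> q) ^ k) / (of_nat R * of_nat R) * z ^ m * w ^ k)" .
    qed
    also have "\<dots> = (\<Sum>p<R. \<Sum>m<R. \<Sum>q<R. \<Sum>k<R. (F p q * cnj (\<omega> p) ^ m * cnj (\<omega> q) ^ k) / (of_nat R * of_nat R) * z ^ m * w ^ k)"
      by (intro sum.cong refl sum.swap)
    also have "\<dots> = (\<Sum>m<R. \<Sum>p<R. \<Sum>q<R. \<Sum>k<R. (F p q * cnj (\<omega> p) ^ m * cnj (\<omega> q) ^ k) / (of_nat R * of_nat R) * z ^ m * w ^ k)"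
      by (rule sum.swap)
    also have "\<dots> = (\<Sum>m<R. \<Sum>p<R. \<Sum>k<R. \<Sum>q<R. (F p q * cnj (\<omega> p) ^ m * cnj (\<omega> q) ^ k) / (of_nat R * of_nat R) * z ^ m * w ^ k)"
      by (intro sum.cong refl sum.swap)
    also have "\<dots> = (\<Sum>m<R. \<Sum>k<R. \<Sum>p<R. \<Sum>q<R. (F p q * cnj (\<omega> p) ^ m * cnj (\<omega> q) ^ k) / (of_nat R * of_nat R) * z ^ m * w ^ k)"
      by (intro sum.cong refl sum.swap)
    also have "\<dots> = (\<Sum>m<R. \<Sum>k<R. c m k * z ^ m * w ^ k)"
      by (simp add: c_def F_def sum_distrib_right sum_divide_distrib)
    finally have poly: "(\<Sum>m<R. \<Sum>k<R. c m k * z ^ m * w ^ k) = (\<Sum>p<R. (\<Sum>q<R. F p q * dft_kernel R q w) * dft_kernel R p z)" ..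
    define d where "d p = (\<Sum>q<R. F p q * dft_kernel R q w) - f (of_real \<rho> * \<omega> p) (of_real \<rho> * w)" for p
    have d: "cmod (d p) \<le> \<eta> R" for p
      unfolding d_def F_def \<eta>_def \<theta>_def \<omega>_def
      using interpolation_error[OF \<rho>(1) r f2[OF small[OF \<omega>1[of p]]] _ R(2) w] bound[OF small[OF \<omega>1[of p]]]
      by (simp add: \<omega>_def)
    have d': "cmod ((\<Sum>p<R. f (of_real \<rho> * \<omega> p) (of_real \<rho> * w) * dft_kernel R p z) - f (of_real \<rho> * z) (of_real \<rho> * w)) \<le> \<eta> R"
      unfolding \<eta>_def \<theta>_def \<omega>_def
      by (rule interpolation_error[OF \<rho>(1) r f1[OF small[OF w]] _ R(2) z]) (rule bound[OF _ small[OF w]])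
    have "(\<Sum>m<R. \<Sum>k<R. c m k * z ^ m * w ^ k) - f (of_real \<rho> * z) (of_real \<rho> * w)
      = (\<Sum>p<R. d p * dft_kernel R p z) + ((\<Sum>p<R. f (of_real \<rho> * \<omega> p) (of_real \<rho> * w) * dft_kernel R p z) - f (of_real \<rho> * z) (of_real \<rho> * w))"
      unfolding poly by (simp add: d_def left_diff_distrib sum_subtractf)
    also have "cmod \<dots> \<le> cmod (\<Sum>p<R. d p * dft_kernel R p z) + \<eta> R"
      using d' by (intro norm_triangle_le add_left_mono)
    also have "cmod (\<Sum>p<R. d p * dft_kernel R p z) \<le> (\<Sum>p<R. \<eta> R * 1)"
      by (rule sum_norm_le, unfold norm_mult, rule mult_mono) (use d \<eta>0 cmod_dft_kernel_le[OF z] in auto)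
    also have "(\<Sum>p<R. \<eta> R * 1) + \<eta> R = (real R + 1) * \<eta> R" by (simp add: algebra_simps)
    finally show ?thesis using R(1) by simp
  qed
  then show ?thesis by blast
qed

text \<open>An approximant within \<open>\<epsilon> n\<close> of the dilate by
  \<open>\<rho> n\<close> has modulus at most \<open>1 + \<epsilon> n\<close> on the torus; division
  by this number gives a polynomial covered by \<open>ando_kernel_inequality\<close>. Continuity at
  the given points undoes the dilation in the limit.\<close>

theorem ando_kernel_inequality_holomorphic:
  fixes I :: "'i set" and f :: "complex \<Rightarrow> complex \<Rightarrow> complex"
  assumes I: "finite I" and a: "\<And>i. i \<in> I \<Longrightarrow> cmod (a i) < 1" and b: "\<And>i. i \<in> I \<Longrightarrow> cmod (b i) < 1"
    and psd_a: "psd I (\<lambda>i j. (1 - cnj (a i) * a j) * l i j)"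
    and psd_b: "psd I (\<lambda>i j. (1 - cnj (b i) * b j) * l i j)"
    and f1: "\<And>w. cmod w < 1 \<Longrightarrow> (\<lambda>z. f z w) holomorphic_on ball 0 1"
    and f2: "\<And>z. cmod z < 1 \<Longrightarrow> (\<lambda>w. f z w) holomorphic_on ball 0 1"
    and bound: "\<And>z w. \<lbrakk>cmod z < 1; cmod w < 1\<rbrakk> \<Longrightarrow> cmod (f z w) \<le> 1"
    and cont: "\<And>i. i \<in> I \<Longrightarrow> isCont (\<lambda>p. f (fst p) (snd p)) (a i, b i)"
  shows "0 \<le> Re (\<Sum>i\<in>I. \<Sum>j\<in>I. (1 - cnj (f (a i) (b i)) * f (a j) (b j)) * l i j)"
proof -
  define \<rho> where "\<rho> n = 1 - 1 / (real n + 2)" for n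
  define \<epsilon> where "\<epsilon> n = 1 / (real n + 1)" for n
  have \<rho>: "0 < \<rho> n" "\<rho> n < 1" for n by (auto simp: \<rho>_def)
  have \<epsilon>: "\<epsilon> n > 0" for n by (simp add: \<epsilon>_def)
  define Q where "Q n D c \<longleftrightarrow> (\<forall>z w. cmod z \<le> 1 \<longrightarrow> cmod w \<le> 1 \<longrightarrow>
    cmod ((\<Sum>m<D. \<Sum>k<D. c m k * z ^ m * w ^ k) - f (of_real (\<rho> n) * z) (of_real (\<rho> n) * w)) \<le> \<epsilon> n)"
    for n and D :: nat and c
  have "\<exists>D c. Q n D c" for n
    unfolding Q_def by (rule polynomial_approximation[OF \<rho> \<epsilon> f1 f2 bound])
  then obtain D c where "\<And>n. Q n (D n) (c n)" by metis
  then have Dc: "cmod ((\<Sum>m<D n. \<Sum>k<D n. c n m k * z ^ m * w ^ k) - f (of_real (\<rho> n) * z) (of_real (\<rho> n) * w)) \<le> \<epsilon> n"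
    if "cmod z \<le> 1" "cmod w \<le> 1" for n z w
    using that unfolding Q_def by blast
  define p where "p n z w = (\<Sum>m<D n. \<Sum>k<D n. c n m k * z ^ m * w ^ k)" for n z w
  define g where "g n i = p n (a i) (b i) / of_real (1 + \<epsilon> n)" for n i
  have lim: "(\<lambda>n. g n i) \<longlonglongrightarrow> f (a i) (b i)" if i: "i \<in> I" for i
  proof -
    have \<rho>1: "(\<lambda>n. complex_of_real (\<rho> n)) \<longlonglongrightarrow> of_real 1" unfolding \<rho>_def by (rule tendsto_of_real) real_asymp
    have \<epsilon>0: "\<epsilon> \<longlonglongrightarrow> 0" unfolding \<epsilon>_def by real_asymp
    have "(\<lambda>n. (of_real (\<rho> n) * a i, of_real (\<rho> n) * b i)) \<longlonglongrightarrow> (of_real 1 * a i, of_real 1 * b i)"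
      by (intro tendsto_intros \<rho>1)
    then have "(\<lambda>n. (of_real (\<rho> n) * a i, of_real (\<rho> n) * b i)) \<longlonglongrightarrow> (a i, b i)" by simp
    from isCont_tendsto_compose[OF cont[OF i] this]
    have fl: "(\<lambda>n. f (of_real (\<rho> n) * a i) (of_real (\<rho> n) * b i)) \<longlonglongrightarrow> f (a i) (b i)" by simp
    have "(\<lambda>n. p n (a i) (b i) - f (of_real (\<rho> n) * a i) (of_real (\<rho> n) * b i)) \<longlonglongrightarrow> 0"
      by (rule Lim_null_comparison[OF _ \<epsilon>0]) (use Dc[of "a i" "b i"] a[OF i] b[OF i] in \<open>simp add: p_def\<close>)
    from tendsto_add[OF this fl] have "(\<lambda>n. p n (a i) (b i)) \<longlonglongrightarrow> f (a i) (b i)" by simp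
    moreover have "(\<lambda>n. complex_of_real (1 + \<epsilon> n)) \<longlonglongrightarrow> of_real (1 + 0)"
      by (intro tendsto_of_real tendsto_add tendsto_const \<epsilon>0)
    ultimately have "(\<lambda>n. g n i) \<longlonglongrightarrow> f (a i) (b i) / of_real (1 + 0)"
      unfolding g_def by (intro tendsto_divide) auto
    then show ?thesis by simp
  qed
  have "0 \<le> Re (\<Sum>i\<in>I. \<Sum>j\<in>I. (1 - cnj (g n i) * g n j) * l i j)" for n
  proof -
    define c' where "c' m k = c n m k / of_real (1 + \<epsilon> n)" for m k
    have p': "(\<Sum>m<D n. \<Sum>k<D n. c' m k * z ^ m * w ^ k) = p n z w / of_real (1 + \<epsilon> n)" for z w
      by (simp add: c'_def p_def sum_divide_distrib)
    have "cmod (\<Sum>m<D n. \<Sum>k<D n. c' m k * z ^ m * w ^ k) \<le> 1" if "cmod z = 1" "cmod w = 1" for z w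
    proof -
      have "cmod (of_real (\<rho> n) * z) < 1" "cmod (of_real (\<rho> n) * w) < 1"
        using that \<rho>[of n] by (simp_all add: norm_mult)
      from bound[OF this] Dc[of z w n] that
      have "cmod (p n z w) \<le> 1 + \<epsilon> n"
        using norm_triangle_sub[of "p n z w" "f (of_real (\<rho> n) * z) (of_real (\<rho> n) * w)"] by (simp add: p_def)
      moreover have "cmod (complex_of_real (1 + \<epsilon> n)) = 1 + \<epsilon> n"
        unfolding norm_of_real using \<epsilon>[of n] by simp
      ultimately show ?thesis using \<epsilon>[of n] by (simp only: p' norm_divide) (simp add: divide_le_eq)
    qed
    from ando_kernel_inequality[where c = c' and D = "D n" and l = l, OF I a b psd_a psd_b this]
    show ?thesis unfolding p' g_def .
  qed
  moreover have "(\<lambda>n. Re (\<Sum>i\<in>I. \<Sum>j\<in>I. (1 - cnj (g n i) * g n j) * l i j))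
    \<longlonglongrightarrow> Re (\<Sum>i\<in>I. \<Sum>j\<in>I. (1 - cnj (f (a i) (b i)) * f (a j) (b j)) * l i j)"
    by (intro tendsto_intros lim)
  ultimately show ?thesis by (intro LIMSEQ_le_const) auto
qed

section \<open>The Agler decomposition on a finite set of points of the bidisc\<close>

text \<open>Tychonoff's theorem. It permits minimisation over kernels represented as plain
  functions, with the coordinates outside the index set pinned to zero.\<close>

lemma compact_box:
  fixes S :: "'k \<Rightarrow> complex set"
  assumes "\<And>t. compact (S t)"
  shows "compact {x. \<forall>t. x t \<in> S t}"
proof -
  have "compactin (product_topology (\<lambda>i. euclidean) UNIV) (PiE UNIV S)"
    using assms by (simp add: compactin_PiE)
  then show ?thesis by (simp add: euclidean_product_topology PiE_UNIV_domain Pi_def)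
qed

lemma closed_psd: "closed {x :: bool \<times> 'i \<times> 'i \<Rightarrow> complex. psd I (\<lambda>i j. x (e, i, j))}"
proof -
  have coord: "continuous_on UNIV (\<lambda>x :: bool \<times> 'i \<times> 'i \<Rightarrow> complex. x t)" for t
    by (rule continuous_on_product_coordinates)
  have "{x :: bool \<times> 'i \<times> 'i \<Rightarrow> complex. psd I (\<lambda>i j. x (e, i, j))} =
    (\<Inter>i\<in>I. \<Inter>j\<in>I. {x. x (e, j, i) = cnj (x (e, i, j))}) \<inter>
    (\<Inter>c. {x. 0 \<le> Re (\<Sum>i\<in>I. \<Sum>j\<in>I. cnj (c i) * c j * x (e, i, j))})"
    unfolding psd_def by blast
  also have "closed \<dots>"
    by (intro closed_Int closed_INT ballI closed_Collect_eq closed_Collect_le continuous_intros coord)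
  finally show ?thesis .
qed

section \<open>The cone of positive semidefinite kernels\<close>

lemma psd_cong:
  assumes K: "psd I K" and eq: "\<And>i j. \<lbrakk>i \<in> I; j \<in> I\<rbrakk> \<Longrightarrow> K i j = L i j"
  shows "psd I L"
  unfolding psd_def
proof (intro conjI ballI allI)
  show "L j i = cnj (L i j)" if "i \<in> I" "j \<in> I" for i j
    using psd_hermitian[OF K that] eq[OF that] eq[OF that(2,1)] by metis
  show "0 \<le> Re (\<Sum>i\<in>I. \<Sum>j\<in>I. cnj (c i) * c j * L i j)" for c
    using psd_nonneg[OF K, of c] eq by (simp cong: sum.cong)
qed

lemma psd_add:
  assumes K: "psd I K" and L: "psd I L"
  shows "psd I (\<lambda>i j. K i j + L i j)"
  unfolding psd_def
proof (intro conjI ballI allI)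
  show "K j i + L j i = cnj (K i j + L i j)" if "i \<in> I" "j \<in> I" for i j
    using psd_hermitian[OF K that] psd_hermitian[OF L that] by simp
  show "0 \<le> Re (\<Sum>i\<in>I. \<Sum>j\<in>I. cnj (c i) * c j * (K i j + L i j))" for c
    using psd_nonneg[OF K, of c] psd_nonneg[OF L, of c] by (simp add: distrib_left sum.distrib)
qed

lemma psd_scale:
  assumes "psd I K" "0 \<le> t"
  shows "psd I (\<lambda>i j. of_real t * K i j)"
  unfolding psd_def
proof (intro conjI ballI allI)
  show "of_real t * K j i = cnj (of_real t * K i j)" if "i \<in> I" "j \<in> I" for i j
    using psd_hermitian[OF assms(1) that] by simp
  fix c
  have "(\<Sum>i\<in>I. \<Sum>j\<in>I. cnj (c i) * c j * (of_real t * K i j)) = of_real t * (\<Sum>i\<in>I. \<Sum>j\<in>I. cnj (c i) * c j * K i j)"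
    by (simp add: sum_distrib_left mult_ac)
  then show "0 \<le> Re (\<Sum>i\<in>I. \<Sum>j\<in>I. cnj (c i) * c j * (of_real t * K i j))"
    using psd_nonneg[OF assms(1), of c] assms(2) by simp
qed

lemma psd_zero: "psd I (\<lambda>i j. 0)"
  by (simp add: psd_def)

lemma psd_rank_one: "psd I (\<lambda>i j. cnj (c i) * c j)"
  unfolding psd_def
proof (intro conjI ballI allI)
  fix d
  define s where "s = (\<Sum>i\<in>I. d i * c i)"
  have "(\<Sum>i\<in>I. \<Sum>j\<in>I. cnj (d i) * d j * (cnj (c i) * c j)) = cnj s * s"
    unfolding s_def cnj_sum sum_product by (intro sum.cong refl) (simp add: mult_ac)
  also have "\<dots> = of_real ((cmod s)\<^sup>2)" by (simp only: complex_norm_square mult.commute)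
  finally show "0 \<le> Re (\<Sum>i\<in>I. \<Sum>j\<in>I. cnj (d i) * d j * (cnj (c i) * c j))" by simp
qed simp

text \<open>The one-sided derivative at zero of the squared distance is minus twice the left-hand
  side. If that side were a positive \<open>s\<close>, the chosen \<open>t\<close> would keep the
  quadratic term \<open>t * N\<close> below \<open>s\<close>.\<close>

lemma first_variation:
  fixes L H :: "'i \<Rightarrow> 'i \<Rightarrow> complex"
  assumes t0: "t0 > 0"
    and min: "\<And>t. \<lbrakk>0 < t; t \<le> t0\<rbrakk> \<Longrightarrow> (\<Sum>i\<in>I. \<Sum>j\<in>I. (cmod (L i j))\<^sup>2) \<le> (\<Sum>i\<in>I. \<Sum>j\<in>I. (cmod (L i j - of_real t * H i j))\<^sup>2)"
  shows "Re (\<Sum>i\<in>I. \<Sum>j\<in>I. cnj (L i j) * H i j) \<le> 0"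
proof (rule ccontr)
  define s where "s = Re (\<Sum>i\<in>I. \<Sum>j\<in>I. cnj (L i j) * H i j)"
  define N where "N = (\<Sum>i\<in>I. \<Sum>j\<in>I. (cmod (H i j))\<^sup>2)"
  assume "\<not> Re (\<Sum>i\<in>I. \<Sum>j\<in>I. cnj (L i j) * H i j) \<le> 0"
  then have s: "s > 0" by (simp add: s_def)
  have N: "N \<ge> 0" by (simp add: N_def sum_nonneg)
  define t where "t = min t0 (s / (N + 1))"
  have t: "0 < t" "t \<le> t0" using t0 s N by (auto simp: t_def)
  have "(cmod (x - of_real t * y))\<^sup>2 = (cmod x)\<^sup>2 - 2 * t * Re (cnj x * y) + t\<^sup>2 * (cmod y)\<^sup>2" for x y
    unfolding cmod_power2 by (simp add: power2_eq_square algebra_simps)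
  then have "(\<Sum>i\<in>I. \<Sum>j\<in>I. (cmod (L i j - of_real t * H i j))\<^sup>2)
    = (\<Sum>i\<in>I. \<Sum>j\<in>I. (cmod (L i j))\<^sup>2) - 2 * t * s + t\<^sup>2 * N"
    by (simp add: s_def N_def sum.distrib sum_subtractf sum_distrib_left del: times_complex.sel)
  then have "t * (2 * s) \<le> t * (t * N)" using min[OF t] by (simp add: power2_eq_square)
  then have "2 * s \<le> t * N" using t by simp
  also have "\<dots> \<le> s / (N + 1) * N" using N by (intro mult_right_mono) (auto simp: t_def)
  also have "\<dots> \<le> s" using s N by (simp add: divide_le_eq)
  finally show False using s by simp
qed

text \<open>A minimiser of the distance replaces a separating functional and a proof that the cone
  is closed. Adding a small rank-one kernel to one slot shows that minus the conjugate of the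
  residual \<open>L\<close> is admissible in \<open>dual\<close>. Shrinking the pair towards zero
  bounds the square of \<open>L\<close> by the real inner product of \<open>L\<close> with
  \<open>A\<close>, and \<open>dual\<close> makes the latter nonpositive.\<close>

theorem cone_duality:
  fixes I :: "'i set" and a b :: "'i \<Rightarrow> complex" and A :: "'i \<Rightarrow> 'i \<Rightarrow> complex"
  assumes I: "finite I" and a: "\<And>i. i \<in> I \<Longrightarrow> cmod (a i) < 1" and b: "\<And>i. i \<in> I \<Longrightarrow> cmod (b i) < 1"
    and A: "\<And>i j. \<lbrakk>i \<in> I; j \<in> I\<rbrakk> \<Longrightarrow> A j i = cnj (A i j)"
    and dual: "\<And>l. \<lbrakk>psd I (\<lambda>i j. (1 - cnj (a i) * a j) * l i j); psd I (\<lambda>i j. (1 - cnj (b i) * b j) * l i j)\<rbrakk>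
      \<Longrightarrow> 0 \<le> Re (\<Sum>i\<in>I. \<Sum>j\<in>I. A i j * l i j)"
  obtains \<Gamma> \<Delta> where "psd I \<Gamma>" "psd I \<Delta>"
    "\<And>i j. \<lbrakk>i \<in> I; j \<in> I\<rbrakk> \<Longrightarrow> A i j = (1 - cnj (a i) * a j) * \<Gamma> i j + (1 - cnj (b i) * b j) * \<Delta> i j"
proof -
  define p where "p e i = (if e then a i else b i)" for e i
  define m where "m e i j = 1 - cnj (p e i) * p e j" for e i j
  have m_herm: "m e j i = cnj (m e i j)" for e i j by (simp add: m_def mult.commute)
  have p1: "cmod (p e i) < 1" if "i \<in> I" for e i using a[OF that] b[OF that] by (simp add: p_def)
  \<comment> \<open>The inserted 1 keeps the minimum defined for empty \<open>I\<close>.\<close>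
  define \<delta> where "\<delta> = Min (insert 1 ((\<lambda>(e, i). 1 - (cmod (p e i))\<^sup>2) ` (UNIV \<times> I)))"
  have fin: "finite (insert 1 ((\<lambda>(e, i). 1 - (cmod (p e i))\<^sup>2) ` ((UNIV :: bool set) \<times> I)))" using I by simp
  have \<delta>: "\<delta> > 0"
    unfolding \<delta>_def using p1 by (subst Min_gr_iff[OF fin]) (auto simp: power_less_one_iff)
  have \<delta>_le: "\<delta> \<le> 1 - (cmod (p e i))\<^sup>2" if "i \<in> I" for e i
    unfolding \<delta>_def using that by (intro Min_le[OF fin]) force
  define F where "F x = (\<Sum>i\<in>I. \<Sum>j\<in>I. (cmod (A i j - (m True i j * x (True, i, j) + m False i j * x (False, i, j))))\<^sup>2)"
    for x :: "bool \<times> 'i \<times> 'i \<Rightarrow> complex"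
  define \<alpha> where "\<alpha> = sqrt (F (\<lambda>_. 0))"
  have F0: "F x \<ge> 0" for x by (simp add: F_def sum_nonneg)
  have \<alpha>: "\<alpha> \<ge> 0" "\<alpha>\<^sup>2 = F (\<lambda>_. 0)" using F0 by (simp_all add: \<alpha>_def)
  \<comment> \<open>The entries of a minimiser are bounded by \<open>B - 1\<close>: on the diagonal
    both contributions are nonnegative and sum to at most \<open>2 * \<alpha>\<close>, and
    Cauchy-Schwarz covers the rest. The spare 1 leaves room for perturbations, so the box is never
    an active constraint.\<close>
  define B where "B = 2 * \<alpha> / \<delta> + 1"
  have B: "B > 0" using \<alpha> \<delta> by (auto simp: B_def intro: add_nonneg_pos)
  define X' where "X' = {x :: bool \<times> 'i \<times> 'i \<Rightarrow> complex. \<forall>t. x t \<in> (if t \<in> UNIV \<times> I \<times> I then cball 0 B else {0})}"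
  define C where "C = X' \<inter> {x. psd I (\<lambda>i j. x (True, i, j))} \<inter> {x. psd I (\<lambda>i j. x (False, i, j))}"
  have "compact C" unfolding C_def X'_def
    by (intro compact_Int_closed closed_psd compact_box) auto
  moreover have "(\<lambda>_. 0) \<in> C" using B psd_zero by (auto simp: C_def X'_def)
  moreover have "continuous_on C F"
    unfolding F_def
    by (intro continuous_intros continuous_on_subset[OF continuous_on_product_coordinates]) auto
  ultimately obtain x where x: "x \<in> C" and x_min: "\<And>y. y \<in> C \<Longrightarrow> F x \<le> F y"
    using continuous_attains_inf[of C F] by blast
  have K: "psd I (\<lambda>i j. x (e, i, j))" for e using x by (cases e) (auto simp: C_def)
  have xz: "x (e, i, j) = 0" if "\<not> (i \<in> I \<and> j \<in> I)" for e i j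
  proof -
    have "x (e, i, j) \<in> (if (e, i, j) \<in> UNIV \<times> I \<times> I then cball 0 B else {0})"
      using x unfolding C_def X'_def by blast
    then show ?thesis using that by auto
  qed
  define L where "L i j = A i j - (m True i j * x (True, i, j) + m False i j * x (False, i, j))" for i j
  have L_herm: "L j i = cnj (L i j)" if "i \<in> I" "j \<in> I" for i j
    using A[OF that] psd_hermitian[OF K that, of True] psd_hermitian[OF K that, of False] m_herm[of _ j i]
    by (simp add: L_def)
  have Fx: "F x = (\<Sum>i\<in>I. \<Sum>j\<in>I. (cmod (L i j))\<^sup>2)" by (simp add: F_def L_def)
  have entry: "cmod (f i j) \<le> \<alpha>"
    if "(\<Sum>i\<in>I. \<Sum>j\<in>I. (cmod (f i j))\<^sup>2) \<le> \<alpha>\<^sup>2" "i \<in> I" "j \<in> I" for f :: "'i \<Rightarrow> 'i \<Rightarrow> complex" and i j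
  proof (rule power2_le_imp_le)
    have "(cmod (f i j))\<^sup>2 \<le> (\<Sum>j\<in>I. (cmod (f i j))\<^sup>2)" using I that by (intro member_le_sum) auto
    also have "\<dots> \<le> (\<Sum>i\<in>I. \<Sum>j\<in>I. (cmod (f i j))\<^sup>2)"
      using I that by (intro member_le_sum[of i I "\<lambda>i. \<Sum>j\<in>I. (cmod (f i j))\<^sup>2"]) (auto intro: sum_nonneg)
    finally show "(cmod (f i j))\<^sup>2 \<le> \<alpha>\<^sup>2" using that(1) by simp
  qed (rule \<alpha>)
  have "F x \<le> \<alpha>\<^sup>2" unfolding \<alpha>(2) by (rule x_min) fact
  then have L_le: "cmod (L i j) \<le> \<alpha>" if "i \<in> I" "j \<in> I" for i j using entry[of L] that Fx by simp
  have A_le: "cmod (A i j) \<le> \<alpha>" if "i \<in> I" "j \<in> I" for i j using entry[of A] that \<alpha>(2) by (simp add: F_def)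
  have diag: "Re (x (e, i, i)) \<le> 2 * \<alpha> / \<delta>" if i: "i \<in> I" for e i
  proof -
    have pos: "0 \<le> Re (x (e, i, i))" for e using psd_diag(1)[OF K I i] .
    have real: "x (e, i, i) = of_real (Re (x (e, i, i)))" for e using psd_diag(2)[OF K I i] .
    have mr: "m e i i = of_real (1 - (cmod (p e i))\<^sup>2)" for e
      unfolding m_def by (simp add: complex_norm_square[unfolded of_real_power] mult.commute)
    have t: "\<delta> * Re (x (e, i, i)) \<le> Re (m e i i * x (e, i, i))" for e
      unfolding mr using mult_right_mono[OF \<delta>_le[OF i, of e] pos[of e]] by simp
    have t0: "0 \<le> Re (m e i i * x (e, i, i))" for e
      using order_trans[OF mult_nonneg_nonneg[OF less_imp_le[OF \<delta>] pos[of e]] t[of e]] .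
    have "Re (m True i i * x (True, i, i)) + Re (m False i i * x (False, i, i)) = Re (A i i - L i i)"
      by (simp add: L_def)
    also have "\<dots> \<le> cmod (A i i - L i i)" by (rule complex_Re_le_cmod)
    also have "\<dots> \<le> cmod (A i i) + cmod (L i i)" by (rule norm_triangle_ineq4)
    also have "\<dots> \<le> 2 * \<alpha>" using A_le[OF i i] L_le[OF i i] by simp
    finally have "Re (m e i i * x (e, i, i)) \<le> 2 * \<alpha>" using t0[of True] t0[of False] by (cases e) auto
    then have "\<delta> * Re (x (e, i, i)) \<le> 2 * \<alpha>" using t[of e] by linarith
    then show ?thesis using \<delta> by (simp add: le_divide_eq mult.commute)
  qed
  have x_le: "cmod (x (e, i, j)) \<le> 2 * \<alpha> / \<delta>" if "i \<in> I" "j \<in> I" for e i j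
  proof (rule power2_le_imp_le)
    have "(cmod (x (e, i, j)))\<^sup>2 \<le> Re (x (e, i, i)) * Re (x (e, j, j))"
      by (rule psd_cauchy_schwarz[OF K I that])
    also have "\<dots> \<le> (2 * \<alpha> / \<delta>) * (2 * \<alpha> / \<delta>)"
      using diag that \<alpha> \<delta> psd_diag(1)[OF K I] by (intro mult_mono) auto
    finally show "(cmod (x (e, i, j)))\<^sup>2 \<le> (2 * \<alpha> / \<delta>)\<^sup>2" by (simp add: power2_eq_square)
  qed (use \<alpha> \<delta> in simp)
  have feasible: "y \<in> C" if "\<And>e i j. \<lbrakk>i \<in> I; j \<in> I\<rbrakk> \<Longrightarrow> cmod (y (e, i, j)) \<le> B"
    "\<And>e i j. \<not> (i \<in> I \<and> j \<in> I) \<Longrightarrow> y (e, i, j) = 0" "\<And>e. psd I (\<lambda>i j. y (e, i, j))" for y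
    using that by (auto simp: C_def X'_def)
  define l where "l i j = - cnj (L i j)" for i j
  have psd_l: "psd I (\<lambda>i j. m e i j * l i j)" for e
    unfolding psd_def
  proof (intro conjI ballI allI)
    show "m e j i * l j i = cnj (m e i j * l i j)" if "i \<in> I" "j \<in> I" for i j
      using m_herm[of e j i] L_herm[OF that] by (simp add: l_def)
    fix c :: "'i \<Rightarrow> complex"
    define S where "S = (\<Sum>i\<in>I. cmod (c i))"
    have S: "0 \<le> S" by (simp add: S_def sum_nonneg)
    have cS: "cmod (c i) \<le> S" if "i \<in> I" for i
      unfolding S_def using I that by (intro member_le_sum) auto
    \<comment> \<open>For \<open>t\<close> up to \<open>t0\<close> the added kernel has entries of
      modulus at most 1, the spare room in the box.\<close>
    define t0 where "t0 = 1 / (S\<^sup>2 + 1)"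
    have t0: "t0 > 0" by (auto simp: t0_def intro!: divide_pos_pos add_nonneg_pos)
    have "Re (\<Sum>i\<in>I. \<Sum>j\<in>I. cnj (L i j) * (m e i j * (cnj (c i) * c j))) \<le> 0"
    proof (rule first_variation[OF t0])
      fix t :: real assume t: "0 < t" "t \<le> t0"
      define y where "y = (\<lambda>(e', i, j). x (e', i, j) + (if e' = e \<and> i \<in> I \<and> j \<in> I then of_real t * (cnj (c i) * c j) else 0))"
      have "y \<in> C"
      proof (rule feasible)
        fix e' i j
        show "y (e', i, j) = 0" if "\<not> (i \<in> I \<and> j \<in> I)" using that xz[OF that, of e'] by (auto simp: y_def)
        show "psd I (\<lambda>i j. y (e', i, j))"
        proof (cases "e' = e")
          case True
          have "psd I (\<lambda>i j. x (e, i, j) + of_real t * (cnj (c i) * c j))"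
            using t by (intro psd_add K psd_scale psd_rank_one) auto
          then show ?thesis by (rule psd_cong) (simp add: True y_def)
        qed (use K in \<open>simp add: y_def\<close>)
        assume ij: "i \<in> I" "j \<in> I"
        have "cmod (c i) * cmod (c j) \<le> S * S" using cS ij S by (intro mult_mono) auto
        then have "t * (cmod (c i) * cmod (c j)) \<le> t0 * S\<^sup>2"
          using t by (intro mult_mono) (auto simp: power2_eq_square)
        also have "\<dots> \<le> 1" unfolding t0_def by (simp add: pos_divide_le_eq add_nonneg_pos)
        finally have "cmod (of_real t * (cnj (c i) * c j)) \<le> 1" using t by (simp add: norm_mult)
        then have "cmod (if e' = e \<and> i \<in> I \<and> j \<in> I then of_real t * (cnj (c i) * c j) else 0) \<le> 1" by simp
        then show "cmod (y (e', i, j)) \<le> B"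
          unfolding y_def B_def prod.case using x_le[OF ij, of e'] by (intro norm_triangle_le) linarith
      qed
      then have "F x \<le> F y" by (rule x_min)
      also have "F y = (\<Sum>i\<in>I. \<Sum>j\<in>I. (cmod (L i j - of_real t * (m e i j * (cnj (c i) * c j))))\<^sup>2)"
        unfolding F_def
        by (intro sum.cong refl arg_cong[where f = "\<lambda>z. (cmod z)\<^sup>2"]) (cases e; simp add: y_def L_def algebra_simps)
      finally show "(\<Sum>i\<in>I. \<Sum>j\<in>I. (cmod (L i j))\<^sup>2)
        \<le> (\<Sum>i\<in>I. \<Sum>j\<in>I. (cmod (L i j - of_real t * (m e i j * (cnj (c i) * c j))))\<^sup>2)"
        by (simp add: Fx)
    qed
    also have "Re (\<Sum>i\<in>I. \<Sum>j\<in>I. cnj (L i j) * (m e i j * (cnj (c i) * c j)))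
      = - Re (\<Sum>i\<in>I. \<Sum>j\<in>I. cnj (c i) * c j * (m e i j * l i j))"
      unfolding uminus_complex.sel[symmetric] sum_negf[symmetric] by (simp add: l_def mult_ac)
    finally show "0 \<le> Re (\<Sum>i\<in>I. \<Sum>j\<in>I. cnj (c i) * c j * (m e i j * l i j))" by simp
  qed
  have "0 \<le> Re (\<Sum>i\<in>I. \<Sum>j\<in>I. A i j * l i j)"
    using psd_l[of True] psd_l[of False] by (intro dual) (simp_all add: m_def p_def)
  then have LA: "Re (\<Sum>i\<in>I. \<Sum>j\<in>I. cnj (L i j) * A i j) \<le> 0"
    by (simp add: l_def sum_negf mult.commute)
  \<comment> \<open>Replacing \<open>x\<close> by \<open>(1 - t)\<close> times \<open>x\<close>
    changes the residual to \<open>L - t * (L - A)\<close>.\<close>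
  have "Re (\<Sum>i\<in>I. \<Sum>j\<in>I. cnj (L i j) * (L i j - A i j)) \<le> 0"
  proof (rule first_variation[of 1])
    fix t :: real assume t: "0 < t" "t \<le> 1"
    define y where "y q = of_real (1 - t) * x q" for q
    have "y \<in> C"
    proof (rule feasible)
      show "y (e, i, j) = 0" if "\<not> (i \<in> I \<and> j \<in> I)" for e i j using xz[OF that] by (simp add: y_def)
      show "psd I (\<lambda>i j. y (e, i, j))" for e unfolding y_def using t by (intro psd_scale K) auto
      show "cmod (y (e, i, j)) \<le> B" if "i \<in> I" "j \<in> I" for e i j
      proof -
        have "cmod (y (e, i, j)) = (1 - t) * cmod (x (e, i, j))"
          unfolding y_def norm_mult norm_of_real using t by simp
        also have "\<dots> \<le> 1 * cmod (x (e, i, j))" using t by (intro mult_right_mono) auto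
        also have "\<dots> \<le> B" using x_le[OF that, of e] by (simp add: B_def)
        finally show ?thesis .
      qed
    qed
    then have "F x \<le> F y" by (rule x_min)
    also have "F y = (\<Sum>i\<in>I. \<Sum>j\<in>I. (cmod (L i j - of_real t * (L i j - A i j)))\<^sup>2)"
      unfolding F_def
      by (intro sum.cong refl arg_cong[where f = "\<lambda>z. (cmod z)\<^sup>2"]) (simp add: y_def L_def algebra_simps)
    finally show "(\<Sum>i\<in>I. \<Sum>j\<in>I. (cmod (L i j))\<^sup>2) \<le> (\<Sum>i\<in>I. \<Sum>j\<in>I. (cmod (L i j - of_real t * (L i j - A i j)))\<^sup>2)"
      by (simp add: Fx)
  qed simp
  moreover have "(\<Sum>i\<in>I. \<Sum>j\<in>I. cnj (L i j) * (L i j - A i j))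
    = of_real (F x) - (\<Sum>i\<in>I. \<Sum>j\<in>I. cnj (L i j) * A i j)"
    unfolding Fx of_real_sum complex_norm_square by (simp add: right_diff_distrib sum_subtractf mult.commute)
  ultimately have "F x \<le> 0" using LA by simp
  then have "F x = 0" using F0[of x] by simp
  then have "\<forall>i\<in>I. (\<Sum>j\<in>I. (cmod (L i j))\<^sup>2) = 0"
    unfolding Fx using I by (subst (asm) sum_nonneg_eq_0_iff) (auto intro: sum_nonneg)
  then have "L i j = 0" if "i \<in> I" "j \<in> I" for i j
    using that I by (auto simp: sum_nonneg_eq_0_iff)
  then show thesis using that[OF K[of True] K[of False]] by (simp add: L_def m_def p_def)
qed

section \<open>The model of an interpolating function\<close>

lemma holomorphic_on_slice:
  assumes \<phi>: "analytic2_on \<phi> symm_bidisc" and w: "cmod w < 1"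
  shows "(\<lambda>z. \<phi> (z + w, z * w)) holomorphic_on ball 0 1"
proof (rule holomorphic_onI)
  fix z :: complex assume "z \<in> ball 0 1"
  then have "(z + w, z * w) \<in> symm_bidisc" using w by (auto simp: symm_bidisc_def dist_norm)
  then obtain \<alpha> \<beta> where d: "(\<phi> has_derivative (\<lambda>h. \<alpha> * fst h + \<beta> * snd h)) (at (z + w, z * w))"
    using \<phi> unfolding analytic2_on_def by blast
  have "((\<lambda>z. (z + w, z * w)) has_derivative (\<lambda>h. (h, h * w))) (at z)"
    by (auto intro!: derivative_eq_intros)
  from has_derivative_compose[OF this d]
  have "((\<lambda>z. \<phi> (z + w, z * w)) has_derivative (\<lambda>h. \<alpha> * h + \<beta> * (h * w))) (at z)" by simp
  moreover have "(\<lambda>h. \<alpha> * h + \<beta> * (h * w)) = (*) (\<alpha> + \<beta> * w)" by (auto simp: algebra_simps)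
  ultimately have "((\<lambda>z. \<phi> (z + w, z * w)) has_field_derivative (\<alpha> + \<beta> * w)) (at z)"
    by (simp add: has_field_derivative_def)
  then show "(\<lambda>z. \<phi> (z + w, z * w)) field_differentiable at z within ball 0 1"
    using field_differentiable_at_within field_differentiable_def by blast
qed

lemma isCont_symm:
  assumes \<phi>: "analytic2_on \<phi> symm_bidisc" and z: "cmod z < 1" and w: "cmod w < 1"
  shows "isCont (\<lambda>p. \<phi> (fst p + snd p, fst p * snd p)) (z, w)"
proof -
  have "(z + w, z * w) \<in> symm_bidisc" using z w by (auto simp: symm_bidisc_def)
  then have "isCont \<phi> (z + w, z * w)"
    using \<phi> has_derivative_continuous unfolding analytic2_on_def by blast
  moreover have "isCont (\<lambda>p :: complex \<times> complex. (fst p + snd p, fst p * snd p)) (z, w)"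
    by (intro continuous_intros)
  ultimately show ?thesis
    using isCont_o2[of "(z, w)" "\<lambda>p. (fst p + snd p, fst p * snd p)" \<phi>] by simp
qed

text \<open>
  Both orderings \<open>(z, w)\<close> and \<open>(w, z)\<close> of every pair occur among the points, with \<open>\<sigma>\<close> exchanging
  them. Averaging the Agler decomposition with its image under \<open>\<sigma>\<close> makes it symmetric.
\<close>

lemma symmetric_agler_decomposition:
  fixes I :: "'i set" and a b :: "'i \<Rightarrow> complex"
  assumes I: "finite I" and a: "\<And>i. i \<in> I \<Longrightarrow> cmod (a i) < 1" and b: "\<And>i. i \<in> I \<Longrightarrow> cmod (b i) < 1"
    and \<sigma>: "\<And>i. i \<in> I \<Longrightarrow> \<sigma> i \<in> I" "\<And>i. i \<in> I \<Longrightarrow> \<sigma> (\<sigma> i) = i"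
    and ab: "\<And>i. i \<in> I \<Longrightarrow> a (\<sigma> i) = b i" "\<And>i. i \<in> I \<Longrightarrow> b (\<sigma> i) = a i"
    and \<phi>: "analytic2_on \<phi> symm_bidisc" "\<phi> ` symm_bidisc \<subseteq> cball 0 1"
  defines "F \<equiv> \<lambda>i. \<phi> (a i + b i, a i * b i)"
  obtains u where "\<And>i. i \<in> I \<Longrightarrow> u i \<in> carrier (fn_space I)"
    "\<And>i j. \<lbrakk>i \<in> I; j \<in> I\<rbrakk> \<Longrightarrow> 1 - cnj (F i) * F j = (1 - cnj (a i) * a j) * ip (fn_space I) (u j) (u i)
      + (1 - cnj (b i) * b j) * ip (fn_space I) (u (\<sigma> j)) (u (\<sigma> i))"
proof -
  define A where "A i j = 1 - cnj (F i) * F j" for i j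
  have A_herm: "A j i = cnj (A i j)" for i j by (simp add: A_def mult.commute)
  have A\<sigma>: "A (\<sigma> i) (\<sigma> j) = A i j" if "i \<in> I" "j \<in> I" for i j
    using ab that by (simp add: A_def F_def add.commute mult.commute)
  have dual: "0 \<le> Re (\<Sum>i\<in>I. \<Sum>j\<in>I. A i j * l i j)"
    if l: "psd I (\<lambda>i j. (1 - cnj (a i) * a j) * l i j)" "psd I (\<lambda>i j. (1 - cnj (b i) * b j) * l i j)" for l
    unfolding A_def F_def
  proof (rule ando_kernel_inequality_holomorphic[where f = "\<lambda>z w. \<phi> (z + w, z * w)", OF I a b l])
    show "(\<lambda>z. \<phi> (z + w, z * w)) holomorphic_on ball 0 1" if "cmod w < 1" for w
      by (rule holomorphic_on_slice[OF \<phi>(1) that])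
    show "(\<lambda>w. \<phi> (z + w, z * w)) holomorphic_on ball 0 1" if "cmod z < 1" for z
      using holomorphic_on_slice[OF \<phi>(1) that] by (simp add: add.commute mult.commute)
    show "cmod (\<phi> (z + w, z * w)) \<le> 1" if "cmod z < 1" "cmod w < 1" for z w
    proof -
      have "(z + w, z * w) \<in> symm_bidisc" using that by (auto simp: symm_bidisc_def)
      then have "\<phi> (z + w, z * w) \<in> cball 0 1" using \<phi>(2) by blast
      then show ?thesis by (simp add: dist_norm)
    qed
    show "isCont (\<lambda>p. \<phi> (fst p + snd p, fst p * snd p)) (a i, b i)" if "i \<in> I" for i
      by (rule isCont_symm[OF \<phi>(1) a[OF that] b[OF that]])
  qed
  obtain \<Gamma> \<Delta> where \<Gamma>: "psd I \<Gamma>" and \<Delta>: "psd I \<Delta>" and dec: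
    "\<And>i j. \<lbrakk>i \<in> I; j \<in> I\<rbrakk> \<Longrightarrow> A i j = (1 - cnj (a i) * a j) * \<Gamma> i j + (1 - cnj (b i) * b j) * \<Delta> i j"
    using cone_duality[where I = I and a = a and b = b and A = A, OF I a b A_herm dual] by blast
  have bij: "bij_betw \<sigma> I I"
    by (rule bij_betw_byWitness[of I \<sigma> \<sigma> I]) (use \<sigma> in auto)
  have "psd I (\<lambda>i j. \<Delta> (\<sigma> i) (\<sigma> j))"
    unfolding psd_def
  proof (intro conjI ballI allI)
    show "\<Delta> (\<sigma> j) (\<sigma> i) = cnj (\<Delta> (\<sigma> i) (\<sigma> j))" if "i \<in> I" "j \<in> I" for i j
      using psd_hermitian[OF \<Delta> \<sigma>(1)[OF that(1)] \<sigma>(1)[OF that(2)]] .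
    fix c
    have re: "(\<Sum>i\<in>I. f (\<sigma> i)) = (\<Sum>i\<in>I. f i)" for f :: "'i \<Rightarrow> complex"
      by (rule sum.reindex_bij_betw[OF bij])
    have "(\<Sum>i\<in>I. \<Sum>j\<in>I. cnj (c i) * c j * \<Delta> (\<sigma> i) (\<sigma> j))
      = (\<Sum>i\<in>I. \<Sum>j\<in>I. cnj (c (\<sigma> (\<sigma> i))) * c (\<sigma> (\<sigma> j)) * \<Delta> (\<sigma> i) (\<sigma> j))"
      by (intro sum.cong refl) (simp add: \<sigma>)
    also have "\<dots> = (\<Sum>i\<in>I. \<Sum>j\<in>I. cnj (c (\<sigma> i)) * c (\<sigma> j) * \<Delta> i j)"
      by (subst re[of "\<lambda>j. cnj (c (\<sigma> (\<sigma> _))) * c (\<sigma> j) * \<Delta> (\<sigma> _) j"], rule re)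
    finally show "0 \<le> Re (\<Sum>i\<in>I. \<Sum>j\<in>I. cnj (c i) * c j * \<Delta> (\<sigma> i) (\<sigma> j))"
      using psd_nonneg[OF \<Delta>, of "\<lambda>i. c (\<sigma> i)"] by simp
  qed
  \<comment> \<open>The other kernel of the averaged decomposition is this one with
    \<open>\<sigma>\<close> applied to both indices, so a single family \<open>u\<close> serves both
    slots.\<close>
  then have "psd I (\<lambda>i j. of_real (1/2) * (\<Gamma> i j + \<Delta> (\<sigma> i) (\<sigma> j)))"
    by (intro psd_scale psd_add \<Gamma>) auto
  from psd_gram[OF I this] obtain u where u: "\<And>i. i \<in> I \<Longrightarrow> u i \<in> carrier (fn_space I)"
    and gram: "\<And>i j. \<lbrakk>i \<in> I; j \<in> I\<rbrakk> \<Longrightarrow> of_real (1/2) * (\<Gamma> i j + \<Delta> (\<sigma> i) (\<sigma> j)) = ip (fn_space I) (u j) (u i)"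
    by blast
  have "A i j = (1 - cnj (a i) * a j) * ip (fn_space I) (u j) (u i)
      + (1 - cnj (b i) * b j) * ip (fn_space I) (u (\<sigma> j)) (u (\<sigma> i))" if ij: "i \<in> I" "j \<in> I" for i j
  proof -
    have 2: "A i j = (1 - cnj (b i) * b j) * \<Gamma> (\<sigma> i) (\<sigma> j) + (1 - cnj (a i) * a j) * \<Delta> (\<sigma> i) (\<sigma> j)"
      using dec[of "\<sigma> i" "\<sigma> j"] A\<sigma>[OF ij] \<sigma>(1) ij ab by simp
    have gram\<sigma>: "ip (fn_space I) (u (\<sigma> j)) (u (\<sigma> i)) = of_real (1/2) * (\<Gamma> (\<sigma> i) (\<sigma> j) + \<Delta> i j)"
      using gram[of "\<sigma> i" "\<sigma> j"] \<sigma> ij by simp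
    have "A i j = of_real (1/2) * (A i j + A i j)" by simp
    also have "\<dots> = of_real (1/2) * (((1 - cnj (a i) * a j) * \<Gamma> i j + (1 - cnj (b i) * b j) * \<Delta> i j)
      + ((1 - cnj (b i) * b j) * \<Gamma> (\<sigma> i) (\<sigma> j) + (1 - cnj (a i) * a j) * \<Delta> (\<sigma> i) (\<sigma> j)))"
      by (rule arg_cong2[OF dec[OF ij] 2, of "\<lambda>x y. of_real (1/2) * (x + y)"])
    also have "\<dots> = (1 - cnj (a i) * a j) * (of_real (1/2) * (\<Gamma> i j + \<Delta> (\<sigma> i) (\<sigma> j)))
      + (1 - cnj (b i) * b j) * (of_real (1/2) * (\<Gamma> (\<sigma> i) (\<sigma> j) + \<Delta> i j))"
      by (simp only: distrib_left mult.left_commute add_ac)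
    finally show ?thesis unfolding gram[OF ij] gram\<sigma> .
  qed
  then show thesis
    unfolding A_def by (intro that[of u] u)
qed

text \<open>Once the isometry \<open>T\<close> is found, both \<open>p j\<close> and
  \<open>p' j\<close> come from one vector \<open>c j\<close>, as its images under
  \<open>1 - z' T\<close> and \<open>1 - z T\<close>. These are the vectors in the first two terms
  on the right of \<open>symm_identity\<close>, whose third term vanishes for isometric
  \<open>T\<close>. So the identity turns \<open>dec1\<close> into the required Gram identity for
  \<open>s_T\<close>.\<close>

lemma (in hilbert_space) interpolation_model_of_gram:
  assumes zz': "\<And>j. j \<in> {1..n} \<Longrightarrow> s j = (z j + z' j, z j * z' j)"
      "\<And>j. j \<in> {1..n} \<Longrightarrow> cmod (z j) < 1" "\<And>j. j \<in> {1..n} \<Longrightarrow> cmod (z' j) < 1"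
    and pM: "\<And>j. j \<in> {1..n} \<Longrightarrow> p j \<in> carrier M" "\<And>j. j \<in> {1..n} \<Longrightarrow> p' j \<in> carrier M"
    and dec1: "\<And>i j. \<lbrakk>i \<in> {1..n}; j \<in> {1..n}\<rbrakk> \<Longrightarrow> 1 - cnj (w i) * w j
      = (1 - cnj (z i) * z j) * ip M (p j) (p i) + (1 - cnj (z' i) * z' j) * ip M (p' j) (p' i)"
    and dec2: "\<And>i j. \<lbrakk>i \<in> {1..n}; j \<in> {1..n}\<rbrakk> \<Longrightarrow> 1 - cnj (w i) * w j
      = (1 - cnj (z i) * z' j) * ip M (p' j) (p i) + (1 - cnj (z' i) * z j) * ip M (p j) (p' i)"
  shows "\<exists>T v. interpolation_model n s w M T v"
proof -
  have s: "s j \<in> symm_bidisc" if "j \<in> {1..n}" for j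
    using zz'[OF that] by (auto simp: symm_bidisc_def)
  define x where "x j = z j \<odot> p j \<ominus> z' j \<odot> p' j" for j
  define y where "y j = p j \<ominus> p' j" for j
  have xy: "x j \<in> carrier M" "y j \<in> carrier M" if "j \<in> {1..n}" for j
    using pM[OF that] by (auto simp: x_def y_def)
  have "ip M (x j) (x i) = ip M (y j) (y i)" if ij: "i \<in> {1..n}" "j \<in> {1..n}" for i j
  proof -
    have "(1 - cnj (z i) * z j) * ip M (p j) (p i) + (1 - cnj (z' i) * z' j) * ip M (p' j) (p' i)
      = (1 - cnj (z i) * z' j) * ip M (p' j) (p i) + (1 - cnj (z' i) * z j) * ip M (p j) (p' i)"
      using dec1[OF ij] dec2[OF ij] by simp
    then show ?thesis
      using pM[OF ij(1)] pM[OF ij(2)] by (simp add: x_def y_def ip_simps algebra_simps)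
  qed
  then have "\<exists>T T'. unitary_pair T T' \<and> (\<forall>j\<in>{1..n}. T (x j) = y j)"
    by (intro unitary_extension) (use xy in auto)
  then obtain T T' where TT': "unitary_pair T T'" and Txy: "\<And>j. j \<in> {1..n} \<Longrightarrow> T (x j) = y j"
    by blast
  note lin = unitary_pairD(1)[OF TT'] and ip_T = unitary_pairD(8)[OF TT']
  note [simp] = linear_opD[OF lin]
  have T: "contraction_op M T"
    by (rule contraction_opI[OF lin]) (simp add: hnorm_def ip_T)
  \<comment> \<open>The equation \<open>T (x j) = y j\<close>, rearranged; the common value will be
    \<open>(1 - z T) (1 - z' T) c\<close>.\<close>
  have Tp: "p j \<ominus> z j \<odot> T (p j) = p' j \<ominus> z' j \<odot> T (p' j)" if j: "j \<in> {1..n}" for j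
  proof -
    have eq: "z j \<odot> T (p j) \<ominus> z' j \<odot> T (p' j) = p j \<ominus> p' j"
      using Txy[OF j] pM[OF j] by (simp add: x_def y_def linear_op_diff[OF lin])
    have "z j * ip M (T (p j)) t - z' j * ip M (T (p' j)) t = ip M (p j) t - ip M (p' j) t"
      if "t \<in> carrier M" for t
      using arg_cong[OF eq, of "\<lambda>x. ip M x t"] that pM[OF j] by (simp add: ip_simps)
    then show ?thesis
      using pM[OF j] by (intro ip_eqI) (auto simp: ip_simps algebra_simps)
  qed
  have "\<exists>c. c \<in> carrier M \<and> p j = c \<ominus> z' j \<odot> T c \<and> p' j = c \<ominus> z j \<odot> T c" if j: "j \<in> {1..n}" for j
  proof -
    obtain c where c: "c \<in> carrier M" "p' j = c \<ominus> z j \<odot> T c"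
      using resolvent_solvable[OF T zz'(2)[OF j] pM(2)[OF j]] by blast
    define d where "d = c \<ominus> z' j \<odot> T c"
    have d: "d \<in> carrier M" using c by (simp add: d_def)
    \<comment> \<open>Both factors are polynomials in \<open>T\<close> and commute. Injectivity of
      \<open>1 - z T\<close> then identifies \<open>d\<close> with \<open>p j\<close>.\<close>
    have "d \<ominus> z j \<odot> T d = p' j \<ominus> z' j \<odot> T (p' j)"
      unfolding c(2) d_def using c(1)
      by (intro ip_eqI) (auto simp: linear_op_diff[OF lin] ip_simps algebra_simps)
    then have "p j = d"
      using resolvent_inj[OF T zz'(2)[OF j] pM(1)[OF j] d] Tp[OF j] by simp
    then show ?thesis using c d_def by blast
  qed
  then obtain c where c: "\<And>j. j \<in> {1..n} \<Longrightarrow> c j \<in> carrier M"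
    "\<And>j. j \<in> {1..n} \<Longrightarrow> p j = c j \<ominus> z' j \<odot> T (c j)"
    "\<And>j. j \<in> {1..n} \<Longrightarrow> p' j = c j \<ominus> z j \<odot> T (c j)" by metis
  \<comment> \<open>The scaling cancels the factor 2 in front of the two terms of
    \<open>symm_identity\<close>.\<close>
  define k where "k = complex_of_real (1 / sqrt 2)"
  have kk: "k * cnj k = 1 / 2"
    unfolding k_def by (simp flip: of_real_mult)
  define e where "e j = k \<odot> c j" for j
  define v where "v j = 2 \<odot> e j \<ominus> fst (s j) \<odot> T (e j)" for j
  have e: "e j \<in> carrier M" "v j \<in> carrier M" if "j \<in> {1..n}" for j
    using c(1)[OF that] by (auto simp: e_def v_def)
  have "interpolation_model n s w M T v"
    unfolding interpolation_model_def
  proof (intro conjI ballI)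
    show "hilbert_space M" by (rule hilbert_space_axioms)
    show "contraction_op M T" by (rule T)
    show "v j \<in> carrier M" if "j \<in> {1..n}" for j by (rule e(2)[OF that])
    fix i j assume ij: "i \<in> {1..n}" "j \<in> {1..n}"
    define S where "S j = symm_op M (s j) T (v j)" for j
    have S: "S j = (2 * snd (s j)) \<odot> T (e j) \<ominus> fst (s j) \<odot> e j" "S j \<in> carrier M" if j: "j \<in> {1..n}" for j
      using symm_op_apply[OF T s[OF j] e(1)[OF j]] e(1)[OF j] by (simp_all add: S_def v_def)
    note B = symm_op_bounded[OF T s[OF ij(1)]]
    have scaled: "e j \<ominus> z' j \<odot> T (e j) = k \<odot> p j"
      "e j \<ominus> z j \<odot> T (e j) = k \<odot> p' j" if j: "j \<in> {1..n}" for j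
      unfolding c(2)[OF j] c(3)[OF j] e_def using c(1)[OF j]
      by (auto intro!: ip_eqI simp: ip_simps algebra_simps)
    have "ip M (v j \<ominus> adjoint_op M (symm_op M (s i) T) (S j)) (v i) = ip M (v j) (v i) - ip M (S j) (S i)"
      using ip_adjoint_op[OF B e(2)[OF ij(1)] S(2)[OF ij(2)]] adjoint_op[OF B S(2)[OF ij(2)]]
        e(2)[OF ij(1)] e(2)[OF ij(2)] by (simp add: ip_diff_left S_def)
    also have "\<dots> = 2 * (1 - z j * cnj (z i)) * ip M (k \<odot> p j) (k \<odot> p i)
        + 2 * (1 - z' j * cnj (z' i)) * ip M (k \<odot> p' j) (k \<odot> p' i)
        + (z j - z' j) * cnj (z i - z' i) * (ip M (e j) (e i) - ip M (T (e j)) (T (e i)))"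
      using symm_identity[of "e j" "T (e j)" "e i" "T (e i)" "z j" "z' j" "z i" "z' i"] e(1)[OF ij(1)] e(1)[OF ij(2)]
      by (simp add: S(1)[OF ij(1)] S(1)[OF ij(2)] v_def zz'(1)[OF ij(1)] zz'(1)[OF ij(2)] scaled[OF ij(1)] scaled[OF ij(2)])
    also have "\<dots> = 2 * (k * cnj k) * ((1 - cnj (z i) * z j) * ip M (p j) (p i) + (1 - cnj (z' i) * z' j) * ip M (p' j) (p' i))"
      using pM[OF ij(1)] pM[OF ij(2)] e(1)[OF ij(1)] e(1)[OF ij(2)]
      by (simp add: ip_T ip_simps algebra_simps)
    also have "\<dots> = 1 - cnj (w i) * w j" by (simp add: kk dec1[OF ij])
    finally show "1 - cnj (w i) * w j
      = ip M (v j \<ominus> adjoint_op M (symm_op M (s i) T) (symm_op M (s j) T (v j))) (v i)"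
      by (simp add: S_def)
  qed
  then show ?thesis by blast
qed

text \<open>Numbering the points of the bidisc by natural numbers puts \<open>fn_space I\<close> on
  the prescribed carrier type.\<close>

theorem model_of_interpolation:
  assumes s: "\<And>j. j \<in> {1..n} \<Longrightarrow> s j \<in> symm_bidisc"
    and \<phi>: "analytic2_on \<phi> symm_bidisc" "\<phi> ` symm_bidisc \<subseteq> cball 0 1"
    and w: "\<And>j. j \<in> {1..n} \<Longrightarrow> \<phi> (s j) = w j"
  shows "\<exists>(M :: (nat \<Rightarrow> complex) hilbert) T v. interpolation_model n s w M T v"
proof -
  have "\<forall>j\<in>{1..n}. \<exists>z z'. s j = (z + z', z * z') \<and> cmod z < 1 \<and> cmod z' < 1"
    using s by (auto simp: symm_bidisc_def)
  then obtain z z' where zz': "\<And>j. j \<in> {1..n} \<Longrightarrow> s j = (z j + z' j, z j * z' j)"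
    "\<And>j. j \<in> {1..n} \<Longrightarrow> cmod (z j) < 1" "\<And>j. j \<in> {1..n} \<Longrightarrow> cmod (z' j) < 1" by metis
  text \<open>The index \<open>2 j\<close> stands for the point \<open>(z j, z' j)\<close> of the bidisc and \<open>2 j + 1\<close> for \<open>(z' j, z j)\<close>.\<close>
  define I where "I = {i. i div 2 \<in> {1..n}}"
  define \<sigma> where "\<sigma> i = (if even i then Suc i else i - 1)" for i :: nat
  define a where "a i = (if even i then z (i div 2) else z' (i div 2))" for i
  define b where "b i = (if even i then z' (i div 2) else z (i div 2))" for i
  have "I \<subseteq> {..2 * n + 1}" by (auto simp: I_def)
  then have I: "finite I" by (rule finite_subset) simp
  have \<sigma>_div: "\<sigma> i div 2 = i div 2" and \<sigma>_even: "even (\<sigma> i) \<longleftrightarrow> odd i" and \<sigma>\<sigma>: "\<sigma> (\<sigma> i) = i" for i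
    by (auto simp: \<sigma>_def elim!: oddE)
  have I2: "2 * j \<in> I" "Suc (2 * j) \<in> I" "\<sigma> (2 * j) = Suc (2 * j)" "\<sigma> (Suc (2 * j)) = 2 * j"
    "a (2 * j) = z j" "b (2 * j) = z' j" "a (Suc (2 * j)) = z' j" "b (Suc (2 * j)) = z j" if "j \<in> {1..n}" for j
    using that by (auto simp: I_def \<sigma>_def a_def b_def)
  define F where "F i = \<phi> (a i + b i, a i * b i)" for i
  obtain u where u: "\<And>i. i \<in> I \<Longrightarrow> u i \<in> carrier (fn_space I)" and dec:
    "\<And>i j. \<lbrakk>i \<in> I; j \<in> I\<rbrakk> \<Longrightarrow> 1 - cnj (F i) * F j = (1 - cnj (a i) * a j) * ip (fn_space I) (u j) (u i)
      + (1 - cnj (b i) * b j) * ip (fn_space I) (u (\<sigma> j)) (u (\<sigma> i))"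
  proof (rule symmetric_agler_decomposition[where I = I and a = a and b = b and \<sigma> = \<sigma> and \<phi> = \<phi>])
    show "cmod (a i) < 1" "cmod (b i) < 1" if "i \<in> I" for i
      using that zz'(2,3) by (auto simp: I_def a_def b_def)
    show "\<sigma> i \<in> I" if "i \<in> I" for i using that by (simp add: I_def \<sigma>_div)
    show "\<sigma> (\<sigma> i) = i" for i by (rule \<sigma>\<sigma>)
    show "a (\<sigma> i) = b i" "b (\<sigma> i) = a i" for i by (simp_all add: a_def b_def \<sigma>_div \<sigma>_even)
  qed (use I \<phi> in \<open>auto simp: F_def\<close>)
  interpret hilbert_space "fn_space I" by (rule hilbert_space_fn_space[OF I])
  have Fw: "F (2 * j) = w j" "F (Suc (2 * j)) = w j" if "j \<in> {1..n}" for j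
    using I2[OF that] zz'(1)[OF that] w[OF that] by (simp_all add: F_def add.commute mult.commute)
  have "\<exists>T v. interpolation_model n s w (fn_space I) T v"
  proof (rule interpolation_model_of_gram[OF zz'])
    show "u (2 * j) \<in> carrier (fn_space I)" "u (Suc (2 * j)) \<in> carrier (fn_space I)" if "j \<in> {1..n}" for j
      using u I2(1,2)[OF that] by blast+
    fix i j assume ij: "i \<in> {1..n}" "j \<in> {1..n}"
    show "1 - cnj (w i) * w j = (1 - cnj (z i) * z j) * ip (fn_space I) (u (2 * j)) (u (2 * i))
        + (1 - cnj (z' i) * z' j) * ip (fn_space I) (u (Suc (2 * j))) (u (Suc (2 * i)))"
      "1 - cnj (w i) * w j = (1 - cnj (z i) * z' j) * ip (fn_space I) (u (Suc (2 * j))) (u (2 * i))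
        + (1 - cnj (z' i) * z j) * ip (fn_space I) (u (2 * j)) (u (Suc (2 * i)))"
      \<comment> \<open>Even against even index gives the first identity, even against odd the
        second; the left-hand sides agree because \<open>F\<close> does not distinguish the two
        orderings of a pair.\<close>
      using dec[OF I2(1)[OF ij(1)] I2(1)[OF ij(2)]] dec[OF I2(1)[OF ij(1)] I2(2)[OF ij(2)]] Fw ij
      by (simp_all add: I2[OF ij(1)] I2[OF ij(2)])
  qed
  then show ?thesis by blast
qed

text \<open>Existence of a model cannot range over all types. The equivalence is stated for a fixed
  carrier type, and the implication from model to function is added for an arbitrary
  \<open>'a\<close>, so that models on other types are covered too.\<close>

theorem theorem5p1:
  fixes n :: nat and s :: "nat \<Rightarrow> complex \<times> complex" and w :: "nat \<Rightarrow> complex"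
  assumes "\<forall>j\<in>{1..n}. s j \<in> symm_bidisc"
    and "inj_on s {1..n}"
    and "\<forall>j\<in>{1..n}. w j \<in> cball 0 1"
  shows "((\<exists>\<phi>. analytic2_on \<phi> symm_bidisc \<and> \<phi> ` symm_bidisc \<subseteq> cball 0 1 \<and>
              (\<forall>j\<in>{1..n}. \<phi> (s j) = w j))
          \<longleftrightarrow> (\<exists>(M :: (nat \<Rightarrow> complex) hilbert) T v. interpolation_model n s w M T v))
       \<and> ((\<exists>(M :: 'a hilbert) T v. interpolation_model n s w M T v)
          \<longrightarrow> (\<exists>\<phi>. analytic2_on \<phi> symm_bidisc \<and> \<phi> ` symm_bidisc \<subseteq> cball 0 1 \<and>
                 (\<forall>j\<in>{1..n}. \<phi> (s j) = w j)))"
proof (intro conjI iffI impI)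
  have s: "\<And>j. j \<in> {1..n} \<Longrightarrow> s j \<in> symm_bidisc" using assms(1) by blast
  show "\<exists>(M :: (nat \<Rightarrow> complex) hilbert) T v. interpolation_model n s w M T v"
    if "\<exists>\<phi>. analytic2_on \<phi> symm_bidisc \<and> \<phi> ` symm_bidisc \<subseteq> cball 0 1 \<and> (\<forall>j\<in>{1..n}. \<phi> (s j) = w j)"
  proof -
    from that obtain \<phi> where "analytic2_on \<phi> symm_bidisc" "\<phi> ` symm_bidisc \<subseteq> cball 0 1"
      "\<And>j. j \<in> {1..n} \<Longrightarrow> \<phi> (s j) = w j" by blast
    with s show ?thesis by (rule model_of_interpolation)
  qed
  show "\<exists>\<phi>. analytic2_on \<phi> symm_bidisc \<and> \<phi> ` symm_bidisc \<subseteq> cball 0 1 \<and> (\<forall>j\<in>{1..n}. \<phi> (s j) = w j)"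
    if "\<exists>(M :: (nat \<Rightarrow> complex) hilbert) T v. interpolation_model n s w M T v"
    using that by (elim exE) (rule interpolation_of_model[OF _ s])
  show "\<exists>\<phi>. analytic2_on \<phi> symm_bidisc \<and> \<phi> ` symm_bidisc \<subseteq> cball 0 1 \<and> (\<forall>j\<in>{1..n}. \<phi> (s j) = w j)"
    if "\<exists>(M :: 'a hilbert) T v. interpolation_model n s w M T v"
    using that by (elim exE) (rule interpolation_of_model[OF _ s])
qed

end
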